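(* $\mathsf{ACA}_0$ proves: if $R$ is a countable integral domain in which every prime $\Sigma^0_1$-ideal is principal, then $R$ is a $\Sigma^0_1$-PID.
   Context: $\mathsf{ACA}_0$: basic arithmetic with comprehension for all arithmetical formulas. An integral domain is a commutative ring with unity without nonzero zero-divisors. A $\Sigma^0_1$-ideal is a sequence $\langle a_0,a_1,\ldots\rangle$ in $R$ such that for all $i,j$ and $r,s\in R$ there is $k$ with $a_k=a_ir+a_js$; $r\in\mathcal{I}$ means $\exists m\,r=a_m$; equality of $\Sigma^0_1$-ideals means mutual inclusion. A $\Sigma^0_1$-ideal $\mathcal{I}$ is prime if $ab\in\mathcal{I}$ implies $a\in\mathcal{I}$ or $b\in\mathcal{I}$, and principal if $\mathcal{I}=(c)=\{cr:r\in R\}$ for some $c$. $R$ is a $\Sigma^0_1$-PID if it is an integral domain in which every $\Sigma^0_1$-ideal is principal. *)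

theory Defs
  imports Main
begin

section \<open>The language of second-order arithmetic\<close>

text \<open>
  Two-sorted first-order syntax with named variables. Number variables and set variables live in
  separate namespaces, although both are named by strings. Following Simpson, equality is primitive
  for numbers only, and only the classical connectives falsum, implication and the two universal
  quantifiers are primitive.
\<close>

datatype tm =
    V string
  | Zero  (\<open>\<^bold>0\<close>)
  | One  (\<open>\<^bold>1\<close>)
  | Plus tm tm  (infixl \<open>\<^bold>+\<close> 65)
  | Times tm tm  (infixl \<open>\<^bold>*\<close> 70)

datatype fm =
    Eq tm tm  (infix \<open>\<^bold>=\<close> 50)
  | Less tm tm  (infix \<open>\<^bold><\<close> 50)
  | Mem tm string  (infix \<open>\<^bold>\<in>\<close> 50)
  | Falsum  (\<open>\<^bold>\<bottom>\<close>)
  | Imp fm fm  (infixr \<open>\<^bold>\<longrightarrow>\<close> 25)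
  | AllN string fm  (\<open>(3\<^bold>\<forall>_./ _)\<close> [1000, 10] 10)
  | AllS string fm  (\<open>(3\<^bold>\<forall>\<^sub>S_./ _)\<close> [1000, 10] 10)

definition Neg :: "fm \<Rightarrow> fm"  (\<open>\<^bold>\<not> _\<close> [40] 40)
  where "(\<^bold>\<not> \<phi>) = (\<phi> \<^bold>\<longrightarrow> \<^bold>\<bottom>)"

definition Conj :: "fm \<Rightarrow> fm \<Rightarrow> fm"  (infixr \<open>\<^bold>\<and>\<close> 35)
  where "(\<phi> \<^bold>\<and> \<psi>) = (\<^bold>\<not> (\<phi> \<^bold>\<longrightarrow> \<^bold>\<not> \<psi>))"

definition Disj :: "fm \<Rightarrow> fm \<Rightarrow> fm"  (infixr \<open>\<^bold>\<or>\<close> 30)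
  where "(\<phi> \<^bold>\<or> \<psi>) = (\<^bold>\<not> \<phi> \<^bold>\<longrightarrow> \<psi>)"

definition Iff :: "fm \<Rightarrow> fm \<Rightarrow> fm"  (infixr \<open>\<^bold>\<longleftrightarrow>\<close> 25)
  where "(\<phi> \<^bold>\<longleftrightarrow> \<psi>) = ((\<phi> \<^bold>\<longrightarrow> \<psi>) \<^bold>\<and> (\<psi> \<^bold>\<longrightarrow> \<phi>))"

definition ExN :: "string \<Rightarrow> fm \<Rightarrow> fm"  (\<open>(3\<^bold>\<exists>_./ _)\<close> [1000, 10] 10)
  where "(\<^bold>\<exists>x. \<phi>) = (\<^bold>\<not> (\<^bold>\<forall>x. \<^bold>\<not> \<phi>))"

definition ExS :: "string \<Rightarrow> fm \<Rightarrow> fm"  (\<open>(3\<^bold>\<exists>\<^sub>S_./ _)\<close> [1000, 10] 10)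
  where "(\<^bold>\<exists>\<^sub>SX. \<phi>) = (\<^bold>\<not> (\<^bold>\<forall>\<^sub>SX. \<^bold>\<not> \<phi>))"

primrec fv_tm :: "tm \<Rightarrow> string set" where
  "fv_tm (V x) = {x}"
| "fv_tm \<^bold>0 = {}"
| "fv_tm \<^bold>1 = {}"
| "fv_tm (s \<^bold>+ t) = fv_tm s \<union> fv_tm t"
| "fv_tm (s \<^bold>* t) = fv_tm s \<union> fv_tm t"

primrec fvN :: "fm \<Rightarrow> string set" where
  "fvN (s \<^bold>= t) = fv_tm s \<union> fv_tm t"
| "fvN (s \<^bold>< t) = fv_tm s \<union> fv_tm t"
| "fvN (t \<^bold>\<in> X) = fv_tm t"
| "fvN \<^bold>\<bottom> = {}"
| "fvN (\<phi> \<^bold>\<longrightarrow> \<psi>) = fvN \<phi> \<union> fvN \<psi>"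
| "fvN (\<^bold>\<forall>x. \<phi>) = fvN \<phi> - {x}"
| "fvN (\<^bold>\<forall>\<^sub>SX. \<phi>) = fvN \<phi>"

primrec fvS :: "fm \<Rightarrow> string set" where
  "fvS (s \<^bold>= t) = {}"
| "fvS (s \<^bold>< t) = {}"
| "fvS (t \<^bold>\<in> X) = {X}"
| "fvS \<^bold>\<bottom> = {}"
| "fvS (\<phi> \<^bold>\<longrightarrow> \<psi>) = fvS \<phi> \<union> fvS \<psi>"
| "fvS (\<^bold>\<forall>x. \<phi>) = fvS \<phi>"
| "fvS (\<^bold>\<forall>\<^sub>SX. \<phi>) = fvS \<phi> - {X}"

text \<open>
  Substitution does not rename bound variables; the inference rules below use it only where the
  substituted term is free for the variable, i.e. where nothing is captured.
\<close>

primrec subst_tm :: "string \<Rightarrow> tm \<Rightarrow> tm \<Rightarrow> tm" where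
  "subst_tm x u (V y) = (if y = x then u else V y)"
| "subst_tm x u \<^bold>0 = \<^bold>0"
| "subst_tm x u \<^bold>1 = \<^bold>1"
| "subst_tm x u (s \<^bold>+ t) = subst_tm x u s \<^bold>+ subst_tm x u t"
| "subst_tm x u (s \<^bold>* t) = subst_tm x u s \<^bold>* subst_tm x u t"

primrec substN :: "string \<Rightarrow> tm \<Rightarrow> fm \<Rightarrow> fm" where
  "substN x u (s \<^bold>= t) = (subst_tm x u s \<^bold>= subst_tm x u t)"
| "substN x u (s \<^bold>< t) = (subst_tm x u s \<^bold>< subst_tm x u t)"
| "substN x u (t \<^bold>\<in> X) = (subst_tm x u t \<^bold>\<in> X)"
| "substN x u \<^bold>\<bottom> = \<^bold>\<bottom>"
| "substN x u (\<phi> \<^bold>\<longrightarrow> \<psi>) = (substN x u \<phi> \<^bold>\<longrightarrow> substN x u \<psi>)"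
| "substN x u (\<^bold>\<forall>y. \<phi>) = (\<^bold>\<forall>y. if y = x then \<phi> else substN x u \<phi>)"
| "substN x u (\<^bold>\<forall>\<^sub>SX. \<phi>) = (\<^bold>\<forall>\<^sub>SX. substN x u \<phi>)"

primrec substS :: "string \<Rightarrow> string \<Rightarrow> fm \<Rightarrow> fm" where
  "substS X Y (s \<^bold>= t) = (s \<^bold>= t)"
| "substS X Y (s \<^bold>< t) = (s \<^bold>< t)"
| "substS X Y (t \<^bold>\<in> Z) = (t \<^bold>\<in> (if Z = X then Y else Z))"
| "substS X Y \<^bold>\<bottom> = \<^bold>\<bottom>"
| "substS X Y (\<phi> \<^bold>\<longrightarrow> \<psi>) = (substS X Y \<phi> \<^bold>\<longrightarrow> substS X Y \<psi>)"
| "substS X Y (\<^bold>\<forall>x. \<phi>) = (\<^bold>\<forall>x. substS X Y \<phi>)"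
| "substS X Y (\<^bold>\<forall>\<^sub>SZ. \<phi>) = (\<^bold>\<forall>\<^sub>SZ. if Z = X then \<phi> else substS X Y \<phi>)"

primrec free_forN :: "tm \<Rightarrow> string \<Rightarrow> fm \<Rightarrow> bool" where
  "free_forN u x (s \<^bold>= t) = True"
| "free_forN u x (s \<^bold>< t) = True"
| "free_forN u x (t \<^bold>\<in> X) = True"
| "free_forN u x \<^bold>\<bottom> = True"
| "free_forN u x (\<phi> \<^bold>\<longrightarrow> \<psi>) = (free_forN u x \<phi> \<and> free_forN u x \<psi>)"
| "free_forN u x (\<^bold>\<forall>y. \<phi>) = (x \<notin> fvN (\<^bold>\<forall>y. \<phi>) \<or> y \<notin> fv_tm u \<and> free_forN u x \<phi>)"
| "free_forN u x (\<^bold>\<forall>\<^sub>SX. \<phi>) = free_forN u x \<phi>"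

primrec free_forS :: "string \<Rightarrow> string \<Rightarrow> fm \<Rightarrow> bool" where
  "free_forS Y X (s \<^bold>= t) = True"
| "free_forS Y X (s \<^bold>< t) = True"
| "free_forS Y X (t \<^bold>\<in> Z) = True"
| "free_forS Y X \<^bold>\<bottom> = True"
| "free_forS Y X (\<phi> \<^bold>\<longrightarrow> \<psi>) = (free_forS Y X \<phi> \<and> free_forS Y X \<psi>)"
| "free_forS Y X (\<^bold>\<forall>x. \<phi>) = free_forS Y X \<phi>"
| "free_forS Y X (\<^bold>\<forall>\<^sub>SZ. \<phi>) = (X \<notin> fvS (\<^bold>\<forall>\<^sub>SZ. \<phi>) \<or> Z \<noteq> Y \<and> free_forS Y X \<phi>)"


section \<open>Provability\<close>

text \<open>Classical two-sorted natural deduction with equality on the number sort.\<close>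

inductive proves :: "fm set \<Rightarrow> fm \<Rightarrow> bool"  (infix \<open>\<turnstile>\<close> 5) where
  Assm: "\<phi> \<in> \<Gamma> \<Longrightarrow> \<Gamma> \<turnstile> \<phi>"
| Weak: "\<Gamma> \<turnstile> \<phi> \<Longrightarrow> \<Gamma> \<subseteq> \<Delta> \<Longrightarrow> \<Delta> \<turnstile> \<phi>"
| ImpI: "insert \<phi> \<Gamma> \<turnstile> \<psi> \<Longrightarrow> \<Gamma> \<turnstile> \<phi> \<^bold>\<longrightarrow> \<psi>"
| ImpE: "\<Gamma> \<turnstile> \<phi> \<^bold>\<longrightarrow> \<psi> \<Longrightarrow> \<Gamma> \<turnstile> \<phi> \<Longrightarrow> \<Gamma> \<turnstile> \<psi>"
| RAA: "insert (\<^bold>\<not> \<phi>) \<Gamma> \<turnstile> \<^bold>\<bottom> \<Longrightarrow> \<Gamma> \<turnstile> \<phi>"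
| AllNI: "\<Gamma> \<turnstile> \<phi> \<Longrightarrow> (\<forall>\<gamma>\<in>\<Gamma>. x \<notin> fvN \<gamma>) \<Longrightarrow> \<Gamma> \<turnstile> (\<^bold>\<forall>x. \<phi>)"
| AllNE: "\<Gamma> \<turnstile> (\<^bold>\<forall>x. \<phi>) \<Longrightarrow> free_forN t x \<phi> \<Longrightarrow> \<Gamma> \<turnstile> substN x t \<phi>"
| AllSI: "\<Gamma> \<turnstile> \<phi> \<Longrightarrow> (\<forall>\<gamma>\<in>\<Gamma>. X \<notin> fvS \<gamma>) \<Longrightarrow> \<Gamma> \<turnstile> (\<^bold>\<forall>\<^sub>SX. \<phi>)"
| AllSE: "\<Gamma> \<turnstile> (\<^bold>\<forall>\<^sub>SX. \<phi>) \<Longrightarrow> free_forS Y X \<phi> \<Longrightarrow> \<Gamma> \<turnstile> substS X Y \<phi>"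
| Refl: "\<Gamma> \<turnstile> t \<^bold>= t"
| Leibniz: "\<Gamma> \<turnstile> s \<^bold>= t \<Longrightarrow> \<Gamma> \<turnstile> substN x s \<phi> \<Longrightarrow> free_forN s x \<phi> \<Longrightarrow> free_forN t x \<phi>
    \<Longrightarrow> \<Gamma> \<turnstile> substN x t \<phi>"


section \<open>The system \<open>ACA\<^sub>0\<close>\<close>

definition basic_axioms :: "fm set" where
  "basic_axioms =
    (let m = V ''m''; n = V ''n'' in
     {\<^bold>\<forall>''n''. \<^bold>\<not> n \<^bold>+ \<^bold>1 \<^bold>= \<^bold>0,
      \<^bold>\<forall>''m''. \<^bold>\<forall>''n''. m \<^bold>+ \<^bold>1 \<^bold>= n \<^bold>+ \<^bold>1 \<^bold>\<longrightarrow> m \<^bold>= n,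
      \<^bold>\<forall>''m''. m \<^bold>+ \<^bold>0 \<^bold>= m,
      \<^bold>\<forall>''m''. \<^bold>\<forall>''n''. m \<^bold>+ (n \<^bold>+ \<^bold>1) \<^bold>= (m \<^bold>+ n) \<^bold>+ \<^bold>1,
      \<^bold>\<forall>''m''. m \<^bold>* \<^bold>0 \<^bold>= \<^bold>0,
      \<^bold>\<forall>''m''. \<^bold>\<forall>''n''. m \<^bold>* (n \<^bold>+ \<^bold>1) \<^bold>= (m \<^bold>* n) \<^bold>+ m,
      \<^bold>\<forall>''m''. \<^bold>\<not> m \<^bold>< \<^bold>0,
      \<^bold>\<forall>''m''. \<^bold>\<forall>''n''. m \<^bold>< n \<^bold>+ \<^bold>1 \<^bold>\<longleftrightarrow> (m \<^bold>< n \<^bold>\<or> m \<^bold>= n)})"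

definition induction_axiom :: fm where
  "induction_axiom =
    (let n = V ''n'' in
     \<^bold>\<forall>\<^sub>S''X''. \<^bold>0 \<^bold>\<in> ''X'' \<^bold>\<and> (\<^bold>\<forall>''n''. n \<^bold>\<in> ''X'' \<^bold>\<longrightarrow> n \<^bold>+ \<^bold>1 \<^bold>\<in> ''X'') \<^bold>\<longrightarrow> (\<^bold>\<forall>''n''. n \<^bold>\<in> ''X''))"

primrec arithmetical :: "fm \<Rightarrow> bool" where
  "arithmetical (s \<^bold>= t) = True"
| "arithmetical (s \<^bold>< t) = True"
| "arithmetical (t \<^bold>\<in> X) = True"
| "arithmetical \<^bold>\<bottom> = True"
| "arithmetical (\<phi> \<^bold>\<longrightarrow> \<psi>) = (arithmetical \<phi> \<and> arithmetical \<psi>)"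
| "arithmetical (\<^bold>\<forall>x. \<phi>) = arithmetical \<phi>"
| "arithmetical (\<^bold>\<forall>\<^sub>SX. \<phi>) = False"

definition universal_closures :: "fm \<Rightarrow> fm set" where
  "universal_closures \<phi> =
    {foldr AllN xs (foldr AllS Xs \<phi>) | xs Xs. fvN \<phi> \<subseteq> set xs \<and> fvS \<phi> \<subseteq> set Xs}"

text \<open>\<open>\<phi>\<close> may have number and set parameters other than \<open>n\<close> and \<open>X\<close>.\<close>

definition arithmetical_comprehension :: "fm set" where
  "arithmetical_comprehension =
    (\<Union>{universal_closures (\<^bold>\<exists>\<^sub>SX. \<^bold>\<forall>n. V n \<^bold>\<in> X \<^bold>\<longleftrightarrow> \<phi>) | X n \<phi>. arithmetical \<phi> \<and> X \<notin> fvS \<phi>})"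

definition ACA\<^sub>0 :: "fm set" where
  "ACA\<^sub>0 = basic_axioms \<union> {induction_axiom} \<union> arithmetical_comprehension"


section \<open>Countable rings and \<open>\<Sigma>\<^sup>0\<^sub>1\<close>-ideals\<close>

text \<open>
  As usual in reverse mathematics, a countable commutative ring is a set of numbers with a unary
  and two binary operations (sets of codes of tuples) and two distinguished elements. The set
  variables \<open>''R''\<close>, \<open>''add''\<close>, \<open>''neg''\<close>, \<open>''mul''\<close> and the number variables \<open>''zero''\<close>, \<open>''one''\<close>
  are reserved for these and stay free in the formulas below until the final sentence binds them.

  The string arguments of the formula-building functions are names of variables and must
  differ from the names bound inside.
\<close>

text \<open>Simpson's pairing function \<open>(i,j) = (i + j)\<^sup>2 + i\<close>, as a term of the object language.\<close>

definition pair :: "tm \<Rightarrow> tm \<Rightarrow> tm"  (\<open>\<llangle>_,/ _\<rrangle>\<close>)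
  where "\<llangle>s, t\<rrangle> = (s \<^bold>+ t) \<^bold>* (s \<^bold>+ t) \<^bold>+ s"

definition AllR :: "string list \<Rightarrow> fm \<Rightarrow> fm"  (\<open>(3\<^bold>\<forall>\<^sub>R_./ _)\<close> [1000, 10] 10)
  where "(\<^bold>\<forall>\<^sub>Rxs. \<phi>) = foldr (\<lambda>x \<psi>. \<^bold>\<forall>x. V x \<^bold>\<in> ''R'' \<^bold>\<longrightarrow> \<psi>) xs \<phi>"

definition ExR :: "string list \<Rightarrow> fm \<Rightarrow> fm"  (\<open>(3\<^bold>\<exists>\<^sub>R_./ _)\<close> [1000, 10] 10)
  where "(\<^bold>\<exists>\<^sub>Rxs. \<phi>) = foldr (\<lambda>x \<psi>. \<^bold>\<exists>x. V x \<^bold>\<in> ''R'' \<^bold>\<and> \<psi>) xs \<phi>"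

text \<open>\<open>maps1 F x y\<close> says \<open>F(x) = y\<close>, and \<open>maps2 F x y z\<close> says \<open>F(x,y) = z\<close>.\<close>

definition maps1 :: "string \<Rightarrow> string \<Rightarrow> string \<Rightarrow> fm"
  where "maps1 F x y = (\<llangle>V x, V y\<rrangle> \<^bold>\<in> F)"

definition maps2 :: "string \<Rightarrow> string \<Rightarrow> string \<Rightarrow> string \<Rightarrow> fm"
  where "maps2 F x y z = (\<llangle>\<llangle>V x, V y\<rrangle>, V z\<rrangle> \<^bold>\<in> F)"

abbreviation add_is :: "string \<Rightarrow> string \<Rightarrow> string \<Rightarrow> fm" where "add_is \<equiv> maps2 ''add''"
abbreviation mul_is :: "string \<Rightarrow> string \<Rightarrow> string \<Rightarrow> fm" where "mul_is \<equiv> maps2 ''mul''"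
abbreviation neg_is :: "string \<Rightarrow> string \<Rightarrow> fm" where "neg_is \<equiv> maps1 ''neg''"

text \<open>\<open>F : R \<rightarrow> R\<close>, \<open>F : R \<times> R \<rightarrow> R\<close> and \<open>A : \<nat> \<rightarrow> R\<close>, as sets of codes of pairs.\<close>

definition unary_op :: "string \<Rightarrow> fm" where
  "unary_op F =
    ((\<^bold>\<forall>''n''. V ''n'' \<^bold>\<in> F \<^bold>\<longrightarrow> (\<^bold>\<exists>\<^sub>R[''x'', ''y'']. V ''n'' \<^bold>= \<llangle>V ''x'', V ''y''\<rrangle>)) \<^bold>\<and>
     (\<^bold>\<forall>\<^sub>R[''x'']. \<^bold>\<exists>\<^sub>R[''y'']. maps1 F ''x'' ''y'') \<^bold>\<and>
     (\<^bold>\<forall>\<^sub>R[''x'', ''y'', ''z'']. maps1 F ''x'' ''y'' \<^bold>\<longrightarrow> maps1 F ''x'' ''z'' \<^bold>\<longrightarrow> V ''y'' \<^bold>= V ''z''))"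

definition binary_op :: "string \<Rightarrow> fm" where
  "binary_op F =
    ((\<^bold>\<forall>''n''. V ''n'' \<^bold>\<in> F \<^bold>\<longrightarrow>
        (\<^bold>\<exists>\<^sub>R[''x'', ''y'', ''z'']. V ''n'' \<^bold>= \<llangle>\<llangle>V ''x'', V ''y''\<rrangle>, V ''z''\<rrangle>)) \<^bold>\<and>
     (\<^bold>\<forall>\<^sub>R[''x'', ''y'']. \<^bold>\<exists>\<^sub>R[''z'']. maps2 F ''x'' ''y'' ''z'') \<^bold>\<and>
     (\<^bold>\<forall>\<^sub>R[''x'', ''y'', ''z'', ''w''].
        maps2 F ''x'' ''y'' ''z'' \<^bold>\<longrightarrow> maps2 F ''x'' ''y'' ''w'' \<^bold>\<longrightarrow> V ''z'' \<^bold>= V ''w''))"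

definition sequence_in_R :: "string \<Rightarrow> fm" where
  "sequence_in_R A =
    ((\<^bold>\<forall>''n''. V ''n'' \<^bold>\<in> A \<^bold>\<longrightarrow> (\<^bold>\<exists>''i''. \<^bold>\<exists>\<^sub>R[''x'']. V ''n'' \<^bold>= \<llangle>V ''i'', V ''x''\<rrangle>)) \<^bold>\<and>
     (\<^bold>\<forall>''i''. \<^bold>\<exists>\<^sub>R[''x'']. maps1 A ''i'' ''x'') \<^bold>\<and>
     (\<^bold>\<forall>''i''. \<^bold>\<forall>\<^sub>R[''x'', ''y'']. maps1 A ''i'' ''x'' \<^bold>\<longrightarrow> maps1 A ''i'' ''y'' \<^bold>\<longrightarrow> V ''x'' \<^bold>= V ''y''))"

definition commutative_ring :: fm where
  "commutative_ring =
    (V ''zero'' \<^bold>\<in> ''R'' \<^bold>\<and> V ''one'' \<^bold>\<in> ''R'' \<^bold>\<and>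
     binary_op ''add'' \<^bold>\<and> unary_op ''neg'' \<^bold>\<and> binary_op ''mul'' \<^bold>\<and>
     \<comment> \<open>\<open>(x + y) + z = x + (y + z)\<close>, \<open>x + y = y + x\<close>, \<open>x + 0 = x\<close>, \<open>x + (-x) = 0\<close>\<close>
     (\<^bold>\<forall>\<^sub>R[''x'', ''y'', ''z'', ''u'', ''v'', ''w''].
        add_is ''x'' ''y'' ''u'' \<^bold>\<longrightarrow> add_is ''y'' ''z'' ''v'' \<^bold>\<longrightarrow>
        add_is ''u'' ''z'' ''w'' \<^bold>\<longrightarrow> add_is ''x'' ''v'' ''w'') \<^bold>\<and>
     (\<^bold>\<forall>\<^sub>R[''x'', ''y'', ''z'']. add_is ''x'' ''y'' ''z'' \<^bold>\<longrightarrow> add_is ''y'' ''x'' ''z'') \<^bold>\<and>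
     (\<^bold>\<forall>\<^sub>R[''x'']. add_is ''x'' ''zero'' ''x'') \<^bold>\<and>
     (\<^bold>\<forall>\<^sub>R[''x'', ''y'']. neg_is ''x'' ''y'' \<^bold>\<longrightarrow> add_is ''x'' ''y'' ''zero'') \<^bold>\<and>
     \<comment> \<open>\<open>(x y) z = x (y z)\<close>, \<open>x y = y x\<close>, \<open>x 1 = x\<close>\<close>
     (\<^bold>\<forall>\<^sub>R[''x'', ''y'', ''z'', ''u'', ''v'', ''w''].
        mul_is ''x'' ''y'' ''u'' \<^bold>\<longrightarrow> mul_is ''y'' ''z'' ''v'' \<^bold>\<longrightarrow>
        mul_is ''u'' ''z'' ''w'' \<^bold>\<longrightarrow> mul_is ''x'' ''v'' ''w'') \<^bold>\<and>
     (\<^bold>\<forall>\<^sub>R[''x'', ''y'', ''z'']. mul_is ''x'' ''y'' ''z'' \<^bold>\<longrightarrow> mul_is ''y'' ''x'' ''z'') \<^bold>\<and>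
     (\<^bold>\<forall>\<^sub>R[''x'']. mul_is ''x'' ''one'' ''x'') \<^bold>\<and>
     \<comment> \<open>\<open>x (y + z) = x y + x z\<close>\<close>
     (\<^bold>\<forall>\<^sub>R[''x'', ''y'', ''z'', ''s'', ''u'', ''v'', ''w''].
        add_is ''y'' ''z'' ''s'' \<^bold>\<longrightarrow> mul_is ''x'' ''s'' ''w'' \<^bold>\<longrightarrow>
        mul_is ''x'' ''y'' ''u'' \<^bold>\<longrightarrow> mul_is ''x'' ''z'' ''v'' \<^bold>\<longrightarrow> add_is ''u'' ''v'' ''w''))"

text \<open>Neither \<open>0 \<noteq> 1\<close> for integral domains nor properness for prime ideals is required.\<close>

definition integral_domain :: fm where
  "integral_domain =
    (commutative_ring \<^bold>\<and>
     (\<^bold>\<forall>\<^sub>R[''x'', ''y'']. mul_is ''x'' ''y'' ''zero'' \<^bold>\<longrightarrow> V ''x'' \<^bold>= V ''zero'' \<^bold>\<or> V ''y'' \<^bold>= V ''zero''))"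

text \<open>For all \<open>i\<close>, \<open>j\<close> and \<open>r, s \<in> R\<close> there is \<open>k\<close> with \<open>a\<^sub>k = a\<^sub>i r + a\<^sub>j s\<close>; here \<open>x = a\<^sub>i\<close>, \<open>y = a\<^sub>j\<close>,
  \<open>z = a\<^sub>k\<close>, \<open>u = x r\<close> and \<open>v = y s\<close>.\<close>

definition sigma_ideal :: "string \<Rightarrow> fm" where
  "sigma_ideal A =
    (sequence_in_R A \<^bold>\<and>
     (\<^bold>\<forall>''i''. \<^bold>\<forall>''j''. \<^bold>\<forall>\<^sub>R[''r'', ''s'']. \<^bold>\<exists>''k''. \<^bold>\<exists>\<^sub>R[''x'', ''y'', ''z'', ''u'', ''v''].
        maps1 A ''i'' ''x'' \<^bold>\<and> maps1 A ''j'' ''y'' \<^bold>\<and> maps1 A ''k'' ''z'' \<^bold>\<and>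
        mul_is ''x'' ''r'' ''u'' \<^bold>\<and> mul_is ''y'' ''s'' ''v'' \<^bold>\<and> add_is ''u'' ''v'' ''z''))"

definition in_ideal :: "string \<Rightarrow> string \<Rightarrow> fm"
  where "in_ideal x A = (\<^bold>\<exists>''m''. maps1 A ''m'' x)"

definition prime_ideal :: "string \<Rightarrow> fm" where
  "prime_ideal A =
    (\<^bold>\<forall>\<^sub>R[''x'', ''y'', ''z'']. mul_is ''x'' ''y'' ''z'' \<^bold>\<longrightarrow> in_ideal ''z'' A \<^bold>\<longrightarrow>
       in_ideal ''x'' A \<^bold>\<or> in_ideal ''y'' A)"

definition principal_ideal :: "string \<Rightarrow> fm" where
  "principal_ideal A =
    (\<^bold>\<exists>\<^sub>R[''c'']. \<^bold>\<forall>\<^sub>R[''x'']. in_ideal ''x'' A \<^bold>\<longleftrightarrow> (\<^bold>\<exists>\<^sub>R[''r'']. mul_is ''c'' ''r'' ''x''))"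

definition sigma_PID :: fm where
  "sigma_PID = (integral_domain \<^bold>\<and> (\<^bold>\<forall>\<^sub>S''A''. sigma_ideal ''A'' \<^bold>\<longrightarrow> principal_ideal ''A''))"

definition for_all_R_structures :: "fm \<Rightarrow> fm" where
  "for_all_R_structures \<phi> =
    (\<^bold>\<forall>\<^sub>S''R''. \<^bold>\<forall>\<^sub>S''add''. \<^bold>\<forall>\<^sub>S''neg''. \<^bold>\<forall>\<^sub>S''mul''. \<^bold>\<forall>''zero''. \<^bold>\<forall>''one''. \<phi>)"

end

theory Submission
  imports Defs "HOL-Library.Countable_Set" "HOL-Algebra.Ring" "HOL-Algebra.Divisibility"
begin

text \<open>
  By completeness it suffices to argue in a model of \<open>ACA\<^sub>0\<close>, whose numbers may be nonstandard; the
  instances of comprehension that are needed avoid a reserved supply of variable names, so the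
  Henkin construction can do without renaming bound variables. In the model, finite sets are coded
  as in Goedel's \<open>\<beta>\<close>-function, and hence arithmetical relations can be iterated.

  Let every prime ideal be principal. If an ideal \<open>I\<close> is disjoint from a multiplicative set \<open>S\<close>, some
  prime ideal contains \<open>I\<close> and is disjoint from \<open>S\<close>. For \<open>S\<close> the set of products of units and primes
  and \<open>I = (a)\<close> with \<open>a \<noteq> 0\<close> outside \<open>S\<close>, a generator of that prime ideal would be a prime in \<open>S\<close>; so
  every nonzero \<open>a\<close> factors into primes. Given an ideal \<open>I\<close> with \<open>0 \<noteq> a \<in> I\<close>, choose \<open>d\<close> with
  \<open>I \<subseteq> (d)\<close> and \<open>a/d\<close> of least length. If \<open>(I : d)\<close> were proper, it would lie in some prime ideal \<open>(p)\<close>,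
  and \<open>d p\<close> would be a better choice. Hence \<open>I = (d)\<close>.
\<close>

section \<open>Derived rules\<close>

text \<open>The usual proof picks an ideal maximal among the non-principal ones and shows that it is
  prime; carried out directly, that search quantifies over ideals, that is over sets, and is no
  instance of arithmetical comprehension. The route taken is Kaplansky's criterion for unique
  factorization, in which every choice is made among ring elements: the ideals that are varied are
  colon ideals \<open>(J : e)\<close> determined by \<open>e\<close>, and containment of a fixed
  ideal in \<open>(d)\<close> is an arithmetical condition on \<open>d\<close>. Since numbers of the
  model may be nonstandard, HOL induction says nothing about them. Each induction, including the one
  on the number of prime factors, needs a property defined by a formula without set quantifiers; the
  predicate \<open>ar\<close> reduces that check to composing closure rules. Prime ideals may be the
  whole ring. Properness is therefore always obtained by keeping 1 in the multiplicative set that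
  the prime ideal has to avoid.\<close>

lemma proves_finite:
  "\<Gamma> \<turnstile> \<phi> \<Longrightarrow> \<exists>\<Delta>\<subseteq>\<Gamma>. finite \<Delta> \<and> (\<Delta> \<turnstile> \<phi>)"
proof (induction rule: proves.induct)
  case (Assm \<phi> \<Gamma>)
  then have "{\<phi>} \<subseteq> \<Gamma> \<and> finite {\<phi>} \<and> ({\<phi>} \<turnstile> \<phi>)" by (simp add: proves.Assm)
  then show ?case by blast
next
  case (Weak \<Gamma> \<phi> \<Delta>)
  then show ?case by (meson order_trans)
next
  case (ImpI \<phi> \<Gamma> \<psi>)
  then obtain D where D: "D \<subseteq> insert \<phi> \<Gamma>" "finite D" "D \<turnstile> \<psi>" by blast
  \<comment> \<open>The finite set may or may not contain the discharged hypothesis; removing it and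
    inserting it again covers both cases.\<close>
  have "insert \<phi> (D - {\<phi>}) \<turnstile> \<psi>" by (rule proves.Weak[OF D(3)]) blast
  then have "D - {\<phi>} \<turnstile> \<phi> \<^bold>\<longrightarrow> \<psi>" by (rule proves.ImpI)
  moreover have "D - {\<phi>} \<subseteq> \<Gamma>" "finite (D - {\<phi>})" using D by auto
  ultimately show ?case by blast
next
  case (ImpE \<Gamma> \<phi> \<psi>)
  then obtain D E where D: "D \<subseteq> \<Gamma>" "finite D" "D \<turnstile> \<phi> \<^bold>\<longrightarrow> \<psi>" "E \<subseteq> \<Gamma>" "finite E" "E \<turnstile> \<phi>" by blast
  have "D \<union> E \<turnstile> \<psi>"
    by (rule proves.ImpE[OF proves.Weak[OF D(3)] proves.Weak[OF D(6)]]) simp_all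
  moreover have "D \<union> E \<subseteq> \<Gamma>" "finite (D \<union> E)" using D by auto
  ultimately show ?case by blast
next
  case (RAA \<phi> \<Gamma>)
  then obtain D where D: "D \<subseteq> insert (\<^bold>\<not> \<phi>) \<Gamma>" "finite D" "D \<turnstile> \<^bold>\<bottom>" by blast
  have "insert (\<^bold>\<not> \<phi>) (D - {\<^bold>\<not> \<phi>}) \<turnstile> \<^bold>\<bottom>" by (rule proves.Weak[OF D(3)]) blast
  then have "D - {\<^bold>\<not> \<phi>} \<turnstile> \<phi>" by (rule proves.RAA)
  moreover have "D - {\<^bold>\<not> \<phi>} \<subseteq> \<Gamma>" "finite (D - {\<^bold>\<not> \<phi>})" using D by auto
  ultimately show ?case by blast
next
  case (AllNI \<Gamma> \<phi> x)
  then obtain D where D: "D \<subseteq> \<Gamma>" "finite D" "D \<turnstile> \<phi>" by blast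
  then have "D \<turnstile> (\<^bold>\<forall>x. \<phi>)" using AllNI(2) by (intro proves.AllNI) auto
  with D show ?case by blast
next
  case (AllNE \<Gamma> x \<phi> t)
  then obtain D where D: "D \<subseteq> \<Gamma>" "finite D" "D \<turnstile> (\<^bold>\<forall>x. \<phi>)" by blast
  then have "D \<turnstile> substN x t \<phi>" using AllNE(2) by (intro proves.AllNE)
  with D show ?case by blast
next
  case (AllSI \<Gamma> \<phi> X)
  then obtain D where D: "D \<subseteq> \<Gamma>" "finite D" "D \<turnstile> \<phi>" by blast
  then have "D \<turnstile> (\<^bold>\<forall>\<^sub>SX. \<phi>)" using AllSI(2) by (intro proves.AllSI) auto
  with D show ?case by blast
next
  case (AllSE \<Gamma> X \<phi> Y)
  then obtain D where D: "D \<subseteq> \<Gamma>" "finite D" "D \<turnstile> (\<^bold>\<forall>\<^sub>SX. \<phi>)" by blast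
  then have "D \<turnstile> substS X Y \<phi>" using AllSE(2) by (intro proves.AllSE)
  with D show ?case by blast
next
  case (Refl \<Gamma> t)
  have "{} \<turnstile> t \<^bold>= t" by (rule proves.Refl)
  then show ?case by blast
next
  case (Leibniz \<Gamma> s t x \<phi>)
  then obtain D E where D: "D \<subseteq> \<Gamma>" "finite D" "D \<turnstile> s \<^bold>= t" "E \<subseteq> \<Gamma>" "finite E" "E \<turnstile> substN x s \<phi>" by blast
  have "D \<union> E \<turnstile> substN x t \<phi>"
    by (rule proves.Leibniz[OF proves.Weak[OF D(3)] proves.Weak[OF D(6)] Leibniz(3,4)]) simp_all
  moreover have "D \<union> E \<subseteq> \<Gamma>" "finite (D \<union> E)" using D by auto
  ultimately show ?case by blast
qed

lemma NegE: "\<Gamma> \<turnstile> \<^bold>\<not> \<phi> \<Longrightarrow> \<Gamma> \<turnstile> \<phi> \<Longrightarrow> \<Gamma> \<turnstile> \<^bold>\<bottom>"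
  unfolding Neg_def by (rule ImpE)

lemma cut: "insert \<phi> \<Gamma> \<turnstile> \<psi> \<Longrightarrow> \<Gamma> \<turnstile> \<phi> \<Longrightarrow> \<Gamma> \<turnstile> \<psi>"
  by (rule ImpE, rule ImpI)

lemma explosion: "\<Gamma> \<turnstile> \<^bold>\<bottom> \<Longrightarrow> \<Gamma> \<turnstile> \<phi>"
  by (rule RAA, erule Weak) blast

lemma finite_fv_tm [simp]: "finite (fv_tm t)"
  by (induction t) auto

lemma finite_fvN [simp]: "finite (fvN \<phi>)"
  by (induction \<phi>) auto

lemma finite_fvS [simp]: "finite (fvS \<phi>)"
  by (induction \<phi>) auto

lemma subst_tm_fresh [simp]: "x \<notin> fv_tm t \<Longrightarrow> subst_tm x u t = t"
  by (induction t) auto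

lemma fresh_string: "finite F \<Longrightarrow> \<exists>x :: string. x \<notin> F"
  using ex_new_if_finite[OF infinite_UNIV_listI] by blast

text \<open>The Leibniz rule needs a template and a placeholder variable. Taking the placeholder
  outside a finite set \<open>F\<close>, in practice the variables of the terms that stay fixed,
  keeps the substitution from touching those terms; all equality rules follow this pattern.\<close>

lemma Eq_replace:
  assumes "\<Gamma> \<turnstile> s \<^bold>= t" and "\<And>x. x \<notin> F \<Longrightarrow> \<exists>\<phi>. substN x s \<phi> = A \<and> substN x t \<phi> = B \<and> free_forN s x \<phi> \<and> free_forN t x \<phi>"
    and "\<Gamma> \<turnstile> A" and "finite F"
  shows "\<Gamma> \<turnstile> B"
proof -
  obtain x where "x \<notin> F" using fresh_string assms(4) by blast
  with assms(2) obtain \<phi> where "substN x s \<phi> = A" "substN x t \<phi> = B" "free_forN s x \<phi>" "free_forN t x \<phi>" by blast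
  with assms show ?thesis using Leibniz by blast
qed

lemma Eq_sym: "\<Gamma> \<turnstile> s \<^bold>= t \<Longrightarrow> \<Gamma> \<turnstile> t \<^bold>= s"
  by (rule Eq_replace[where A = "s \<^bold>= s" and F = "fv_tm s"])
     (auto intro: Refl intro!: exI[of _ "V _ \<^bold>= s"])

lemma Eq_trans: "\<Gamma> \<turnstile> s \<^bold>= t \<Longrightarrow> \<Gamma> \<turnstile> t \<^bold>= u \<Longrightarrow> \<Gamma> \<turnstile> s \<^bold>= u"
  by (rule Eq_replace[where s = t and t = u and A = "s \<^bold>= t" and F = "fv_tm s"])
     (auto intro: Refl intro!: exI[of _ "s \<^bold>= V _"])

lemma Eq_Plus: "\<Gamma> \<turnstile> s \<^bold>= s' \<Longrightarrow> \<Gamma> \<turnstile> t \<^bold>= t' \<Longrightarrow> \<Gamma> \<turnstile> s \<^bold>+ t \<^bold>= s' \<^bold>+ t'"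
proof (rule Eq_trans)
  show "\<Gamma> \<turnstile> s \<^bold>= s' \<Longrightarrow> \<Gamma> \<turnstile> s \<^bold>+ t \<^bold>= s' \<^bold>+ t"
    by (rule Eq_replace[where A = "s \<^bold>+ t \<^bold>= s \<^bold>+ t" and F = "fv_tm s \<union> fv_tm t"])
       (auto intro: Refl intro!: exI[of _ "s \<^bold>+ t \<^bold>= V _ \<^bold>+ t"])
  show "\<Gamma> \<turnstile> t \<^bold>= t' \<Longrightarrow> \<Gamma> \<turnstile> s' \<^bold>+ t \<^bold>= s' \<^bold>+ t'"
    by (rule Eq_replace[where A = "s' \<^bold>+ t \<^bold>= s' \<^bold>+ t" and F = "fv_tm s' \<union> fv_tm t"])
       (auto intro: Refl intro!: exI[of _ "s' \<^bold>+ t \<^bold>= s' \<^bold>+ V _"])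
qed

lemma Eq_Times: "\<Gamma> \<turnstile> s \<^bold>= s' \<Longrightarrow> \<Gamma> \<turnstile> t \<^bold>= t' \<Longrightarrow> \<Gamma> \<turnstile> s \<^bold>* t \<^bold>= s' \<^bold>* t'"
proof (rule Eq_trans)
  show "\<Gamma> \<turnstile> s \<^bold>= s' \<Longrightarrow> \<Gamma> \<turnstile> s \<^bold>* t \<^bold>= s' \<^bold>* t"
    by (rule Eq_replace[where A = "s \<^bold>* t \<^bold>= s \<^bold>* t" and F = "fv_tm s \<union> fv_tm t"])
       (auto intro: Refl intro!: exI[of _ "s \<^bold>* t \<^bold>= V _ \<^bold>* t"])
  show "\<Gamma> \<turnstile> t \<^bold>= t' \<Longrightarrow> \<Gamma> \<turnstile> s' \<^bold>* t \<^bold>= s' \<^bold>* t'"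
    by (rule Eq_replace[where A = "s' \<^bold>* t \<^bold>= s' \<^bold>* t" and F = "fv_tm s' \<union> fv_tm t"])
       (auto intro: Refl intro!: exI[of _ "s' \<^bold>* t \<^bold>= s' \<^bold>* V _"])
qed

lemma Less_cong: "\<Gamma> \<turnstile> s \<^bold>= s' \<Longrightarrow> \<Gamma> \<turnstile> t \<^bold>= t' \<Longrightarrow> \<Gamma> \<turnstile> s \<^bold>< t \<Longrightarrow> \<Gamma> \<turnstile> s' \<^bold>< t'"
  by (rule Eq_replace[where s = t and t = t' and A = "s' \<^bold>< t" and F = "fv_tm s'"],
      assumption, (auto intro!: exI[of _ "s' \<^bold>< V _"])[1],
      rule Eq_replace[where s = s and t = s' and A = "s \<^bold>< t" and F = "fv_tm t"])
     (auto intro!: exI[of _ "V _ \<^bold>< t"])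

lemma Mem_cong: "\<Gamma> \<turnstile> s \<^bold>= s' \<Longrightarrow> \<Gamma> \<turnstile> s \<^bold>\<in> X \<Longrightarrow> \<Gamma> \<turnstile> s' \<^bold>\<in> X"
  by (rule Eq_replace[where s = s and t = s' and A = "s \<^bold>\<in> X" and F = "{}"])
     (auto intro!: exI[of _ "V _ \<^bold>\<in> X"])

section \<open>Semantics\<close>

locale soa_structure =
  fixes n0 n1 :: 'n and plus times :: "'n \<Rightarrow> 'n \<Rightarrow> 'n" and less :: "'n \<Rightarrow> 'n \<Rightarrow> bool"
    and sets :: "'n set set"
begin

primrec ev :: "(string \<Rightarrow> 'n) \<Rightarrow> tm \<Rightarrow> 'n" where
  "ev \<nu> (V x) = \<nu> x"
| "ev \<nu> \<^bold>0 = n0"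
| "ev \<nu> \<^bold>1 = n1"
| "ev \<nu> (s \<^bold>+ t) = plus (ev \<nu> s) (ev \<nu> t)"
| "ev \<nu> (s \<^bold>* t) = times (ev \<nu> s) (ev \<nu> t)"

primrec sat :: "(string \<Rightarrow> 'n) \<Rightarrow> (string \<Rightarrow> 'n set) \<Rightarrow> fm \<Rightarrow> bool" where
  "sat \<nu> \<Sigma> (s \<^bold>= t) = (ev \<nu> s = ev \<nu> t)"
| "sat \<nu> \<Sigma> (s \<^bold>< t) = less (ev \<nu> s) (ev \<nu> t)"
| "sat \<nu> \<Sigma> (t \<^bold>\<in> X) = (ev \<nu> t \<in> \<Sigma> X)"
| "sat \<nu> \<Sigma> \<^bold>\<bottom> = False"
| "sat \<nu> \<Sigma> (\<phi> \<^bold>\<longrightarrow> \<psi>) = (sat \<nu> \<Sigma> \<phi> \<longrightarrow> sat \<nu> \<Sigma> \<psi>)"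
| "sat \<nu> \<Sigma> (\<^bold>\<forall>x. \<phi>) = (\<forall>a. sat (\<nu>(x := a)) \<Sigma> \<phi>)"
| "sat \<nu> \<Sigma> (\<^bold>\<forall>\<^sub>SX. \<phi>) = (\<forall>A\<in>sets. sat \<nu> (\<Sigma>(X := A)) \<phi>)"

lemma sat_derived [simp]:
  "sat \<nu> \<Sigma> (\<^bold>\<not> \<phi>) = (\<not> sat \<nu> \<Sigma> \<phi>)"
  "sat \<nu> \<Sigma> (\<phi> \<^bold>\<and> \<psi>) = (sat \<nu> \<Sigma> \<phi> \<and> sat \<nu> \<Sigma> \<psi>)"
  "sat \<nu> \<Sigma> (\<phi> \<^bold>\<or> \<psi>) = (sat \<nu> \<Sigma> \<phi> \<or> sat \<nu> \<Sigma> \<psi>)"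
  "sat \<nu> \<Sigma> (\<phi> \<^bold>\<longleftrightarrow> \<psi>) = (sat \<nu> \<Sigma> \<phi> \<longleftrightarrow> sat \<nu> \<Sigma> \<psi>)"
  "sat \<nu> \<Sigma> (\<^bold>\<exists>x. \<phi>) = (\<exists>a. sat (\<nu>(x := a)) \<Sigma> \<phi>)"
  "sat \<nu> \<Sigma> (\<^bold>\<exists>\<^sub>SX. \<phi>) = (\<exists>A\<in>sets. sat \<nu> (\<Sigma>(X := A)) \<phi>)"
  by (auto simp: Neg_def Conj_def Disj_def Iff_def ExN_def ExS_def)

lemma ev_cong: "(\<And>x. x \<in> fv_tm t \<Longrightarrow> \<nu> x = \<nu>' x) \<Longrightarrow> ev \<nu> t = ev \<nu>' t"
  by (induction t) auto

lemma sat_cong: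
  "(\<And>x. x \<in> fvN \<phi> \<Longrightarrow> \<nu> x = \<nu>' x) \<Longrightarrow> (\<And>X. X \<in> fvS \<phi> \<Longrightarrow> \<Sigma> X = \<Sigma>' X) \<Longrightarrow> sat \<nu> \<Sigma> \<phi> = sat \<nu>' \<Sigma>' \<phi>"
proof (induction \<phi> arbitrary: \<nu> \<nu>' \<Sigma> \<Sigma>')
  case (Eq s t)
  then show ?case using ev_cong[of s \<nu> \<nu>'] ev_cong[of t \<nu> \<nu>'] by simp
next
  case (Less s t)
  then show ?case using ev_cong[of s \<nu> \<nu>'] ev_cong[of t \<nu> \<nu>'] by simp
next
  case (Mem t X)
  then show ?case using ev_cong[of t \<nu> \<nu>'] by simp
next
  case Falsum
  then show ?case by simp
next
  case (Imp \<phi> \<psi>)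
  have "sat \<nu> \<Sigma> \<phi> = sat \<nu>' \<Sigma>' \<phi>" "sat \<nu> \<Sigma> \<psi> = sat \<nu>' \<Sigma>' \<psi>"
    by (rule Imp.IH; use Imp.prems in simp)+
  then show ?case by simp
next
  case (AllN x \<phi>)
  have "sat (\<nu>(x := a)) \<Sigma> \<phi> = sat (\<nu>'(x := a)) \<Sigma>' \<phi>" for a
    by (rule AllN.IH) (use AllN.prems in auto)
  then show ?case by simp
next
  case (AllS X \<phi>)
  have "sat \<nu> (\<Sigma>(X := A)) \<phi> = sat \<nu>' (\<Sigma>'(X := A)) \<phi>" for A
    by (rule AllS.IH) (use AllS.prems in auto)
  then show ?case by simp
qed

end

text \<open>
  Substitution does not rename bound variables, so the Henkin witnesses are taken from a supply of
  names that the formulas under consideration do not bind.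
\<close>

definition reserved :: "string set" where
  "reserved = range ((#) (CHR ''~''))"

primrec clean :: "fm \<Rightarrow> bool" where
  "clean (s \<^bold>= t) = True"
| "clean (s \<^bold>< t) = True"
| "clean (t \<^bold>\<in> X) = True"
| "clean \<^bold>\<bottom> = True"
| "clean (\<phi> \<^bold>\<longrightarrow> \<psi>) = (clean \<phi> \<and> clean \<psi>)"
| "clean (\<^bold>\<forall>x. \<phi>) = (x \<notin> reserved \<and> clean \<phi>)"
| "clean (\<^bold>\<forall>\<^sub>SX. \<phi>) = (X \<notin> reserved \<and> clean \<phi>)"

text \<open>Reserved names play the part of Henkin constants: they occur only free, all other names
  only bound. With the two vocabularies separated, substituting a term over reserved names never
  captures anything.\<close>

definition proper :: "fm \<Rightarrow> bool" where
  "proper \<phi> \<longleftrightarrow> clean \<phi> \<and> fvN \<phi> \<subseteq> reserved \<and> fvS \<phi> \<subseteq> reserved"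

lemma fresh_reserved: "finite F \<Longrightarrow> \<exists>x\<in>reserved. x \<notin> F"
proof -
  assume "finite F"
  moreover have "infinite reserved"
    unfolding reserved_def by (simp add: finite_image_iff infinite_UNIV_listI)
  ultimately have "reserved - F \<noteq> {}"
    using Diff_infinite_finite infinite_imp_nonempty by blast
  then show ?thesis by blast
qed

lemma clean_derived [simp]:
  "clean (\<^bold>\<not> \<phi>) = clean \<phi>"
  "clean (\<phi> \<^bold>\<and> \<psi>) = (clean \<phi> \<and> clean \<psi>)"
  "clean (\<phi> \<^bold>\<or> \<psi>) = (clean \<phi> \<and> clean \<psi>)"
  "clean (\<phi> \<^bold>\<longleftrightarrow> \<psi>) = (clean \<phi> \<and> clean \<psi>)"
  "clean (\<^bold>\<exists>x. \<phi>) = (x \<notin> reserved \<and> clean \<phi>)"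
  "clean (\<^bold>\<exists>\<^sub>SX. \<phi>) = (X \<notin> reserved \<and> clean \<phi>)"
  by (auto simp: Neg_def Conj_def Disj_def Iff_def ExN_def ExS_def)

lemma proper_Imp [simp]: "proper (\<phi> \<^bold>\<longrightarrow> \<psi>) = (proper \<phi> \<and> proper \<psi>)"
  by (auto simp: proper_def)

lemma proper_Falsum [simp]: "proper \<^bold>\<bottom>"
  by (auto simp: proper_def)

lemma proper_Neg [simp]: "proper (\<^bold>\<not> \<phi>) = proper \<phi>"
  by (simp add: Neg_def)

lemma clean_substN [simp]: "clean (substN x u \<phi>) = clean \<phi>"
  by (induction \<phi>) auto

lemma clean_substS [simp]: "clean (substS X Y \<phi>) = clean \<phi>"
  by (induction \<phi>) auto

lemma size_substN [simp]: "size (substN x (u :: tm) \<phi>) = size \<phi>"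
  by (induction \<phi>) auto

lemma size_substS [simp]: "size (substS X Y \<phi>) = size \<phi>"
  by (induction \<phi>) auto

lemma fv_subst_tm: "fv_tm (subst_tm x u t) \<subseteq> (fv_tm t - {x}) \<union> fv_tm u"
  by (induction t) auto

lemma fvN_substN: "fvN (substN x u \<phi>) \<subseteq> (fvN \<phi> - {x}) \<union> fv_tm u"
proof (induction \<phi>)
  case (Eq s t)
  then show ?case using fv_subst_tm[of x u s] fv_subst_tm[of x u t] by auto
next
  case (Less s t)
  then show ?case using fv_subst_tm[of x u s] fv_subst_tm[of x u t] by auto
next
  case (Mem t X)
  then show ?case using fv_subst_tm[of x u t] by auto
qed auto

lemma fvS_substN [simp]: "fvS (substN x u \<phi>) = fvS \<phi>"
  by (induction \<phi>) auto

lemma fvN_substS [simp]: "fvN (substS X Y \<phi>) = fvN \<phi>"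
  by (induction \<phi>) auto

lemma fvS_substS: "fvS (substS X Y \<phi>) \<subseteq> (fvS \<phi> - {X}) \<union> {Y}"
  by (induction \<phi>) (auto split: if_splits)

lemma proper_substN: "proper (\<^bold>\<forall>x. \<phi>) \<Longrightarrow> fv_tm t \<subseteq> reserved \<Longrightarrow> proper (substN x t \<phi>)"
  using fvN_substN[of x t \<phi>] by (auto simp: proper_def)

lemma proper_substS: "proper (\<^bold>\<forall>\<^sub>SX. \<phi>) \<Longrightarrow> Y \<in> reserved \<Longrightarrow> proper (substS X Y \<phi>)"
  using fvS_substS[of X Y \<phi>] by (auto simp: proper_def)

lemma clean_free_forN: "clean \<phi> \<Longrightarrow> fv_tm t \<subseteq> reserved \<Longrightarrow> free_forN t x \<phi>"
  by (induction \<phi>) auto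

lemma clean_free_forS: "clean \<phi> \<Longrightarrow> Y \<in> reserved \<Longrightarrow> free_forS Y X \<phi>"
  by (induction \<phi>) auto

lemma subst_tm_inverse: "h \<notin> fv_tm t \<Longrightarrow> subst_tm h (V x) (subst_tm x (V h) t) = t"
  by (induction t) auto

lemma substN_fresh: "h \<notin> fvN \<phi> \<Longrightarrow> clean \<phi> \<Longrightarrow> h \<in> reserved \<Longrightarrow> substN h u \<phi> = \<phi>"
  by (induction \<phi>) auto

lemma substS_fresh: "H \<notin> fvS \<phi> \<Longrightarrow> clean \<phi> \<Longrightarrow> H \<in> reserved \<Longrightarrow> substS H Y \<phi> = \<phi>"
  by (induction \<phi>) auto

text \<open>A clean formula does not bind the reserved name \<open>h\<close>, so if \<open>h\<close>
  is also not free in it, every \<open>h\<close> after the renaming stems from \<open>x\<close>, and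
  the renaming can be undone. This stands in for renaming of bound variables.\<close>

lemma substN_inverse:
  "h \<notin> fvN \<phi> \<Longrightarrow> clean \<phi> \<Longrightarrow> h \<in> reserved \<Longrightarrow> substN h (V x) (substN x (V h) \<phi>) = \<phi>"
  by (induction \<phi>) (auto simp: subst_tm_inverse substN_fresh)

lemma substS_inverse:
  "H \<notin> fvS \<phi> \<Longrightarrow> clean \<phi> \<Longrightarrow> H \<in> reserved \<Longrightarrow> substS H X (substS X H \<phi>) = \<phi>"
  by (induction \<phi>) (auto simp: substS_fresh)

lemma free_forN_fresh: "h \<notin> fvN \<phi> \<Longrightarrow> clean \<phi> \<Longrightarrow> h \<in> reserved \<Longrightarrow> free_forN u h \<phi>"
  by (induction \<phi>) auto

lemma free_forS_fresh: "H \<notin> fvS \<phi> \<Longrightarrow> clean \<phi> \<Longrightarrow> H \<in> reserved \<Longrightarrow> free_forS Y H \<phi>"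
  by (induction \<phi>) auto

lemma free_forN_inverse:
  "h \<notin> fvN \<phi> \<Longrightarrow> clean \<phi> \<Longrightarrow> h \<in> reserved \<Longrightarrow> free_forN (V x) h (substN x (V h) \<phi>)"
  by (induction \<phi>) (auto simp: free_forN_fresh)

lemma free_forS_inverse:
  "H \<notin> fvS \<phi> \<Longrightarrow> clean \<phi> \<Longrightarrow> H \<in> reserved \<Longrightarrow> free_forS X H (substS X H \<phi>)"
  by (induction \<phi>) (auto simp: free_forS_fresh)

context soa_structure
begin

lemma ev_subst_tm: "ev \<nu> (subst_tm x u t) = ev (\<nu>(x := ev \<nu> u)) t"
  by (induction t) auto

lemma sat_substN:
  "clean \<phi> \<Longrightarrow> fv_tm u \<subseteq> reserved \<Longrightarrow> sat \<nu> \<Sigma> (substN x u \<phi>) = sat (\<nu>(x := ev \<nu> u)) \<Sigma> \<phi>"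
proof (induction \<phi> arbitrary: \<nu> \<Sigma>)
  case (AllN y \<phi>)
  \<comment> \<open>The bound \<open>y\<close> is unreserved while all variables of \<open>u\<close>
    are reserved, so updating \<open>y\<close> leaves the value of \<open>u\<close> alone.\<close>
  have "ev (\<nu>(y := a)) u = ev \<nu> u" for a
    by (rule ev_cong) (use AllN.prems in auto)
  moreover have "sat \<nu>' \<Sigma> (substN x u \<phi>) = sat (\<nu>'(x := ev \<nu>' u)) \<Sigma> \<phi>" for \<nu>'
    by (rule AllN.IH) (use AllN.prems in auto)
  ultimately show ?case by (cases "y = x") (simp_all add: fun_upd_twist[of y x] del: fun_upd_apply)
qed (auto simp: ev_subst_tm)

lemma sat_substS:
  "clean \<phi> \<Longrightarrow> Y \<in> reserved \<Longrightarrow> sat \<nu> \<Sigma> (substS X Y \<phi>) = sat \<nu> (\<Sigma>(X := \<Sigma> Y)) \<phi>"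
proof (induction \<phi> arbitrary: \<nu> \<Sigma>)
  case (AllS Z \<phi>)
  then have "Z \<noteq> Y" by auto
  moreover have "sat \<nu> \<Sigma>' (substS X Y \<phi>) = sat \<nu> (\<Sigma>'(X := \<Sigma>' Y)) \<phi>" for \<Sigma>'
    by (rule AllS.IH) (use AllS.prems in auto)
  ultimately show ?case by (cases "Z = X") (simp_all add: fun_upd_twist[of Z X] fun_upd_other del: fun_upd_apply)
qed auto

end

section \<open>Completeness\<close>

instance tm :: countable by countable_datatype
instance fm :: countable by countable_datatype

text \<open>A stage contains infinitely many axioms, so it is the finiteness of its set of free
  variables that leaves a fresh reserved name for the next witness.\<close>

definition henkin_stage :: "fm set \<Rightarrow> bool" where
  "henkin_stage \<Gamma> \<longleftrightarrow> \<not> (\<Gamma> \<turnstile> \<^bold>\<bottom>) \<and> (\<forall>\<gamma>\<in>\<Gamma>. proper \<gamma>) \<and> finite (\<Union>(fvN ` \<Gamma>)) \<and> finite (\<Union>(fvS ` \<Gamma>))"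

text \<open>The witnesses against a universal formula are variables of the given language rather
  than new constants. So the language does not grow, and one stage per formula suffices.\<close>

definition settles :: "fm set \<Rightarrow> fm \<Rightarrow> bool" where
  "settles \<Gamma> \<phi> \<longleftrightarrow> (\<phi> \<in> \<Gamma> \<or> (\<^bold>\<not> \<phi>) \<in> \<Gamma>) \<and>
     (\<forall>x \<psi>. \<phi> = (\<^bold>\<forall>x. \<psi>) \<longrightarrow> \<phi> \<in> \<Gamma> \<or> (\<exists>h\<in>reserved. (\<^bold>\<not> substN x (V h) \<psi>) \<in> \<Gamma>)) \<and>
     (\<forall>X \<psi>. \<phi> = (\<^bold>\<forall>\<^sub>SX. \<psi>) \<longrightarrow> \<phi> \<in> \<Gamma> \<or> (\<exists>H\<in>reserved. (\<^bold>\<not> substS X H \<psi>) \<in> \<Gamma>))"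

lemma settles_mono: "settles \<Gamma> \<phi> \<Longrightarrow> \<Gamma> \<subseteq> \<Delta> \<Longrightarrow> settles \<Delta> \<phi>"
  unfolding settles_def by blast

text \<open>One generalizes over \<open>h\<close>, instantiates back to \<open>x\<close>, and
  generalizes over \<open>x\<close>. This is why neither \<open>h\<close> nor \<open>x\<close> may
  be free in the hypotheses.\<close>

lemma AllN_from_fresh:
  assumes "\<Gamma> \<turnstile> substN x (V h) \<psi>" and "\<forall>\<gamma>\<in>\<Gamma>. h \<notin> fvN \<gamma> \<and> x \<notin> fvN \<gamma>"
    and "h \<notin> fvN \<psi>" "clean \<psi>" "h \<in> reserved"
  shows "\<Gamma> \<turnstile> (\<^bold>\<forall>x. \<psi>)"
proof -
  have "\<Gamma> \<turnstile> (\<^bold>\<forall>h. substN x (V h) \<psi>)" using assms by (intro AllNI) auto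
  from AllNE[OF this free_forN_inverse[OF assms(3-5)]] have "\<Gamma> \<turnstile> \<psi>"
    by (simp add: substN_inverse[OF assms(3-5)])
  then show ?thesis using assms(2) by (intro AllNI) auto
qed

lemma AllS_from_fresh:
  assumes "\<Gamma> \<turnstile> substS X H \<psi>" and "\<forall>\<gamma>\<in>\<Gamma>. H \<notin> fvS \<gamma> \<and> X \<notin> fvS \<gamma>"
    and "H \<notin> fvS \<psi>" "clean \<psi>" "H \<in> reserved"
  shows "\<Gamma> \<turnstile> (\<^bold>\<forall>\<^sub>SX. \<psi>)"
proof -
  have "\<Gamma> \<turnstile> (\<^bold>\<forall>\<^sub>SH. substS X H \<psi>)" using assms by (intro AllSI) auto
  from AllSE[OF this free_forS_inverse[OF assms(3-5)]] have "\<Gamma> \<turnstile> \<psi>"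
    by (simp add: substS_inverse[OF assms(3-5)])
  then show ?thesis using assms(2) by (intro AllSI) auto
qed

lemma henkin_stage_insert:
  "henkin_stage \<Gamma> \<Longrightarrow> proper \<phi> \<Longrightarrow> henkin_stage (insert \<phi> \<Gamma>) \<longleftrightarrow> \<not> (insert \<phi> \<Gamma> \<turnstile> \<^bold>\<bottom>)"
  by (auto simp: henkin_stage_def)

lemma henkin_step:
  assumes \<Gamma>: "henkin_stage \<Gamma>" and \<phi>: "proper \<phi>"
  shows "\<exists>\<Delta>. \<Gamma> \<subseteq> \<Delta> \<and> henkin_stage \<Delta> \<and> settles \<Delta> \<phi>"
proof (cases "insert \<phi> \<Gamma> \<turnstile> \<^bold>\<bottom>")
  case False
  then show ?thesis using assms henkin_stage_insert
    by (intro exI[of _ "insert \<phi> \<Gamma>"]) (auto simp: settles_def)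
next
  case True
  let ?\<Delta> = "insert (\<^bold>\<not> \<phi>) \<Gamma>"
  have nphi: "\<not> (?\<Delta> \<turnstile> \<phi>)"
  proof
    assume "?\<Delta> \<turnstile> \<phi>"
    then have "?\<Delta> \<turnstile> \<^bold>\<bottom>" by (rule NegE[rotated]) (simp add: Assm)
    then have "\<Gamma> \<turnstile> \<phi>" by (rule RAA)
    with True have "\<Gamma> \<turnstile> \<^bold>\<bottom>" by (rule cut)
    with \<Gamma> show False by (simp add: henkin_stage_def)
  qed
  then have \<Delta>: "henkin_stage ?\<Delta>" using assms explosion by (subst henkin_stage_insert) auto
  consider (N) x \<psi> where "\<phi> = (\<^bold>\<forall>x. \<psi>)" | (S) X \<psi> where "\<phi> = (\<^bold>\<forall>\<^sub>SX. \<psi>)"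
    | (other) "\<forall>x \<psi>. \<phi> \<noteq> (\<^bold>\<forall>x. \<psi>)" "\<forall>X \<psi>. \<phi> \<noteq> (\<^bold>\<forall>\<^sub>SX. \<psi>)" by blast
  then show ?thesis
  proof cases
    case N
    have "finite (\<Union>(fvN ` ?\<Delta>) \<union> fvN \<psi>)" using \<Delta> by (simp add: henkin_stage_def)
    then obtain h where h: "h \<in> reserved" "h \<notin> \<Union>(fvN ` ?\<Delta>) \<union> fvN \<psi>" using fresh_reserved by blast
    \<comment> \<open>The bound name \<open>x\<close> is unreserved, whereas proper formulas have
      only reserved free variables.\<close>
    have x: "x \<notin> fvN \<gamma>" if "\<gamma> \<in> ?\<Delta>" for \<gamma>
    proof -
      have "x \<notin> reserved" using \<phi> N by (simp add: proper_def)
      moreover have "proper \<gamma>" using \<Delta> that unfolding henkin_stage_def by blast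
      ultimately show ?thesis by (auto simp: proper_def)
    qed
    have "\<not> (insert (\<^bold>\<not> substN x (V h) \<psi>) ?\<Delta> \<turnstile> \<^bold>\<bottom>)"
    proof
      assume "insert (\<^bold>\<not> substN x (V h) \<psi>) ?\<Delta> \<turnstile> \<^bold>\<bottom>"
      then have "?\<Delta> \<turnstile> substN x (V h) \<psi>" by (rule RAA)
      then have "?\<Delta> \<turnstile> \<phi>" unfolding N
        by (rule AllN_from_fresh) (use h x N \<phi> in \<open>auto simp: proper_def\<close>)
      with nphi show False ..
    qed
    moreover have "proper (\<^bold>\<not> substN x (V h) \<psi>)" using \<phi> N h by (simp add: proper_substN)
    ultimately have "henkin_stage (insert (\<^bold>\<not> substN x (V h) \<psi>) ?\<Delta>)"
      using \<Delta> by (simp add: henkin_stage_insert)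
    moreover have "settles (insert (\<^bold>\<not> substN x (V h) \<psi>) ?\<Delta>) \<phi>"
      unfolding settles_def N using h(1) by simp blast
    ultimately show ?thesis by (intro exI[of _ "insert (\<^bold>\<not> substN x (V h) \<psi>) ?\<Delta>"]) auto
  next
    case S
    have "finite (\<Union>(fvS ` ?\<Delta>) \<union> fvS \<psi>)" using \<Delta> by (simp add: henkin_stage_def)
    then obtain H where h: "H \<in> reserved" "H \<notin> \<Union>(fvS ` ?\<Delta>) \<union> fvS \<psi>" using fresh_reserved by blast
    have x: "X \<notin> fvS \<gamma>" if "\<gamma> \<in> ?\<Delta>" for \<gamma>
    proof -
      have "X \<notin> reserved" using \<phi> S by (simp add: proper_def)
      moreover have "proper \<gamma>" using \<Delta> that unfolding henkin_stage_def by blast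
      ultimately show ?thesis by (auto simp: proper_def)
    qed
    have "\<not> (insert (\<^bold>\<not> substS X H \<psi>) ?\<Delta> \<turnstile> \<^bold>\<bottom>)"
    proof
      assume "insert (\<^bold>\<not> substS X H \<psi>) ?\<Delta> \<turnstile> \<^bold>\<bottom>"
      then have "?\<Delta> \<turnstile> substS X H \<psi>" by (rule RAA)
      then have "?\<Delta> \<turnstile> \<phi>" unfolding S
        by (rule AllS_from_fresh) (use h x S \<phi> in \<open>auto simp: proper_def\<close>)
      with nphi show False ..
    qed
    moreover have "proper (\<^bold>\<not> substS X H \<psi>)" using \<phi> S h by (simp add: proper_substS)
    ultimately have "henkin_stage (insert (\<^bold>\<not> substS X H \<psi>) ?\<Delta>)"
      using \<Delta> by (simp add: henkin_stage_insert)
    moreover have "settles (insert (\<^bold>\<not> substS X H \<psi>) ?\<Delta>) \<phi>"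
      unfolding settles_def S using h(1) by simp blast
    ultimately show ?thesis by (intro exI[of _ "insert (\<^bold>\<not> substS X H \<psi>) ?\<Delta>"]) auto
  next
    case other
    with \<Delta> show ?thesis by (intro exI[of _ ?\<Delta>]) (auto simp: settles_def)
  qed
qed

lemma union_chain_consistent:
  assumes "\<And>n :: nat. C n \<subseteq> C (Suc n)" and "\<And>n. \<not> (C n \<turnstile> \<^bold>\<bottom>)"
  shows "\<not> ((\<Union>n. C n) \<turnstile> \<^bold>\<bottom>)"
proof
  assume "(\<Union>n. C n) \<turnstile> \<^bold>\<bottom>"
  then obtain D where D: "D \<subseteq> (\<Union>n. C n)" "finite D" "D \<turnstile> \<^bold>\<bottom>" using proves_finite by blast
  have mono: "C i \<subseteq> C j" if "i \<le> j" for i j using lift_Suc_mono_le[of C, OF assms(1) that] .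
  have "\<exists>n. D \<subseteq> C n" using D(2,1)
  proof (induction rule: finite_induct)
    case empty
    then show ?case by blast
  next
    case (insert \<phi> D)
    then obtain i j where "D \<subseteq> C i" "\<phi> \<in> C j" by auto
    then have "insert \<phi> D \<subseteq> C (max i j)" using mono[of i "max i j"] mono[of j "max i j"] by auto
    then show ?case ..
  qed
  with D(3) assms(2) Weak show False by blast
qed

lemma henkin_extension:
  assumes "henkin_stage \<Gamma>"
  shows "\<exists>S. \<Gamma> \<subseteq> S \<and> \<not> (S \<turnstile> \<^bold>\<bottom>) \<and> (\<forall>\<gamma>\<in>S. proper \<gamma>) \<and> (\<forall>\<phi>. proper \<phi> \<longrightarrow> settles S \<phi>)"
proof -
  have "\<exists>C. \<forall>n. (henkin_stage (C n) \<and> (n = 0 \<longrightarrow> C n = \<Gamma>)) \<and>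
      C n \<subseteq> C (Suc n) \<and> (proper (from_nat n) \<longrightarrow> settles (C (Suc n)) (from_nat n))"
  proof (rule dependent_nat_choice)
    show "\<exists>D. henkin_stage D \<and> ((0 :: nat) = 0 \<longrightarrow> D = \<Gamma>)" using assms by blast
    fix D and n :: nat
    assume "henkin_stage D \<and> (n = 0 \<longrightarrow> D = \<Gamma>)"
    then show "\<exists>E. (henkin_stage E \<and> (Suc n = 0 \<longrightarrow> E = \<Gamma>)) \<and> D \<subseteq> E \<and>
        (proper (from_nat n) \<longrightarrow> settles E (from_nat n))"
      using henkin_step[of D "from_nat n"] by (cases "proper (from_nat n)") auto
  qed
  then obtain C where "\<forall>n. (henkin_stage (C n) \<and> (n = 0 \<longrightarrow> C n = \<Gamma>)) \<and>
      C n \<subseteq> C (Suc n) \<and> (proper (from_nat n) \<longrightarrow> settles (C (Suc n)) (from_nat n))" ..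
  then have C: "\<And>n. henkin_stage (C n)" "C 0 = \<Gamma>" "\<And>n. C n \<subseteq> C (Suc n)"
    "\<And>n. proper (from_nat n) \<Longrightarrow> settles (C (Suc n)) (from_nat n)" by simp_all
  let ?S = "\<Union>n. C n"
  have "\<not> (?S \<turnstile> \<^bold>\<bottom>)" using C by (intro union_chain_consistent) (auto simp: henkin_stage_def)
  moreover have "settles ?S \<phi>" if "proper \<phi>" for \<phi>
    using C(4)[of "to_nat \<phi>"] that by (auto intro: settles_mono)
  moreover have "\<Gamma> \<subseteq> ?S" using C(2) by blast
  moreover have "\<forall>\<gamma>\<in>?S. proper \<gamma>" using C(1) by (auto simp: henkin_stage_def)
  ultimately show ?thesis by blast
qed

section \<open>The term model of a complete Henkin theory\<close>

abbreviation Hterm :: "tm \<Rightarrow> bool" where "Hterm t \<equiv> fv_tm t \<subseteq> reserved"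

primrec numeral_tm :: "nat \<Rightarrow> tm" where
  "numeral_tm 0 = \<^bold>0"
| "numeral_tm (Suc n) = numeral_tm n \<^bold>+ \<^bold>1"

lemma Hterm_numeral [simp]: "fv_tm (numeral_tm n) = {}"
  by (induction n) auto

text \<open>The two successor axioms make the numerals pairwise distinct in \<open>S\<close>. Hence
  there are infinitely many classes of terms, and the model can be placed on the type
  \<open>nat\<close>.\<close>

locale henkin =
  fixes S :: "fm set"
  assumes consistent: "\<not> (S \<turnstile> \<^bold>\<bottom>)"
    and proper: "\<gamma> \<in> S \<Longrightarrow> proper \<gamma>"
    and settled: "proper \<phi> \<Longrightarrow> settles S \<phi>"
    and Suc_not_zero: "(\<^bold>\<forall>''n''. \<^bold>\<not> V ''n'' \<^bold>+ \<^bold>1 \<^bold>= \<^bold>0) \<in> S"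
    and Suc_inject: "(\<^bold>\<forall>''m''. \<^bold>\<forall>''n''. V ''m'' \<^bold>+ \<^bold>1 \<^bold>= V ''n'' \<^bold>+ \<^bold>1 \<^bold>\<longrightarrow> V ''m'' \<^bold>= V ''n'') \<in> S"
begin

lemma closed:
  assumes "S \<turnstile> \<phi>" "proper \<phi>"
  shows "\<phi> \<in> S"
proof (rule ccontr)
  assume "\<phi> \<notin> S"
  then have "(\<^bold>\<not> \<phi>) \<in> S" using settled[OF assms(2)] by (simp add: settles_def)
  then show False using NegE[OF Assm assms(1)] consistent by simp
qed

lemma Neg_iff: "proper \<phi> \<Longrightarrow> (\<^bold>\<not> \<phi>) \<in> S \<longleftrightarrow> \<phi> \<notin> S"
  using settled[of \<phi>] NegE[OF Assm Assm, of \<phi> S] consistent by (auto simp: settles_def)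

lemma Imp_iff: "proper (\<phi> \<^bold>\<longrightarrow> \<psi>) \<Longrightarrow> (\<phi> \<^bold>\<longrightarrow> \<psi>) \<in> S \<longleftrightarrow> (\<phi> \<in> S \<longrightarrow> \<psi> \<in> S)"
proof (intro iffI impI)
  assume p: "proper (\<phi> \<^bold>\<longrightarrow> \<psi>)"
  show "\<psi> \<in> S" if "(\<phi> \<^bold>\<longrightarrow> \<psi>) \<in> S" "\<phi> \<in> S"
    using p that closed[OF ImpE[OF Assm Assm]] by simp
  assume "\<phi> \<in> S \<longrightarrow> \<psi> \<in> S"
  then consider "\<psi> \<in> S" | "(\<^bold>\<not> \<phi>) \<in> S" using p Neg_iff by auto
  then have "insert \<phi> S \<turnstile> \<psi>"
  proof cases
    case 2
    show ?thesis by (rule explosion[OF NegE[of _ \<phi>]]) (simp_all add: 2 Assm)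
  qed (simp add: Assm)
  then show "(\<phi> \<^bold>\<longrightarrow> \<psi>) \<in> S" using p closed ImpI by blast
qed

lemma AllN_iff:
  assumes p: "proper (\<^bold>\<forall>x. \<phi>)"
  shows "(\<^bold>\<forall>x. \<phi>) \<in> S \<longleftrightarrow> (\<forall>t. Hterm t \<longrightarrow> substN x t \<phi> \<in> S)"
proof (intro iffI allI impI)
  fix t assume "(\<^bold>\<forall>x. \<phi>) \<in> S" and t: "Hterm t"
  then have "S \<turnstile> substN x t \<phi>"
    using p by (intro AllNE[OF Assm] clean_free_forN) (auto simp: proper_def)
  then show "substN x t \<phi> \<in> S" using proper_substN[OF p t] closed by blast
next
  assume "\<forall>t. Hterm t \<longrightarrow> substN x t \<phi> \<in> S"
  then have "\<forall>h\<in>reserved. (\<^bold>\<not> substN x (V h) \<phi>) \<notin> S"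
    using Neg_iff proper_substN[OF p] by simp
  then show "(\<^bold>\<forall>x. \<phi>) \<in> S" using settled[OF p] by (auto simp: settles_def)
qed

lemma AllS_iff:
  assumes p: "proper (\<^bold>\<forall>\<^sub>SX. \<phi>)"
  shows "(\<^bold>\<forall>\<^sub>SX. \<phi>) \<in> S \<longleftrightarrow> (\<forall>Y\<in>reserved. substS X Y \<phi> \<in> S)"
proof (intro iffI ballI)
  fix Y assume "(\<^bold>\<forall>\<^sub>SX. \<phi>) \<in> S" and Y: "Y \<in> reserved"
  then have "S \<turnstile> substS X Y \<phi>"
    using p by (intro AllSE[OF Assm] clean_free_forS) (auto simp: proper_def)
  then show "substS X Y \<phi> \<in> S" using proper_substS[OF p Y] closed by blast
next
  assume "\<forall>Y\<in>reserved. substS X Y \<phi> \<in> S"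
  then have "\<forall>Y\<in>reserved. (\<^bold>\<not> substS X Y \<phi>) \<notin> S"
    using Neg_iff proper_substS[OF p] by simp
  then show "(\<^bold>\<forall>\<^sub>SX. \<phi>) \<in> S" using settled[OF p] by (auto simp: settles_def)
qed

lemma numeral_inject: "(numeral_tm i \<^bold>= numeral_tm j) \<in> S \<Longrightarrow> i = j"
proof (induction i arbitrary: j)
  have nz: "(numeral_tm (Suc n) \<^bold>= \<^bold>0) \<notin> S" for n
  proof -
    have "S \<turnstile> \<^bold>\<not> numeral_tm (Suc n) \<^bold>= \<^bold>0"
      using AllNE[OF Assm[OF Suc_not_zero], of "numeral_tm n"] by (simp add: Neg_def)
    then show ?thesis using NegE[OF _ Assm] consistent by blast
  qed
  {
    case 0
    show ?case
    proof (rule ccontr)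
      assume "0 \<noteq> j"
      then obtain n where "j = Suc n" by (cases j) auto
      with 0 have "S \<turnstile> numeral_tm (Suc n) \<^bold>= \<^bold>0" by (simp add: Eq_sym Assm)
      then have "(numeral_tm (Suc n) \<^bold>= \<^bold>0) \<in> S" by (rule closed) (simp add: proper_def)
      then show False using nz by simp
    qed
  next
    case (Suc i)
    show ?case
    proof (cases j)
      case 0
      with Suc.prems nz show ?thesis by simp
    next
      case (Suc k)
      have "S \<turnstile> (\<^bold>\<forall>''n''. numeral_tm i \<^bold>+ \<^bold>1 \<^bold>= V ''n'' \<^bold>+ \<^bold>1 \<^bold>\<longrightarrow> numeral_tm i \<^bold>= V ''n'')"
        using AllNE[OF Assm[OF Suc_inject], of "numeral_tm i"] by simp
      from AllNE[OF this, of "numeral_tm k"]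
      have "S \<turnstile> numeral_tm (Suc i) \<^bold>= numeral_tm (Suc k) \<^bold>\<longrightarrow> numeral_tm i \<^bold>= numeral_tm k" by simp
      moreover have "S \<turnstile> numeral_tm (Suc i) \<^bold>= numeral_tm (Suc k)" using Suc.prems \<open>j = Suc k\<close> Assm by blast
      ultimately have "S \<turnstile> numeral_tm i \<^bold>= numeral_tm k" by (rule ImpE)
      then have "(numeral_tm i \<^bold>= numeral_tm k) \<in> S" using closed by (simp add: proper_def)
      then show ?thesis using Suc.IH \<open>j = Suc k\<close> by simp
    qed
  }
qed

text \<open>The quotient of the terms by provable equality depends on \<open>S\<close> and cannot be
  a type of its own. Being countably infinite, it is transported to \<open>nat\<close>, and
  \<open>h\<close> sends a term to the number of its class.\<close>

lemma term_values:
  "\<exists>h :: tm \<Rightarrow> nat. (\<forall>s t. Hterm s \<longrightarrow> Hterm t \<longrightarrow> (h s = h t \<longleftrightarrow> (s \<^bold>= t) \<in> S)) \<and>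
     (\<forall>n. \<exists>t. Hterm t \<and> h t = n)"
proof -
  let ?c = "\<lambda>t. {s. Hterm s \<and> (s \<^bold>= t) \<in> S}"
  have c: "?c s = ?c t \<longleftrightarrow> (s \<^bold>= t) \<in> S" if "Hterm s" "Hterm t" for s t
  proof
    have "s \<in> ?c s" using that Refl closed by (auto simp: proper_def)
    then show "?c s = ?c t \<Longrightarrow> (s \<^bold>= t) \<in> S" by blast
    have "(u \<^bold>= v) \<in> S \<Longrightarrow> (v \<^bold>= w) \<in> S \<Longrightarrow> Hterm u \<Longrightarrow> Hterm w \<Longrightarrow> (u \<^bold>= w) \<in> S" for u v w
      using Eq_trans[OF Assm Assm] closed by (simp add: proper_def)
    moreover assume "(s \<^bold>= t) \<in> S"
    moreover from this have "(t \<^bold>= s) \<in> S" using that Eq_sym[OF Assm] closed by (simp add: proper_def)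
    ultimately show "?c s = ?c t" using that by blast
  qed
  let ?D = "?c ` Collect Hterm"
  have "countable ?D" by simp
  moreover have "infinite ?D"
  proof
    assume "finite ?D"
    then have "finite ((\<lambda>n. ?c (numeral_tm n)) ` UNIV)" by (rule finite_subset[rotated]) auto
    moreover have "inj (\<lambda>n. ?c (numeral_tm n))" by (rule injI) (simp only: c Hterm_numeral empty_subsetI numeral_inject)
    ultimately show False using finite_imageD infinite_UNIV_nat by blast
  qed
  ultimately obtain e :: "tm set \<Rightarrow> nat" where e: "bij_betw e ?D UNIV" by (rule countableE_infinite)
  have inj: "e (?c s) = e (?c t) \<longleftrightarrow> ?c s = ?c t" if "Hterm s" "Hterm t" for s t
    using bij_betw_imp_inj_on[OF e] that by (auto simp only: inj_on_def)
  have surj: "\<exists>t. Hterm t \<and> e (?c t) = n" for n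
  proof -
    have "n \<in> e ` ?D" using e by (simp add: bij_betw_def)
    then show ?thesis by blast
  qed
  show ?thesis
    by (rule exI[of _ "\<lambda>t. e (?c t)"]) (use inj surj c in blast)
qed

theorem has_model:
  "\<exists>(zero :: nat) one plus times less (\<sigma> :: string \<Rightarrow> nat set). \<exists>\<nu>. \<forall>\<phi>\<in>S.
      soa_structure.sat zero one plus times less (\<sigma> ` reserved) \<nu> \<sigma> \<phi>"
proof -
  obtain h :: "tm \<Rightarrow> nat" where h: "\<And>s t. Hterm s \<Longrightarrow> Hterm t \<Longrightarrow> h s = h t \<longleftrightarrow> (s \<^bold>= t) \<in> S"
    and surj: "\<And>n. \<exists>t. Hterm t \<and> h t = n" using term_values by blast
  \<comment> \<open>The model computes with chosen representatives; provable equality is a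
    congruence for the operations, the order and membership, so the choice does not matter.\<close>
  obtain rep where rep: "\<And>n. Hterm (rep n)" "\<And>n. h (rep n) = n" using surj by metis
  define \<sigma> where "\<sigma> = (\<lambda>X. {h t | t. Hterm t \<and> (t \<^bold>\<in> X) \<in> S})"
  define \<nu> where "\<nu> = (\<lambda>x. h (V x))"
  interpret soa_structure "h \<^bold>0" "h \<^bold>1" "\<lambda>a b. h (rep a \<^bold>+ rep b)" "\<lambda>a b. h (rep a \<^bold>* rep b)"
    "\<lambda>a b. (rep a \<^bold>< rep b) \<in> S" "\<sigma> ` reserved" .
  have eqS: "S \<turnstile> rep (h t) \<^bold>= t" if "Hterm t" for t
    using h[OF rep(1) that] rep(2) Assm by blast
  have ev: "Hterm t \<Longrightarrow> ev \<nu> t = h t" for t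
  proof (induction t)
    case (Plus s t)
    have "(rep (h s) \<^bold>+ rep (h t) \<^bold>= s \<^bold>+ t) \<in> S"
      by (rule closed[OF Eq_Plus[OF eqS eqS]]) (use Plus.prems rep(1) in \<open>auto simp: proper_def\<close>)
    with Plus rep(1) show ?case by (simp add: h)
  next
    case (Times s t)
    have "(rep (h s) \<^bold>* rep (h t) \<^bold>= s \<^bold>* t) \<in> S"
      by (rule closed[OF Eq_Times[OF eqS eqS]]) (use Times.prems rep(1) in \<open>auto simp: proper_def\<close>)
    with Times rep(1) show ?case by (simp add: h)
  qed (simp_all add: \<nu>_def)
  \<comment> \<open>Induction on size, since an instance of \<open>\<psi>\<close> is not a
    subformula of its quantification; substitution preserves \<open>size\<close>, which does not
    count terms.\<close>
  have truth: "proper \<phi> \<Longrightarrow> sat \<nu> \<sigma> \<phi> \<longleftrightarrow> \<phi> \<in> S" for \<phi>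
  proof (induction \<phi> rule: measure_induct_rule[of size])
    case (less \<phi>)
    show ?case
    proof (cases \<phi>)
      case (Eq s t)
      with less.prems show ?thesis by (simp add: ev h proper_def)
    next
      case (Less s t)
      with less.prems have st: "Hterm s" "Hterm t" by (auto simp: proper_def)
      have "(rep (h s) \<^bold>< rep (h t)) \<in> S \<longleftrightarrow> (s \<^bold>< t) \<in> S"
      proof
        assume a: "(rep (h s) \<^bold>< rep (h t)) \<in> S"
        show "(s \<^bold>< t) \<in> S"
          by (rule closed[OF Less_cong[OF eqS eqS Assm[OF a]]]) (use st in \<open>auto simp: proper_def\<close>)
      next
        assume a: "(s \<^bold>< t) \<in> S"
        show "(rep (h s) \<^bold>< rep (h t)) \<in> S"
          by (rule closed[OF Less_cong[OF Eq_sym[OF eqS] Eq_sym[OF eqS] Assm[OF a]]]) (use st rep(1) in \<open>auto simp: proper_def\<close>)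
      qed
      with Less st show ?thesis by (simp add: ev)
    next
      case (Mem t X)
      with less.prems have t: "Hterm t" "X \<in> reserved" by (auto simp: proper_def)
      have "h t \<in> \<sigma> X \<longleftrightarrow> (t \<^bold>\<in> X) \<in> S"
      proof
        assume "h t \<in> \<sigma> X"
        then obtain u where u: "h t = h u" "Hterm u" "(u \<^bold>\<in> X) \<in> S" by (auto simp: \<sigma>_def)
        with h[of u t] t have u: "h t = h u" "Hterm u" "(u \<^bold>\<in> X) \<in> S" "(u \<^bold>= t) \<in> S" by auto
        show "(t \<^bold>\<in> X) \<in> S"
          by (rule closed[OF Mem_cong[OF Assm[OF u(4)] Assm[OF u(3)]]]) (use u t in \<open>auto simp: proper_def\<close>)
      qed (use t in \<open>auto simp: \<sigma>_def\<close>)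
      with Mem t show ?thesis by (simp add: ev)
    next
      case Falsum
      then show ?thesis using consistent Assm by auto
    next
      case (Imp \<phi>1 \<phi>2)
      with less.prems have "proper \<phi>1" "proper \<phi>2" by simp_all
      then have "sat \<nu> \<sigma> \<phi>1 \<longleftrightarrow> \<phi>1 \<in> S" "sat \<nu> \<sigma> \<phi>2 \<longleftrightarrow> \<phi>2 \<in> S" using less.IH Imp by auto
      then show ?thesis using less.prems Imp Imp_iff by simp
    next
      case (AllN x \<psi>)
      have p: "proper (\<^bold>\<forall>x. \<psi>)" and c: "clean \<psi>" using less.prems AllN by (auto simp: proper_def)
      have "sat (\<nu>(x := n)) \<sigma> \<psi> \<longleftrightarrow> substN x (rep n) \<psi> \<in> S" for n
        using sat_substN[OF c rep(1), of \<nu> \<sigma> x n] less.IH[of "substN x (rep n) \<psi>"] proper_substN[OF p rep(1)] AllN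
        by (simp add: ev rep)
      moreover have "substN x t \<psi> \<in> S \<longleftrightarrow> sat (\<nu>(x := h t)) \<sigma> \<psi>" if "Hterm t" for t
        using sat_substN[OF c that, of \<nu> \<sigma> x] less.IH[of "substN x t \<psi>"] proper_substN[OF p that] AllN that
        by (simp add: ev)
      ultimately show ?thesis using AllN_iff[OF p] AllN rep(1) by auto
    next
      case (AllS X \<psi>)
      have p: "proper (\<^bold>\<forall>\<^sub>SX. \<psi>)" and c: "clean \<psi>" using less.prems AllS by (auto simp: proper_def)
      have "sat \<nu> (\<sigma>(X := \<sigma> Y)) \<psi> \<longleftrightarrow> substS X Y \<psi> \<in> S" if "Y \<in> reserved" for Y
        using sat_substS[OF c that, of \<nu> \<sigma> X] less.IH[of "substS X Y \<psi>"] proper_substS[OF p that] AllS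
        by simp
      then show ?thesis using AllS_iff[OF p] AllS by auto
    qed
  qed
  then show ?thesis using proper by blast
qed

end

section \<open>Arithmetical definability in a structure\<close>

text \<open>Names for the entries of an environment and for the quantifiers introduced below. The
  first letter keeps them apart from the Henkin names and from the parameter names beginning with
  \<open>p\<close>.\<close>

definition evars :: "string set" where "evars = range ((#) (CHR ''e''))"

lemma evars_disjoint: "y \<in> evars \<Longrightarrow> y \<notin> reserved" "y \<in> evars \<Longrightarrow> y \<noteq> CHR ''p'' # s"
  by (auto simp: evars_def reserved_def)

lemma fresh_evar: "finite F \<Longrightarrow> \<exists>y\<in>evars. y \<notin> F"
proof -
  assume "finite F"
  moreover have "infinite evars"
    unfolding evars_def by (simp add: finite_image_iff infinite_UNIV_listI)
  ultimately have "evars - F \<noteq> {}"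
    using Diff_infinite_finite infinite_imp_nonempty by blast
  then show ?thesis by blast
qed

text \<open>No reserved name occurs at all, neither bound nor free. The comprehension axiom for such
  a formula can then be closed without binding a reserved name, so it is among the axioms given to
  the Henkin construction.\<close>

definition plain :: "fm \<Rightarrow> bool" where
  "plain \<phi> \<longleftrightarrow> clean \<phi> \<and> fvN \<phi> \<inter> reserved = {} \<and> fvS \<phi> \<inter> reserved = {}"

lemma plain_simps [simp]:
  "plain (s \<^bold>= t) \<longleftrightarrow> fv_tm s \<inter> reserved = {} \<and> fv_tm t \<inter> reserved = {}"
  "plain (t \<^bold>\<in> X) \<longleftrightarrow> fv_tm t \<inter> reserved = {} \<and> X \<notin> reserved"
  "plain \<^bold>\<bottom>"
  "plain (\<phi> \<^bold>\<longrightarrow> \<psi>) \<longleftrightarrow> plain \<phi> \<and> plain \<psi>"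
  "plain (\<^bold>\<forall>x. \<phi>) \<longleftrightarrow> x \<notin> reserved \<and> plain \<phi>"
  by (auto simp: plain_def)

lemma p_unreserved [simp]: "CHR ''p'' # s \<notin> reserved"
  by (auto simp: reserved_def)

lemma evars_unreserved [simp]: "range \<rho> \<subseteq> evars \<Longrightarrow> \<rho> i \<notin> reserved"
  using evars_disjoint(1) by blast

text \<open>Comprehension is asked for plain formulas only, because the Henkin theory starts from
  the proper axioms. Parameters are still available: \<open>pn\<close> and \<open>ps\<close>
  enumerate all numbers and all sets, and unreserved names can be made to denote them.\<close>

locale soa_model = soa_structure n0 n1 plus times less sets
  for n0 n1 :: 'n and plus (infixl \<open>\<boxplus>\<close> 65) and times (infixl \<open>\<boxtimes>\<close> 70)
    and less :: "'n \<Rightarrow> 'n \<Rightarrow> bool" and sets +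
  fixes pn :: "string \<Rightarrow> 'n" and ps :: "string \<Rightarrow> 'n set"
  assumes surj_pn: "surj pn" and range_ps: "range ps = sets"
    and Suc_not_zero: "n \<boxplus> n1 \<noteq> n0"
    and Suc_inject: "m \<boxplus> n1 = n \<boxplus> n1 \<Longrightarrow> m = n"
    and add_zero: "m \<boxplus> n0 = m"
    and add_Suc: "m \<boxplus> (n \<boxplus> n1) = (m \<boxplus> n) \<boxplus> n1"
    and mult_zero: "m \<boxtimes> n0 = n0"
    and mult_Suc: "m \<boxtimes> (n \<boxplus> n1) = m \<boxtimes> n \<boxplus> m"
    and induction: "A \<in> sets \<Longrightarrow> n0 \<in> A \<Longrightarrow> (\<And>n. n \<in> A \<Longrightarrow> n \<boxplus> n1 \<in> A) \<Longrightarrow> n \<in> A"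
    and comprehension: "arithmetical \<phi> \<Longrightarrow> plain \<phi> \<Longrightarrow> x \<notin> reserved \<Longrightarrow> range \<Sigma> \<subseteq> sets \<Longrightarrow>
      {a. sat (\<nu>(x := a)) \<Sigma> \<phi>} \<in> sets"
begin

text \<open>
  An environment assigns numbers to de Bruijn indices. Every element and every set of the model
  serves as a parameter: it is the value of some variable whose name starts with \<open>p\<close>.
\<close>

definition named :: "(nat \<Rightarrow> string) \<Rightarrow> (nat \<Rightarrow> 'n) \<Rightarrow> (string \<Rightarrow> 'n) \<Rightarrow> (string \<Rightarrow> 'n set) \<Rightarrow> bool" where
  "named \<rho> e \<nu> \<Sigma> \<longleftrightarrow> (\<forall>i. \<nu> (\<rho> i) = e i) \<and>
     (\<forall>s. \<nu> (CHR ''p'' # s) = pn s) \<and> (\<forall>s. \<Sigma> (CHR ''p'' # s) = ps s)"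

text \<open>Arithmetical definability with parameters, phrased so that closure under connectives and
  quantifiers becomes a set of introduction rules. The assignment \<open>\<rho>\<close> of names to
  indices is arbitrary, because a quantifier shifts the indices; its finite range leaves a fresh
  name to bind. It need not be injective, as equal names merely force equal entries.\<close>

definition ar :: "((nat \<Rightarrow> 'n) \<Rightarrow> bool) \<Rightarrow> bool" where
  "ar P \<longleftrightarrow> (\<forall>\<rho>. finite (range \<rho>) \<and> range \<rho> \<subseteq> evars \<longrightarrow>
     (\<exists>\<phi>. arithmetical \<phi> \<and> plain \<phi> \<and> (\<forall>e \<nu> \<Sigma>. named \<rho> e \<nu> \<Sigma> \<longrightarrow> sat \<nu> \<Sigma> \<phi> = P e)))"

text \<open>Definability of the graph is demanded instead of a term. This admits functions that no
  term of the language denotes, notably the ring operations.\<close>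

definition fn :: "((nat \<Rightarrow> 'n) \<Rightarrow> 'n) \<Rightarrow> bool" where
  "fn f \<longleftrightarrow> ar (\<lambda>e. e 0 = f (\<lambda>i. e (Suc i)))"

lemma arI:
  assumes "\<And>\<rho>. finite (range \<rho>) \<Longrightarrow> range \<rho> \<subseteq> evars \<Longrightarrow> \<exists>\<phi>. arithmetical \<phi> \<and> plain \<phi> \<and>
    (\<forall>e \<nu> \<Sigma>. named \<rho> e \<nu> \<Sigma> \<longrightarrow> sat \<nu> \<Sigma> \<phi> = P e)"
  shows "ar P"
  using assms by (simp add: ar_def)

lemma arE:
  assumes "ar P" "finite (range \<rho>)" "range \<rho> \<subseteq> evars"
  obtains \<phi> where "arithmetical \<phi>" "plain \<phi>" "\<And>e \<nu> \<Sigma>. named \<rho> e \<nu> \<Sigma> \<Longrightarrow> sat \<nu> \<Sigma> \<phi> = P e"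
  using assms by (auto simp: ar_def)

lemma ar_eq0: "ar (\<lambda>e. e i = e j)"
  by (rule arI, rule_tac x = "V (\<rho> i) \<^bold>= V (\<rho> j)" in exI) (simp add: named_def)

lemma ar_const0: "ar (\<lambda>e. e i = c)"
proof -
  obtain s where "c = pn s" using surj_pn by (metis surjD)
  then show ?thesis
    by - (rule arI, rule_tac x = "V (\<rho> i) \<^bold>= V (CHR ''p'' # s)" in exI, simp add: named_def)
qed

lemma ar_plus0: "ar (\<lambda>e. e i = e j \<boxplus> e k)"
  by (rule arI, rule_tac x = "V (\<rho> i) \<^bold>= V (\<rho> j) \<^bold>+ V (\<rho> k)" in exI) (simp add: named_def)

lemma ar_times0: "ar (\<lambda>e. e i = e j \<boxtimes> e k)"
  by (rule arI, rule_tac x = "V (\<rho> i) \<^bold>= V (\<rho> j) \<^bold>* V (\<rho> k)" in exI) (simp add: named_def)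

lemma ar_mem0: "A \<in> sets \<Longrightarrow> ar (\<lambda>e. e i \<in> A)"
proof -
  assume "A \<in> sets"
  then obtain s where "A = ps s" using range_ps by blast
  then show ?thesis
    by - (rule arI, rule_tac x = "V (\<rho> i) \<^bold>\<in> CHR ''p'' # s" in exI, simp add: named_def)
qed

lemma ar_False: "ar (\<lambda>e. False)"
  by (rule arI, rule_tac x = "\<^bold>\<bottom>" in exI) simp

lemma ar_imp: "ar P \<Longrightarrow> ar Q \<Longrightarrow> ar (\<lambda>e. P e \<longrightarrow> Q e)"
proof (rule arI)
  fix \<rho> :: "nat \<Rightarrow> string" assume "ar P" "ar Q" and \<rho>: "finite (range \<rho>)" "range \<rho> \<subseteq> evars"
  obtain \<phi> where \<phi>: "arithmetical \<phi>" "plain \<phi>" "\<And>e \<nu> \<Sigma>. named \<rho> e \<nu> \<Sigma> \<Longrightarrow> sat \<nu> \<Sigma> \<phi> = P e"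
    by (rule arE[OF \<open>ar P\<close> \<rho>]) auto
  obtain \<psi> where \<psi>: "arithmetical \<psi>" "plain \<psi>" "\<And>e \<nu> \<Sigma>. named \<rho> e \<nu> \<Sigma> \<Longrightarrow> sat \<nu> \<Sigma> \<psi> = Q e"
    by (rule arE[OF \<open>ar Q\<close> \<rho>]) auto
  from \<phi> \<psi> show "\<exists>\<phi>. arithmetical \<phi> \<and> plain \<phi> \<and> (\<forall>e \<nu> \<Sigma>. named \<rho> e \<nu> \<Sigma> \<longrightarrow> sat \<nu> \<Sigma> \<phi> = (P e \<longrightarrow> Q e))"
    by (intro exI[of _ "\<phi> \<^bold>\<longrightarrow> \<psi>"]) simp
qed

lemma ar_all:
  assumes "ar (\<lambda>e. Q (e 0) (\<lambda>i. e (Suc i)))"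
  shows "ar (\<lambda>e. \<forall>x. Q x e)"
proof (rule arI)
  fix \<rho> :: "nat \<Rightarrow> string" assume \<rho>: "finite (range \<rho>)" "range \<rho> \<subseteq> evars"
  obtain y where y: "y \<in> evars" "y \<notin> range \<rho>" using fresh_evar \<rho> by blast
  have r: "range (case_nat y \<rho>) \<subseteq> insert y (range \<rho>)" by (auto split: nat.splits)
  then have "finite (range (case_nat y \<rho>))" "range (case_nat y \<rho>) \<subseteq> evars"
    using y \<rho> by (meson finite.insertI finite_subset insert_subset subset_trans)+
  then obtain \<phi> where \<phi>: "arithmetical \<phi>" "plain \<phi>"
    "\<And>e \<nu> \<Sigma>. named (case_nat y \<rho>) e \<nu> \<Sigma> \<Longrightarrow> sat \<nu> \<Sigma> \<phi> = Q (e 0) (\<lambda>i. e (Suc i))"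
    by (rule arE[OF assms]) auto
  have "sat (\<nu>(y := a)) \<Sigma> \<phi> = Q a e" if "named \<rho> e \<nu> \<Sigma>" for e \<nu> \<Sigma> a
  proof -
    have "(\<nu>(y := a)) (case_nat y \<rho> i) = case_nat a e i" for i
      using that y by (cases i) (auto simp: named_def)
    then have "named (case_nat y \<rho>) (case_nat a e) (\<nu>(y := a)) \<Sigma>"
      using that evars_disjoint(2)[OF y(1)] by (auto simp: named_def)
    from \<phi>(3)[OF this] show ?thesis by simp
  qed
  then show "\<exists>\<phi>. arithmetical \<phi> \<and> plain \<phi> \<and> (\<forall>e \<nu> \<Sigma>. named \<rho> e \<nu> \<Sigma> \<longrightarrow> sat \<nu> \<Sigma> \<phi> = (\<forall>x. Q x e))"
    using \<phi>(1,2) evars_disjoint(1)[OF y(1)] by (intro exI[of _ "\<^bold>\<forall>y. \<phi>"]) simp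
qed

lemma ar_rename:
  assumes "ar P"
  shows "ar (\<lambda>e. P (\<lambda>i. e (r i)))"
proof (rule arI)
  fix \<rho> :: "nat \<Rightarrow> string" assume \<rho>: "finite (range \<rho>)" "range \<rho> \<subseteq> evars"
  have "range (\<lambda>i. \<rho> (r i)) \<subseteq> range \<rho>" by auto
  then obtain \<phi> where \<phi>: "arithmetical \<phi>" "plain \<phi>"
    "\<And>e \<nu> \<Sigma>. named (\<lambda>i. \<rho> (r i)) e \<nu> \<Sigma> \<Longrightarrow> sat \<nu> \<Sigma> \<phi> = P e"
    using \<rho> by (elim arE[OF assms, of "\<lambda>i. \<rho> (r i)", rotated 2]) (auto intro: finite_subset)
  have "sat \<nu> \<Sigma> \<phi> = P (\<lambda>i. e (r i))" if "named \<rho> e \<nu> \<Sigma>" for e \<nu> \<Sigma>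
    using that by (intro \<phi>(3)) (simp add: named_def)
  with \<phi> show "\<exists>\<phi>. arithmetical \<phi> \<and> plain \<phi> \<and> (\<forall>e \<nu> \<Sigma>. named \<rho> e \<nu> \<Sigma> \<longrightarrow> sat \<nu> \<Sigma> \<phi> = P (\<lambda>i. e (r i)))"
    by blast
qed

lemma ar_not: "ar P \<Longrightarrow> ar (\<lambda>e. \<not> P e)"
  using ar_imp[OF _ ar_False] by simp

lemma ar_disj: "ar P \<Longrightarrow> ar Q \<Longrightarrow> ar (\<lambda>e. P e \<or> Q e)"
  using ar_imp[OF ar_not] by (simp add: imp_conv_disj)

lemma ar_conj: "ar P \<Longrightarrow> ar Q \<Longrightarrow> ar (\<lambda>e. P e \<and> Q e)"
  using ar_not[OF ar_imp[OF _ ar_not]] by simp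

lemma ar_iff: "ar P \<Longrightarrow> ar Q \<Longrightarrow> ar (\<lambda>e. P e \<longleftrightarrow> Q e)"
  using ar_conj[OF ar_imp[of P Q] ar_imp[of Q P]] by (simp add: iff_conv_conj_imp)

lemma ar_ex: "ar (\<lambda>e. Q (e 0) (\<lambda>i. e (Suc i))) \<Longrightarrow> ar (\<lambda>e. \<exists>x. Q x e)"
  using ar_not[OF ar_all[OF ar_not]] by simp

lemma fn_shift: "fn f \<Longrightarrow> ar (\<lambda>e. e i = f (\<lambda>j. e (r j)))"
  unfolding fn_def using ar_rename[of _ "case_nat i r"] by fastforce

lemma ar_sub1: "ar (\<lambda>e. P (e 0)) \<Longrightarrow> fn f \<Longrightarrow> ar (\<lambda>e. P (f e))"
proof -
  assume P: "ar (\<lambda>e. P (e 0))" and f: "fn f"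
  have "ar (\<lambda>e. \<exists>x. x = f e \<and> P x)"
    by (intro ar_ex ar_conj fn_shift f P)
  then show ?thesis by simp
qed

lemma ar_sub2: "ar (\<lambda>e. P (e 0) (e 1)) \<Longrightarrow> fn f \<Longrightarrow> fn g \<Longrightarrow> ar (\<lambda>e. P (f e) (g e))"
proof -
  assume P: "ar (\<lambda>e. P (e 0) (e 1))" and f: "fn f" and g: "fn g"
  have "ar (\<lambda>e. \<exists>y. \<exists>x. x = f e \<and> y = g e \<and> P x y)"
    by (intro ar_ex ar_conj) (use fn_shift[OF f] fn_shift[OF g] P in simp_all)
  then show ?thesis by simp
qed

lemma ar_sub3:
  assumes P: "ar (\<lambda>e. P (e 0) (e 1) (e 2))" and f: "fn f" and g: "fn g" and h: "fn h"
  shows "ar (\<lambda>e. P (f e) (g e) (h e))"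
proof -
  have "ar (\<lambda>e. \<exists>z. \<exists>y. \<exists>x. x = f e \<and> y = g e \<and> z = h e \<and> P x y z)"
    by (intro ar_ex ar_conj)
      (use fn_shift[OF f] fn_shift[OF g] fn_shift[OF h] P in \<open>simp_all add: numeral_2_eq_2\<close>)
  then show ?thesis by simp
qed

lemma fn_sub2:
  assumes F: "ar (\<lambda>e. e 0 = F (e 1) (e 2))" and f: "fn f" and g: "fn g"
  shows "fn (\<lambda>e. F (f e) (g e))"
proof -
  have "ar (\<lambda>e. \<exists>y. \<exists>x. x = f (\<lambda>i. e (Suc i)) \<and> y = g (\<lambda>i. e (Suc i)) \<and> e 0 = F x y)"
    using ar_rename[OF F, of "\<lambda>i. if i = 0 then 2 else if i = 1 then 0 else 1"]
    by (intro ar_ex ar_conj) (use fn_shift[OF f] fn_shift[OF g] in \<open>simp_all add: numeral_2_eq_2\<close>)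
  then show ?thesis by (simp add: fn_def)
qed

lemma fn_var: "fn (\<lambda>e. e i)"
  unfolding fn_def by (rule ar_eq0)

lemma fn_const: "fn (\<lambda>e. c)"
  unfolding fn_def by (rule ar_const0)

lemma fn_plus: "fn f \<Longrightarrow> fn g \<Longrightarrow> fn (\<lambda>e. f e \<boxplus> g e)"
  by (rule fn_sub2[where F = plus, OF ar_plus0])

lemma fn_times: "fn f \<Longrightarrow> fn g \<Longrightarrow> fn (\<lambda>e. f e \<boxtimes> g e)"
  by (rule fn_sub2[where F = times, OF ar_times0])

lemma ar_eq: "fn f \<Longrightarrow> fn g \<Longrightarrow> ar (\<lambda>e. f e = g e)"
  by (rule ar_sub2[where P = "(=)", OF ar_eq0])

lemma ar_mem: "A \<in> sets \<Longrightarrow> fn f \<Longrightarrow> ar (\<lambda>e. f e \<in> A)"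
  by (rule ar_sub1[where P = "\<lambda>x. x \<in> A", OF ar_mem0])

lemma ar_ball: "A \<in> sets \<Longrightarrow> ar (\<lambda>e. Q (e 0) (\<lambda>i. e (Suc i))) \<Longrightarrow> ar (\<lambda>e. \<forall>x\<in>A. Q x e)"
  unfolding Ball_def by (intro ar_all ar_imp ar_mem fn_var)

lemma ar_bex: "A \<in> sets \<Longrightarrow> ar (\<lambda>e. Q (e 0) (\<lambda>i. e (Suc i))) \<Longrightarrow> ar (\<lambda>e. \<exists>x\<in>A. Q x e)"
  unfolding Bex_def by (intro ar_ex ar_conj ar_mem fn_var)

lemmas ar_rules = ar_False ar_imp ar_all ar_not ar_disj ar_conj ar_iff ar_ex ar_ball ar_bex
  ar_eq ar_mem fn_plus fn_times fn_var fn_const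

lemma ar_set:
  assumes "ar (\<lambda>e. P (e 0))"
  shows "{n. P n} \<in> sets"
proof -
  \<comment> \<open>\<open>P\<close> looks at index 0 only, so all indices can share one
    name.\<close>
  obtain \<phi> where \<phi>: "arithmetical \<phi>" "plain \<phi>"
    "\<And>e \<nu> \<Sigma>. named (\<lambda>i. ''e'') e \<nu> \<Sigma> \<Longrightarrow> sat \<nu> \<Sigma> \<phi> = P (e 0)"
    by (rule arE[OF assms, of "\<lambda>i. ''e''"]) (auto simp: evars_def)
  \<comment> \<open>Dropping the first letter gives every name \<open>p\<close> followed by
    \<open>s\<close> its intended value \<open>pn s\<close>, and likewise for sets in the next
    line.\<close>
  define \<nu> where "\<nu> = (\<lambda>s. pn (tl s))"
  define \<Sigma> where "\<Sigma> = (\<lambda>s. ps (tl s))"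
  have "named (\<lambda>i. ''e'') (\<lambda>_. a) (\<nu>(''e'' := a)) \<Sigma>" for a
    by (simp add: named_def \<nu>_def \<Sigma>_def)
  then have "sat (\<nu>(''e'' := a)) \<Sigma> \<phi> = P a" for a by (rule \<phi>(3))
  then have "{n. P n} = {a. sat (\<nu>(''e'' := a)) \<Sigma> \<phi>}" by (simp only:)
  also have "\<dots> \<in> sets"
    using range_ps by (intro comprehension \<phi>) (auto simp: reserved_def \<Sigma>_def)
  finally show ?thesis .
qed

text \<open>The axiom of induction speaks of the sets of the model, and comprehension turns every
  arithmetical property into such a set.\<close>

lemma ar_induct [consumes 1, case_names zero Suc]:
  assumes "ar (\<lambda>e. P (e 0))" and "P n0" and "\<And>n. P n \<Longrightarrow> P (n \<boxplus> n1)"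
  shows "P n"
  using induction[OF ar_set[OF assms(1)], of n] assms(2,3) by simp

section \<open>Arithmetic\<close>

lemma zero_add: "n0 \<boxplus> m = m"
  by (rule ar_induct[of "\<lambda>m. n0 \<boxplus> m = m"]) (intro ar_rules, simp_all add: add_zero add_Suc)

lemma Suc_add: "(m \<boxplus> n1) \<boxplus> n = (m \<boxplus> n) \<boxplus> n1"
  by (rule ar_induct[of "\<lambda>n. (m \<boxplus> n1) \<boxplus> n = (m \<boxplus> n) \<boxplus> n1"])
    (intro ar_rules, simp_all add: add_zero add_Suc)

lemma add_commute: "m \<boxplus> n = n \<boxplus> m"
  by (rule ar_induct[of "\<lambda>n. m \<boxplus> n = n \<boxplus> m"])
    (intro ar_rules, simp_all add: add_zero zero_add add_Suc Suc_add)

lemma add_assoc: "(k \<boxplus> m) \<boxplus> n = k \<boxplus> (m \<boxplus> n)"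
  by (rule ar_induct[of "\<lambda>n. (k \<boxplus> m) \<boxplus> n = k \<boxplus> (m \<boxplus> n)"])
    (intro ar_rules, simp_all add: add_zero add_Suc)

lemma add_left_commute: "m \<boxplus> (n \<boxplus> k) = n \<boxplus> (m \<boxplus> k)"
  by (metis add_assoc add_commute)

lemmas add_ac' = add_assoc add_commute add_left_commute

lemma zero_mult: "n0 \<boxtimes> m = n0"
  by (rule ar_induct[of "\<lambda>m. n0 \<boxtimes> m = n0"]) (intro ar_rules, simp_all add: mult_zero mult_Suc add_zero)

lemma Suc_mult: "(m \<boxplus> n1) \<boxtimes> n = m \<boxtimes> n \<boxplus> n"
  by (rule ar_induct[of "\<lambda>n. (m \<boxplus> n1) \<boxtimes> n = m \<boxtimes> n \<boxplus> n"])
    (intro ar_rules, simp add: mult_zero add_zero, simp add: mult_Suc add_ac')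

lemma mult_commute: "m \<boxtimes> n = n \<boxtimes> m"
  by (rule ar_induct[of "\<lambda>n. m \<boxtimes> n = n \<boxtimes> m"])
    (intro ar_rules, simp_all add: mult_zero zero_mult mult_Suc Suc_mult)

lemma distrib_left: "k \<boxtimes> (m \<boxplus> n) = k \<boxtimes> m \<boxplus> k \<boxtimes> n"
  by (rule ar_induct[of "\<lambda>n. k \<boxtimes> (m \<boxplus> n) = k \<boxtimes> m \<boxplus> k \<boxtimes> n"])
    (intro ar_rules, simp add: add_zero mult_zero,
     simp only: add_assoc[symmetric] mult_Suc)

lemma distrib_right: "(m \<boxplus> n) \<boxtimes> k = m \<boxtimes> k \<boxplus> n \<boxtimes> k"
  by (metis distrib_left mult_commute)

lemma mult_one: "m \<boxtimes> n1 = m"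
  using mult_Suc[of m n0] by (simp add: mult_zero zero_add)

lemma mult_assoc: "(k \<boxtimes> m) \<boxtimes> n = k \<boxtimes> (m \<boxtimes> n)"
  by (rule ar_induct[of "\<lambda>n. (k \<boxtimes> m) \<boxtimes> n = k \<boxtimes> (m \<boxtimes> n)"])
    (intro ar_rules, simp_all add: mult_zero mult_Suc distrib_left mult_one)

lemma mult_left_commute: "m \<boxtimes> (n \<boxtimes> k) = n \<boxtimes> (m \<boxtimes> k)"
  by (metis mult_assoc mult_commute)

lemma one_mult: "n1 \<boxtimes> m = m"
  using mult_commute mult_one by simp

lemmas semiring' = add_ac' mult_assoc mult_commute mult_left_commute distrib_left distrib_right mult_one one_mult

lemma cases_nat: obtains "n = n0" | m where "n = m \<boxplus> n1"
proof -
  have "n = n0 \<or> (\<exists>m. n = m \<boxplus> n1)"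
    by (rule ar_induct[of "\<lambda>n. n = n0 \<or> (\<exists>m. n = m \<boxplus> n1)"]) (intro ar_rules, blast+)
  then show ?thesis using that by blast
qed

lemma add_right_cancel: "m \<boxplus> k = n \<boxplus> k \<longleftrightarrow> m = n"
proof
  show "m \<boxplus> k = n \<boxplus> k \<Longrightarrow> m = n"
    by (rule ar_induct[of "\<lambda>k. m \<boxplus> k = n \<boxplus> k \<longrightarrow> m = n", THEN mp])
      (intro ar_rules, auto simp: add_zero add_Suc dest: Suc_inject)
qed simp

lemma add_left_cancel: "k \<boxplus> m = k \<boxplus> n \<longleftrightarrow> m = n"
  by (simp add: add_commute[of k] add_right_cancel)

lemma add_eq_self: "m \<boxplus> k = m \<longleftrightarrow> k = n0"
  using add_left_cancel[of m k n0] by (simp add: add_zero)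

lemma add_eq_zero: "m \<boxplus> k = n0 \<longleftrightarrow> m = n0 \<and> k = n0"
  by (cases k rule: cases_nat) (auto simp: add_zero zero_add add_Suc Suc_not_zero)

lemma mult_eq_zero: "m \<boxtimes> k = n0 \<Longrightarrow> m = n0 \<or> k = n0"
  by (cases k rule: cases_nat) (auto simp: mult_Suc add_eq_zero)

section \<open>Order, divisibility and pairing\<close>

definition le :: "'n \<Rightarrow> 'n \<Rightarrow> bool" where "le m n \<longleftrightarrow> (\<exists>k. n = m \<boxplus> k)"

definition lt :: "'n \<Rightarrow> 'n \<Rightarrow> bool" where "lt m n \<longleftrightarrow> le (m \<boxplus> n1) n"

definition dv :: "'n \<Rightarrow> 'n \<Rightarrow> bool" where "dv m n \<longleftrightarrow> (\<exists>k. n = m \<boxtimes> k)"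

definition pr :: "'n \<Rightarrow> 'n \<Rightarrow> 'n" where "pr i j = (i \<boxplus> j) \<boxtimes> (i \<boxplus> j) \<boxplus> i"

lemma ar_le: "fn f \<Longrightarrow> fn g \<Longrightarrow> ar (\<lambda>e. le (f e) (g e))"
  by (rule ar_sub2[of le]) (unfold le_def, intro ar_rules)

lemma ar_lt: "fn f \<Longrightarrow> fn g \<Longrightarrow> ar (\<lambda>e. lt (f e) (g e))"
  unfolding lt_def by (intro ar_le ar_rules)

lemma ar_dv: "fn f \<Longrightarrow> fn g \<Longrightarrow> ar (\<lambda>e. dv (f e) (g e))"
  by (rule ar_sub2[of dv]) (unfold dv_def, intro ar_rules)

lemma fn_pr: "fn f \<Longrightarrow> fn g \<Longrightarrow> fn (\<lambda>e. pr (f e) (g e))"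
  unfolding pr_def by (intro ar_rules)

lemmas ar_rules' = ar_le ar_lt ar_dv fn_pr ar_rules

lemma le_refl: "le n n"
  unfolding le_def by (metis add_zero)

lemma zero_le: "le n0 n"
  unfolding le_def by (metis zero_add)

lemma le_add: "le m (m \<boxplus> k)" "le m (k \<boxplus> m)"
  unfolding le_def by (metis add_commute)+

lemma le_trans: "le i j \<Longrightarrow> le j k \<Longrightarrow> le i k"
  unfolding le_def by (metis add_assoc)

lemma le_antisym: "le i j \<Longrightarrow> le j i \<Longrightarrow> i = j"
  unfolding le_def by (metis add_assoc add_eq_self add_eq_zero)

lemma le_Suc: "le m (n \<boxplus> n1) \<longleftrightarrow> le m n \<or> m = n \<boxplus> n1"
proof
  assume "le m (n \<boxplus> n1)"
  then obtain k where k: "n \<boxplus> n1 = m \<boxplus> k" by (auto simp: le_def)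
  show "le m n \<or> m = n \<boxplus> n1"
  proof (cases k rule: cases_nat)
    case 1
    with k show ?thesis by (simp add: add_zero)
  next
    case (2 j)
    with k have "n = m \<boxplus> j" by (simp add: add_Suc Suc_inject)
    then show ?thesis by (auto simp: le_def)
  qed
qed (metis le_add(1) le_refl le_trans)

lemma le_zero: "le m n0 \<longleftrightarrow> m = n0"
  by (metis add_eq_zero le_def le_refl)

lemma lt_Suc: "lt m (n \<boxplus> n1) \<longleftrightarrow> le m n"
  by (auto simp: lt_def le_def Suc_add dest: Suc_inject)

lemma not_lt_zero: "\<not> lt m n0"
  by (simp add: lt_def le_zero Suc_not_zero)

lemma le_cases: "le m n \<or> lt n m"
proof (rule ar_induct[of "\<lambda>m. le m n \<or> lt n m"])
  show "ar (\<lambda>e. le (e 0) n \<or> lt n (e 0))" by (intro ar_rules')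
  show "le n0 n \<or> lt n n0" by (simp add: zero_le)
  fix m assume "le m n \<or> lt n m"
  then show "le (m \<boxplus> n1) n \<or> lt n (m \<boxplus> n1)"
    by (metis add_zero cases_nat le_add(1) le_def lt_Suc lt_def le_refl le_trans add_Suc zero_add Suc_add)
qed

lemma lt_imp_le: "lt m n \<Longrightarrow> le m n"
  unfolding lt_def by (metis le_add(1) le_trans)

lemma lt_irrefl: "\<not> lt n n"
  by (metis Suc_not_zero add_assoc add_eq_self lt_def le_def zero_add add_eq_zero)

lemma le_iff_lt_or_eq: "le m n \<longleftrightarrow> lt m n \<or> m = n"
  by (metis le_antisym le_cases le_refl lt_imp_le)

text \<open>Write \<open>s\<close> for \<open>i + j\<close>. If the other sum were
  \<open>s + d\<close> with \<open>d\<close> nonzero, its square would exceed the square of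
  \<open>s\<close> by more than \<open>s\<close>, hence by more than \<open>i\<close>. Thus the code
  determines the sum, and then the first component.\<close>

lemma pr_sum_le:
  assumes "pr i j = pr i' j'"
  shows "le (i' \<boxplus> j') (i \<boxplus> j)"
proof (rule ccontr)
  assume "\<not> le (i' \<boxplus> j') (i \<boxplus> j)"
  then obtain c where c: "i' \<boxplus> j' = i \<boxplus> j \<boxplus> n1 \<boxplus> c"
    using le_cases lt_def le_def by metis
  let ?s = "i \<boxplus> j" and ?d = "n1 \<boxplus> c"
  have "i' \<boxplus> j' = ?s \<boxplus> ?d" using c by (simp add: add_assoc)
  then have "pr i' j' = ?s \<boxtimes> ?s \<boxplus> (i \<boxplus> (j \<boxplus> ?s \<boxtimes> c \<boxplus> ?d \<boxtimes> ?s \<boxplus> ?d \<boxtimes> ?d \<boxplus> i'))"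
    unfolding pr_def by (simp only: semiring')
  moreover have "pr i j = ?s \<boxtimes> ?s \<boxplus> i" by (simp add: pr_def)
  ultimately have "i = i \<boxplus> (j \<boxplus> ?s \<boxtimes> c \<boxplus> ?d \<boxtimes> ?s \<boxplus> ?d \<boxtimes> ?d \<boxplus> i')"
    using assms add_left_cancel by simp
  then have "?d \<boxtimes> ?d = n0" using add_eq_self add_eq_zero by metis
  then have "n1 \<boxplus> c = n0" using mult_eq_zero by blast
  then show False using Suc_not_zero add_commute by metis
qed

lemma pr_inject [simp]: "pr i j = pr i' j' \<longleftrightarrow> i = i' \<and> j = j'"
proof
  assume *: "pr i j = pr i' j'"
  then have s: "i \<boxplus> j = i' \<boxplus> j'" using pr_sum_le le_antisym by metis
  with * have "i = i'" by (simp add: pr_def add_left_cancel)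
  with s show "i = i' \<and> j = j'" by (simp add: add_left_cancel)
qed simp

text \<open>For fixed \<open>r\<close> the stages \<open>pr r m\<close> are arbitrarily late, which
  lets a construction return to each \<open>r\<close> again and again.\<close>

lemma le_pr: "le j (pr i j)"
proof (cases j rule: cases_nat)
  case (2 k)
  have "pr i j = j \<boxplus> (i \<boxtimes> (i \<boxplus> j) \<boxplus> k \<boxtimes> (i \<boxplus> j) \<boxplus> i \<boxplus> i)"
    unfolding pr_def 2 by (simp only: semiring')
  then show ?thesis by (metis le_add(1))
qed (simp add: zero_le)

section \<open>Coding finite sets\<close>

lemma dv_add_cancel:
  assumes "dv m (a \<boxplus> b)" "dv m a"
  shows "dv m b"
proof -
  obtain j k where jk: "a \<boxplus> b = m \<boxtimes> k" "a = m \<boxtimes> j" using assms by (auto simp: dv_def)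
  \<comment> \<open>Without subtraction the quotients have to be compared; if \<open>j\<close> is
    the larger one, then \<open>b\<close> vanishes.\<close>
  consider c where "k = j \<boxplus> c" | c where "j = k \<boxplus> c" using le_cases lt_imp_le le_def by metis
  then show ?thesis
  proof cases
    case 1
    with jk have "b = m \<boxtimes> c" by (simp add: distrib_left add_left_cancel)
    then show ?thesis by (auto simp: dv_def)
  next
    case 2
    with jk have "b = n0" by (simp add: distrib_left add_assoc add_eq_self add_eq_zero)
    then show ?thesis by (metis dv_def mult_zero)
  qed
qed

lemma dv_mult: "dv m a \<Longrightarrow> dv m (a \<boxtimes> b)"
  by (auto simp: dv_def mult_assoc)

lemma dv_self_mult: "dv m (m \<boxtimes> a)"
  by (auto simp: dv_def)

text \<open>The witness built by the induction is the factorial of \<open>b\<close>, which is thus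
  obtained without a prior theory of recursion.\<close>

lemma common_multiple: "\<exists>v. v \<noteq> n0 \<and> (\<forall>d. d \<noteq> n0 \<longrightarrow> le d b \<longrightarrow> dv d v)"
proof (rule ar_induct[of "\<lambda>b. \<exists>v. v \<noteq> n0 \<and> (\<forall>d. d \<noteq> n0 \<longrightarrow> le d b \<longrightarrow> dv d v)"])
  show "ar (\<lambda>e. \<exists>v. v \<noteq> n0 \<and> (\<forall>d. d \<noteq> n0 \<longrightarrow> le d (e 0) \<longrightarrow> dv d v))"
    by (intro ar_rules')
  show "\<exists>v. v \<noteq> n0 \<and> (\<forall>d. d \<noteq> n0 \<longrightarrow> le d n0 \<longrightarrow> dv d v)"
    using Suc_not_zero[of n0] by (intro exI[of _ "n0 \<boxplus> n1"]) (simp add: le_zero)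
  fix b assume "\<exists>v. v \<noteq> n0 \<and> (\<forall>d. d \<noteq> n0 \<longrightarrow> le d b \<longrightarrow> dv d v)"
  then obtain v where v: "v \<noteq> n0" "\<And>d. d \<noteq> n0 \<Longrightarrow> le d b \<Longrightarrow> dv d v" by blast
  have "v \<boxtimes> (b \<boxplus> n1) \<noteq> n0" using v mult_eq_zero Suc_not_zero by blast
  moreover have "dv d (v \<boxtimes> (b \<boxplus> n1))" if "d \<noteq> n0" "le d (b \<boxplus> n1)" for d
    using that v(2) by (auto simp: le_Suc dv_mult mult_commute[of v] dv_self_mult) (metis dv_mult mult_commute)
  ultimately show "\<exists>v. v \<noteq> n0 \<and> (\<forall>d. d \<noteq> n0 \<longrightarrow> le d (b \<boxplus> n1) \<longrightarrow> dv d v)" by blast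
qed

text \<open>With \<open>v\<close> a multiple of all small numbers the moduli \<open>1 + p v\<close> are pairwise coprime.\<close>

lemma coprime_moduli:
  assumes "dv (n1 \<boxplus> p \<boxtimes> v) (u \<boxtimes> (n1 \<boxplus> q \<boxtimes> v))" and "dv d v" and "q = p \<boxplus> d \<or> p = q \<boxplus> d"
  shows "dv (n1 \<boxplus> p \<boxtimes> v) u"
proof -
  let ?m = "n1 \<boxplus> p \<boxtimes> v" and ?n = "n1 \<boxplus> q \<boxtimes> v"
  obtain w where w: "v = d \<boxtimes> w" using assms(2) by (auto simp: dv_def)
  have 1: "dv ?m (u \<boxtimes> d \<boxtimes> v)"
    using assms(3)
  proof
    assume "q = p \<boxplus> d"
    then have "u \<boxtimes> ?n = ?m \<boxtimes> u \<boxplus> u \<boxtimes> d \<boxtimes> v" by (simp only: semiring')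
    then show ?thesis using assms(1) dv_add_cancel dv_self_mult by metis
  next
    assume "p = q \<boxplus> d"
    then have "?m \<boxtimes> u = u \<boxtimes> ?n \<boxplus> u \<boxtimes> d \<boxtimes> v" by (simp only: semiring')
    then show ?thesis using assms(1) dv_add_cancel dv_self_mult by metis
  qed
  \<comment> \<open>Modulo \<open>?m\<close> the number \<open>p v\<close> is -1. This cancels
    \<open>v\<close> from \<open>u d v\<close>, and afterwards \<open>d\<close>, which is a factor
    of \<open>v\<close>.\<close>
  have "?m \<boxtimes> (u \<boxtimes> d) = u \<boxtimes> d \<boxtimes> v \<boxtimes> p \<boxplus> u \<boxtimes> d" by (simp only: semiring')
  then have "dv ?m (u \<boxtimes> d)" using dv_add_cancel[OF _ dv_mult[OF 1]] dv_self_mult by metis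
  then have 2: "dv ?m (u \<boxtimes> d \<boxtimes> (w \<boxtimes> p))" by (rule dv_mult)
  have "u \<boxtimes> ?m = u \<boxtimes> (p \<boxtimes> v) \<boxplus> u" by (simp only: semiring')
  moreover have "u \<boxtimes> (p \<boxtimes> v) = u \<boxtimes> d \<boxtimes> (w \<boxtimes> p)" unfolding w by (simp only: semiring')
  ultimately have "?m \<boxtimes> u = u \<boxtimes> d \<boxtimes> (w \<boxtimes> p) \<boxplus> u" by (simp add: mult_commute)
  then show ?thesis using dv_add_cancel[OF _ 2] dv_self_mult by metis
qed

text \<open>Only membership has to be decoded, so divisibility of \<open>u\<close> replaces the
  remainders of the usual \<open>\<beta>\<close>-function. The shift to \<open>x + 1\<close> matters
  at \<open>x = 0\<close>, where the modulus would otherwise be 1 and divide everything.\<close>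

definition code :: "'n \<Rightarrow> 'n \<Rightarrow> 'n \<Rightarrow> bool" where
  "code u v x \<longleftrightarrow> dv (n1 \<boxplus> (x \<boxplus> n1) \<boxtimes> v) u"

lemma ar_code: "fn f \<Longrightarrow> fn g \<Longrightarrow> fn h \<Longrightarrow> ar (\<lambda>e. code (f e) (g e) (h e))"
  unfolding code_def by (intro ar_rules')

lemma code_exists:
  assumes A: "A \<in> sets"
  shows "\<exists>u v. \<forall>x. lt x b \<longrightarrow> (code u v x \<longleftrightarrow> x \<in> A)"
proof -
  obtain v where v: "v \<noteq> n0" "\<And>d. d \<noteq> n0 \<Longrightarrow> le d b \<Longrightarrow> dv d v" using common_multiple by blast
  \<comment> \<open>The number \<open>v\<close> is fixed in advance from the bound \<open>b\<close>,
    as it has to be a multiple of all differences of arguments below \<open>b\<close>. Only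
    \<open>u\<close> is built up: it gains the modulus of \<open>k\<close> when \<open>k\<close>
    lies in \<open>A\<close>, and coprimality keeps the other memberships unchanged.\<close>
  have "\<exists>u. \<forall>x. lt x b \<longrightarrow> (code u v x \<longleftrightarrow> x \<in> A \<and> lt x k)" for k
  proof (rule ar_induct[of "\<lambda>k. \<exists>u. \<forall>x. lt x b \<longrightarrow> (code u v x \<longleftrightarrow> x \<in> A \<and> lt x k)"])
    show "ar (\<lambda>e. \<exists>u. \<forall>x. lt x b \<longrightarrow> (code u v x \<longleftrightarrow> x \<in> A \<and> lt x (e 0)))"
      by (intro ar_code ar_rules' A)
    \<comment> \<open>With \<open>u = 1\<close> the empty set is coded, since each modulus exceeds
      1.\<close>
    have "\<not> code n1 v x" for x
    proof
      assume "code n1 v x"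
      then obtain k where k: "n1 = (n1 \<boxplus> (x \<boxplus> n1) \<boxtimes> v) \<boxtimes> k" by (auto simp: code_def dv_def)
      show False
      proof (cases k rule: cases_nat)
        case 1
        with k have "n1 = n0" by (simp add: mult_zero)
        then show ?thesis by (metis Suc_not_zero add_zero)
      next
        case (2 j)
        have "n1 \<boxplus> (v \<boxplus> (x \<boxtimes> v \<boxplus> (n1 \<boxplus> (x \<boxplus> n1) \<boxtimes> v) \<boxtimes> j)) = n1"
          using k unfolding 2 by (simp only: semiring')
        then have "v = n0" using add_eq_self add_eq_zero by metis
        with v show ?thesis by simp
      qed
    qed
    then show "\<exists>u. \<forall>x. lt x b \<longrightarrow> (code u v x \<longleftrightarrow> x \<in> A \<and> lt x n0)"
      using not_lt_zero by blast
    fix k assume "\<exists>u. \<forall>x. lt x b \<longrightarrow> (code u v x \<longleftrightarrow> x \<in> A \<and> lt x k)"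
    then obtain u where u: "\<And>x. lt x b \<Longrightarrow> code u v x \<longleftrightarrow> x \<in> A \<and> lt x k" by blast
    show "\<exists>u. \<forall>x. lt x b \<longrightarrow> (code u v x \<longleftrightarrow> x \<in> A \<and> lt x (k \<boxplus> n1))"
    proof (cases "k \<in> A \<and> lt k b")
      case False
      then show ?thesis using u by (intro exI[of _ u]) (auto simp: lt_Suc le_iff_lt_or_eq)
    next
      case True
      let ?u = "u \<boxtimes> (n1 \<boxplus> (k \<boxplus> n1) \<boxtimes> v)"
      have "code ?u v x \<longleftrightarrow> x \<in> A \<and> lt x (k \<boxplus> n1)" if x: "lt x b" for x
      proof (cases "x = k")
        case eq: True
        then show ?thesis using True
          by (simp add: code_def mult_commute[of u] dv_self_mult lt_Suc le_refl)
      next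
        case False
        obtain d where d: "k = x \<boxplus> d \<or> x = k \<boxplus> d" using le_cases lt_imp_le le_def by metis
        have "d \<noteq> n0" using d False by (auto simp: add_zero)
        moreover have "le d b" using d x True lt_imp_le le_add le_trans by metis
        ultimately have dv: "dv d v" by (rule v)
        have "k \<boxplus> n1 = x \<boxplus> n1 \<boxplus> d \<or> x \<boxplus> n1 = k \<boxplus> n1 \<boxplus> d" using d by (auto simp: Suc_add)
        then have "code ?u v x \<Longrightarrow> code u v x" unfolding code_def
          using coprime_moduli[OF _ dv] by blast
        moreover have "code u v x \<Longrightarrow> code ?u v x" unfolding code_def by (rule dv_mult)
        ultimately have "code ?u v x \<longleftrightarrow> code u v x" by blast
        then show ?thesis using u[OF x] False by (simp add: lt_Suc le_iff_lt_or_eq)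
      qed
      then show ?thesis by blast
    qed
  qed
  from this[of b] show ?thesis by blast
qed

section \<open>Iteration of arithmetical relations\<close>

text \<open>A derivation of \<open>z\<close> at stage \<open>n\<close> is a coded finite set of
  pairs (stage, value) in which each pair at a positive stage up to \<open>n\<close> has a
  predecessor one stage earlier. \<open>T\<close> may be multivalued. The bound \<open>b\<close> is
  part of the code, because nothing is known about divisibility for larger arguments.\<close>

definition reach :: "('n \<Rightarrow> bool) \<Rightarrow> ('n \<Rightarrow> 'n \<Rightarrow> 'n \<Rightarrow> bool) \<Rightarrow> 'n \<Rightarrow> 'n \<Rightarrow> bool" where
  "reach A T n z \<longleftrightarrow> (\<exists>u v b.
     (\<forall>y. lt (pr n0 y) b \<and> code u v (pr n0 y) \<longrightarrow> A y) \<and>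
     (\<forall>i y'. lt i n \<and> lt (pr (i \<boxplus> n1) y') b \<and> code u v (pr (i \<boxplus> n1) y') \<longrightarrow>
        (\<exists>y. (lt (pr i y) b \<and> code u v (pr i y)) \<and> T i y y')) \<and>
     lt (pr n z) b \<and> code u v (pr n z))"

lemma ar_reach:
  assumes "ar (\<lambda>e. A (e 0))" "ar (\<lambda>e. T (e 0) (e 1) (e 2))" "fn f" "fn g"
  shows "ar (\<lambda>e. reach A T (f e) (g e))"
proof (rule ar_sub2[OF _ assms(3,4)])
  show "ar (\<lambda>e. reach A T (e 0) (e 1))"
    unfolding reach_def by (intro ar_rules' ar_code ar_sub3[OF assms(2)] ar_sub1[OF assms(1)])
qed

lemma reach_zero: "reach A T n0 z \<longleftrightarrow> A z"
proof
  assume "A z"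
  have "{x. x = pr n0 z} \<in> sets" by (intro ar_set ar_rules')
  then obtain u v where uv: "\<And>x. lt x (pr n0 z \<boxplus> n1) \<Longrightarrow> code u v x \<longleftrightarrow> x = pr n0 z"
    using code_exists[of "{x. x = pr n0 z}" "pr n0 z \<boxplus> n1"] by auto
  show "reach A T n0 z"
    unfolding reach_def
    by (rule exI[of _ u], rule exI[of _ v], rule exI[of _ "pr n0 z \<boxplus> n1"])
      (use uv \<open>A z\<close> in \<open>auto simp: not_lt_zero lt_Suc le_refl\<close>)
qed (auto simp: reach_def)

lemma reach_Suc:
  assumes T: "ar (\<lambda>e. T (e 0) (e 1) (e 2))"
  shows "reach A T (n \<boxplus> n1) z \<longleftrightarrow> (\<exists>y. reach A T n y \<and> T n y z)"
proof
  assume "reach A T (n \<boxplus> n1) z"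
  then obtain u v b where a: "\<And>y. lt (pr n0 y) b \<and> code u v (pr n0 y) \<Longrightarrow> A y"
    and t: "\<And>i y'. lt i (n \<boxplus> n1) \<and> lt (pr (i \<boxplus> n1) y') b \<and> code u v (pr (i \<boxplus> n1) y') \<Longrightarrow>
        \<exists>y. (lt (pr i y) b \<and> code u v (pr i y)) \<and> T i y y'"
    and c: "lt (pr (n \<boxplus> n1) z) b \<and> code u v (pr (n \<boxplus> n1) z)"
    unfolding reach_def by blast
  have "lt n (n \<boxplus> n1)" by (simp add: lt_Suc le_refl)
  with t c obtain y where y: "lt (pr n y) b" "code u v (pr n y)" "T n y z" by blast
  have "lt i (n \<boxplus> n1)" if "lt i n" for i using that by (simp add: lt_Suc lt_imp_le)
  with a t y have "reach A T n y" unfolding reach_def by blast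
  with y show "\<exists>y. reach A T n y \<and> T n y z" by blast
next
  assume "\<exists>y. reach A T n y \<and> T n y z"
  then obtain y u v b where a: "\<And>y. lt (pr n0 y) b \<and> code u v (pr n0 y) \<Longrightarrow> A y"
    and t: "\<And>i y'. lt i n \<and> lt (pr (i \<boxplus> n1) y') b \<and> code u v (pr (i \<boxplus> n1) y') \<Longrightarrow>
        \<exists>y. (lt (pr i y) b \<and> code u v (pr i y)) \<and> T i y y'"
    and c: "lt (pr n y) b \<and> code u v (pr n y)" and y: "T n y z"
    unfolding reach_def by blast
  \<comment> \<open>The old pairs up to stage \<open>n\<close> together with the new one. Later old
    pairs are discarded: they may lack predecessors, as the old set is controlled only up to stage
    \<open>n\<close>.\<close>
  let ?A = "{x. (\<exists>i w. x = pr i w \<and> le i n \<and> lt x b \<and> code u v x) \<or> x = pr (n \<boxplus> n1) z}"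
  let ?b = "b \<boxplus> (pr (n \<boxplus> n1) z \<boxplus> n1)"
  have "?A \<in> sets" by (intro ar_set ar_rules' ar_code)
  then obtain u' v' where uv: "\<And>x. lt x ?b \<Longrightarrow> code u' v' x \<longleftrightarrow> x \<in> ?A"
    using code_exists[of ?A ?b] by blast
  have b1: "lt x ?b" if "lt x b" for x using that unfolding lt_def by (rule le_trans) (rule le_add)
  have b2: "lt (pr (n \<boxplus> n1) z) ?b" unfolding lt_def by (rule le_add)
  have E: "lt (pr i w) ?b \<and> code u' v' (pr i w) \<longleftrightarrow>
      (le i n \<and> lt (pr i w) b \<and> code u v (pr i w)) \<or> (i = n \<boxplus> n1 \<and> w = z)" for i w
  proof -
    have "lt (pr i w) ?b \<and> code u' v' (pr i w) \<longleftrightarrow> lt (pr i w) ?b \<and> pr i w \<in> ?A" using uv by blast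
    also have "\<dots> \<longleftrightarrow> pr i w \<in> ?A" using b1 b2 by auto
    finally show ?thesis by auto
  qed
  show "reach A T (n \<boxplus> n1) z"
    unfolding reach_def
  proof (rule exI[of _ u'], rule exI[of _ v'], rule exI[of _ ?b], intro conjI allI impI)
    show "A w" if "lt (pr n0 w) ?b \<and> code u' v' (pr n0 w)" for w
      using that Suc_not_zero[of n] a unfolding E by metis
    show "\<exists>w. (lt (pr i w) ?b \<and> code u' v' (pr i w)) \<and> T i w w'"
      if "lt i (n \<boxplus> n1) \<and> lt (pr (i \<boxplus> n1) w') ?b \<and> code u' v' (pr (i \<boxplus> n1) w')" for i w'
    proof (cases "i = n")
      case True
      with that have "w' = z" unfolding E by (metis lt_def lt_irrefl)
      with True y c show ?thesis unfolding E using le_refl by blast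
    next
      case False
      with that have "lt i n" by (simp add: lt_Suc le_iff_lt_or_eq)
      with that have "lt (pr (i \<boxplus> n1) w') b \<and> code u v (pr (i \<boxplus> n1) w')"
        unfolding E using False Suc_inject by blast
      with t[of i w'] \<open>lt i n\<close> show ?thesis unfolding E using lt_imp_le by blast
    qed
    show "lt (pr (n \<boxplus> n1) z) ?b" using b2 .
    show "code u' v' (pr (n \<boxplus> n1) z)" using E[of "n \<boxplus> n1" z] by simp
  qed
qed

end

section \<open>Ideals in the coded ring\<close>

text \<open>The ring lives on numbers of the model, so the algebraic library applies to it.
  Definability of its operations is the link to comprehension and induction inside the
  model.\<close>

locale soa_domain = soa_model n0 n1 plus times less sets pn ps + domain R
  for n0 n1 :: 'a and plus (infixl \<open>\<boxplus>\<close> 65) and times (infixl \<open>\<boxtimes>\<close> 70)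
    and less sets pn ps and R :: "'a ring" (structure) +
  assumes carrier_set: "carrier R \<in> sets"
    and ar_add: "ar (\<lambda>e. e 0 = e 1 \<oplus> e 2)"
    and ar_mult: "ar (\<lambda>e. e 0 = e 1 \<otimes> e 2)"
begin

text \<open>The closure condition of a Sigma ideal, stated for its set of members; nonemptiness
  reflects that a sequence has a first entry.\<close>

definition is_ideal :: "'a set \<Rightarrow> bool" where
  "is_ideal I \<longleftrightarrow> I \<subseteq> carrier R \<and> I \<noteq> {} \<and>
     (\<forall>x\<in>I. \<forall>y\<in>I. \<forall>r\<in>carrier R. \<forall>s\<in>carrier R. x \<otimes> r \<oplus> y \<otimes> s \<in> I)"

definition is_prime :: "'a set \<Rightarrow> bool" where
  "is_prime I \<longleftrightarrow> (\<forall>x\<in>carrier R. \<forall>y\<in>carrier R. x \<otimes> y \<in> I \<longrightarrow> x \<in> I \<or> y \<in> I)"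

definition generates :: "'a \<Rightarrow> 'a set \<Rightarrow> bool" where
  "generates c I \<longleftrightarrow> c \<in> carrier R \<and> (\<forall>x\<in>carrier R. x \<in> I \<longleftrightarrow> c divides x)"

lemma fn_add: "fn f \<Longrightarrow> fn g \<Longrightarrow> fn (\<lambda>e. f e \<oplus> g e)"
  by (rule fn_sub2[where F = "\<lambda>x y. x \<oplus> y", OF ar_add])

lemma fn_mult: "fn f \<Longrightarrow> fn g \<Longrightarrow> fn (\<lambda>e. f e \<otimes> g e)"
  by (rule fn_sub2[where F = "\<lambda>x y. x \<otimes> y", OF ar_mult])

lemmas ring_rules = fn_add fn_mult carrier_set ar_rules'

lemma ar_divides: "fn f \<Longrightarrow> fn g \<Longrightarrow> ar (\<lambda>e. f e divides g e)"
  by (rule ar_sub2[where P = "\<lambda>x y. x divides y"]) (unfold factor_def, intro ring_rules)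

lemma ideal_mult: "is_ideal I \<Longrightarrow> x \<in> I \<Longrightarrow> r \<in> carrier R \<Longrightarrow> x \<otimes> r \<in> I"
proof -
  assume I: "is_ideal I" and x: "x \<in> I" and r: "r \<in> carrier R"
  then have "x \<otimes> r \<oplus> x \<otimes> \<zero> \<in> I" unfolding is_ideal_def by blast
  moreover have "x \<in> carrier R" using I x unfolding is_ideal_def by blast
  ultimately show ?thesis using r by simp
qed

lemma ideal_add: "is_ideal I \<Longrightarrow> x \<in> I \<Longrightarrow> y \<in> I \<Longrightarrow> x \<oplus> y \<in> I"
proof -
  assume I: "is_ideal I" and x: "x \<in> I" and y: "y \<in> I"
  then have "x \<otimes> \<one> \<oplus> y \<otimes> \<one> \<in> I" unfolding is_ideal_def by blast
  moreover have "x \<in> carrier R" "y \<in> carrier R" using I x y unfolding is_ideal_def by blast+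
  ultimately show ?thesis by simp
qed

lemma ideal_carrier: "is_ideal I \<Longrightarrow> x \<in> I \<Longrightarrow> x \<in> carrier R"
  unfolding is_ideal_def by blast

lemma is_idealI:
  assumes "I \<subseteq> carrier R" "\<zero> \<in> I" "\<And>x y. x \<in> I \<Longrightarrow> y \<in> I \<Longrightarrow> x \<oplus> y \<in> I"
    "\<And>x r. x \<in> I \<Longrightarrow> r \<in> carrier R \<Longrightarrow> x \<otimes> r \<in> I"
  shows "is_ideal I"
  using assms unfolding is_ideal_def by blast

lemma ideal_zero: "is_ideal I \<Longrightarrow> \<zero> \<in> I"
proof -
  assume I: "is_ideal I"
  then obtain x where "x \<in> I" unfolding is_ideal_def by blast
  with ideal_mult[OF I this, of \<zero>] ideal_carrier[OF I this] show ?thesis by simp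
qed

text \<open>
  Instead of adding elements to \<open>I\<close> one passes to colon ideals \<open>(J : e)\<close>, each of which is given by
  a single element \<open>e\<close>. Stage \<open>pr r k\<close> multiplies \<open>e\<close> by \<open>r\<close> unless \<open>e r \<in> J\<close>. Every \<open>r\<close> is treated
  at arbitrarily late stages, which makes the union of the ideals \<open>(J : e)\<close> prime.
\<close>

lemma prime_avoidance:
  assumes I: "I \<in> sets" "is_ideal I"
    and S: "S \<in> sets" "S \<subseteq> carrier R" "\<one> \<in> S" "\<And>s t. s \<in> S \<Longrightarrow> t \<in> S \<Longrightarrow> s \<otimes> t \<in> S"
    and disjoint: "I \<inter> S = {}"
  obtains P where "P \<in> sets" "is_ideal P" "is_prime P" "I \<subseteq> P" "P \<inter> S = {}"
proof -
  \<comment> \<open>\<open>J\<close> is the saturation of \<open>I\<close>, the contraction of its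
    extension to the localization at \<open>S\<close>. With it, \<open>(J : e)\<close> is disjoint
    from \<open>S\<close> exactly if \<open>e\<close> lies outside \<open>J\<close>, so avoiding
    \<open>S\<close> becomes a condition on the single element \<open>e\<close>.\<close>
  define J where "J = {x. x \<in> carrier R \<and> (\<exists>s\<in>S. s \<otimes> x \<in> I)}"
  have J_set: "J \<in> sets" unfolding J_def by (intro ar_set ring_rules S I)
  have J_carrier: "x \<in> J \<Longrightarrow> x \<in> carrier R" for x by (simp add: J_def)
  have J_mult: "x \<otimes> r \<in> J" if "x \<in> J" "r \<in> carrier R" for x r
  proof -
    from that obtain s where s: "s \<in> S" "s \<otimes> x \<in> I" "x \<in> carrier R" by (auto simp: J_def)
    have "s \<otimes> (x \<otimes> r) = s \<otimes> x \<otimes> r" using s S(2) that by (simp add: m_assoc subsetD)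
    then have "s \<otimes> (x \<otimes> r) \<in> I" using ideal_mult[OF I(2) s(2) that(2)] by simp
    with s that show ?thesis by (auto simp: J_def)
  qed
  have J_add: "x \<oplus> y \<in> J" if "x \<in> J" "y \<in> J" for x y
  proof -
    from that obtain s t where s: "s \<in> S" "s \<otimes> x \<in> I" "x \<in> carrier R"
      and t: "t \<in> S" "t \<otimes> y \<in> I" "y \<in> carrier R" by (auto simp: J_def)
    have st: "s \<in> carrier R" "t \<in> carrier R" using s t S(2) by auto
    have "s \<otimes> t \<otimes> (x \<oplus> y) = (s \<otimes> x) \<otimes> t \<oplus> (t \<otimes> y) \<otimes> s"
      using s(3) t(3) st by algebra
    then have "s \<otimes> t \<otimes> (x \<oplus> y) \<in> I"
      using ideal_add[OF I(2) ideal_mult[OF I(2) s(2) st(2)] ideal_mult[OF I(2) t(2) st(1)]] by simp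
    moreover have "s \<otimes> t \<in> S" using S(4) s t by blast
    ultimately show ?thesis using s(3) t(3) by (auto simp: J_def)
  qed
  have J_S: "e \<in> J" if "e \<otimes> s \<in> J" "s \<in> S" "e \<in> carrier R" for e s
  proof -
    from that obtain t where t: "t \<in> S" "t \<otimes> (e \<otimes> s) \<in> I" by (auto simp: J_def)
    have "t \<otimes> (e \<otimes> s) = t \<otimes> s \<otimes> e" using t that S(2) by (simp add: m_ac subsetD)
    with t S(4) that show ?thesis by (auto simp: J_def)
  qed
  have one_J: "\<one> \<notin> J"
  proof
    assume "\<one> \<in> J"
    then obtain s where s: "s \<in> S" "s \<otimes> \<one> \<in> I" by (auto simp: J_def)
    then have "s \<in> I" using S(2) by (simp add: subsetD)
    with s(1) disjoint show False by blast
  qed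
  \<comment> \<open>The second disjunct also covers the numbers that code no pair headed by a ring
    element; hence \<open>T\<close> is total as well as functional.\<close>
  define T where "T = (\<lambda>m z z'. (\<exists>r\<in>carrier R. \<exists>k. m = pr r k \<and> z \<otimes> r \<notin> J \<and> z' = z \<otimes> r) \<or>
    ((\<forall>r\<in>carrier R. \<forall>k. m = pr r k \<longrightarrow> z \<otimes> r \<in> J) \<and> z' = z))"
  have T: "ar (\<lambda>e. T (e 0) (e 1) (e 2))" unfolding T_def by (intro ring_rules J_set)
  define Q where "Q = reach (\<lambda>z. z = \<one>) T"
  have Q_ar: "ar (\<lambda>e. Q (f e) (g e))" if "fn f" "fn g" for f g
    unfolding Q_def by (intro ar_reach T that) (intro ring_rules)
  have Q0: "Q n0 z \<longleftrightarrow> z = \<one>" for z unfolding Q_def by (rule reach_zero)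
  have QS: "Q (m \<boxplus> n1) z' \<longleftrightarrow> (\<exists>z. Q m z \<and> T m z z')" for m z' unfolding Q_def by (rule reach_Suc[OF T])
  have T_total: "\<exists>z'. T m z z'" for m z unfolding T_def by blast
  have T_mult: "\<exists>r\<in>carrier R. z' = z \<otimes> r" "z' \<notin> J" if "T m z z'" "z \<in> carrier R" "z \<notin> J" for m z z'
    using that unfolding T_def by (auto intro: bexI[of _ \<one>])
  have T_unique: "z' = z''" if "T m z z'" "T m z z''" for m z z' z'' using that unfolding T_def by auto
  have Q_ex: "\<exists>z. Q m z" for m
  proof (rule ar_induct[of "\<lambda>m. \<exists>z. Q m z"])
    show "ar (\<lambda>e. \<exists>z. Q (e 0) z)" by (intro ring_rules Q_ar)
  qed (use Q0 QS T_total in blast)+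
  have Q_J: "z \<in> carrier R \<and> z \<notin> J" if "Q m z" for m z
  proof -
    have "\<forall>z. Q m z \<longrightarrow> z \<in> carrier R \<and> z \<notin> J"
    proof (rule ar_induct[of "\<lambda>m. \<forall>z. Q m z \<longrightarrow> z \<in> carrier R \<and> z \<notin> J"])
      show "ar (\<lambda>e. \<forall>z. Q (e 0) z \<longrightarrow> z \<in> carrier R \<and> z \<notin> J)" by (intro ring_rules Q_ar J_set)
      show "\<forall>z. Q n0 z \<longrightarrow> z \<in> carrier R \<and> z \<notin> J" using Q0 one_J by auto
      fix m assume IH: "\<forall>z. Q m z \<longrightarrow> z \<in> carrier R \<and> z \<notin> J"
      show "\<forall>z. Q (m \<boxplus> n1) z \<longrightarrow> z \<in> carrier R \<and> z \<notin> J"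
      proof (intro allI impI)
        fix z assume "Q (m \<boxplus> n1) z"
        then obtain y where "Q m y" "T m y z" using QS by blast
        with IH T_mult[of m y z] show "z \<in> carrier R \<and> z \<notin> J" by auto
      qed
    qed
    with that show ?thesis by blast
  qed
  have Q_unique: "z = z'" if "Q m z" "Q m z'" for m z z'
  proof -
    have "\<forall>z z'. Q m z \<longrightarrow> Q m z' \<longrightarrow> z = z'"
    proof (rule ar_induct[of "\<lambda>m. \<forall>z z'. Q m z \<longrightarrow> Q m z' \<longrightarrow> z = z'"])
      show "ar (\<lambda>e. \<forall>z z'. Q (e 0) z \<longrightarrow> Q (e 0) z' \<longrightarrow> z = z')" by (intro ring_rules Q_ar)
      show "\<forall>z z'. Q n0 z \<longrightarrow> Q n0 z' \<longrightarrow> z = z'" using Q0 by simp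
      show "\<forall>z z'. Q (m \<boxplus> n1) z \<longrightarrow> Q (m \<boxplus> n1) z' \<longrightarrow> z = z'"
        if "\<forall>z z'. Q m z \<longrightarrow> Q m z' \<longrightarrow> z = z'" for m
        using that T_unique unfolding QS by metis
    qed
    with that show ?thesis by blast
  qed
  \<comment> \<open>Later multipliers are multiples of earlier ones, so the ideals
    \<open>(J : z)\<close> increase along the stages.\<close>
  have Q_mono: "\<exists>r\<in>carrier R. w = z \<otimes> r" if z: "Q m z" and "Q (m \<boxplus> k) w" for m k z w
  proof -
    have "\<forall>w. Q (m \<boxplus> k) w \<longrightarrow> (\<exists>r\<in>carrier R. w = z \<otimes> r)"
    proof (rule ar_induct[of "\<lambda>k. \<forall>w. Q (m \<boxplus> k) w \<longrightarrow> (\<exists>r\<in>carrier R. w = z \<otimes> r)"])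
      show "ar (\<lambda>e. \<forall>w. Q (m \<boxplus> e 0) w \<longrightarrow> (\<exists>r\<in>carrier R. w = z \<otimes> r))"
        by (intro ring_rules Q_ar)
      show "\<forall>w. Q (m \<boxplus> n0) w \<longrightarrow> (\<exists>r\<in>carrier R. w = z \<otimes> r)"
        using Q_unique[OF z] Q_J[OF z] by (auto simp: add_zero intro: bexI[of _ \<one>])
      fix k assume IH: "\<forall>w. Q (m \<boxplus> k) w \<longrightarrow> (\<exists>r\<in>carrier R. w = z \<otimes> r)"
      show "\<forall>w. Q (m \<boxplus> (k \<boxplus> n1)) w \<longrightarrow> (\<exists>r\<in>carrier R. w = z \<otimes> r)"
      proof (intro allI impI)
        fix w assume "Q (m \<boxplus> (k \<boxplus> n1)) w"
        then obtain y where y: "Q (m \<boxplus> k) y" "T (m \<boxplus> k) y w" using QS by (auto simp: add_Suc)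
        then obtain r r' where "r \<in> carrier R" "w = y \<otimes> r" "r' \<in> carrier R" "y = z \<otimes> r'"
          using IH T_mult(1)[of "m \<boxplus> k" y w] Q_J[OF y(1)] by blast
        then show "\<exists>r\<in>carrier R. w = z \<otimes> r"
          using Q_J[OF z] by (intro bexI[of _ "r' \<otimes> r"]) (auto simp: m_assoc)
      qed
    qed
    with that show ?thesis by blast
  qed
  have J_later: "w \<otimes> x \<in> J" if "Q m z" "z \<otimes> x \<in> J" "x \<in> carrier R" "Q m' w" "le m m'" for m m' z w x
  proof -
    from that(5) obtain k where "m' = m \<boxplus> k" by (auto simp: le_def)
    with that Q_mono obtain r where r: "r \<in> carrier R" "w = z \<otimes> r" by blast
    have "w \<otimes> x = z \<otimes> x \<otimes> r" using r that(3) Q_J[OF that(1)] by (simp add: m_ac)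
    with J_mult[OF that(2) r(1)] show ?thesis by simp
  qed
  define P where "P = {x. x \<in> carrier R \<and> (\<exists>m z. Q m z \<and> z \<otimes> x \<in> J)}"
  have "P \<in> sets" unfolding P_def by (intro ar_set ring_rules Q_ar J_set)
  moreover have IP: "I \<subseteq> P"
  proof
    fix x assume "x \<in> I"
    then have x: "x \<in> carrier R" using ideal_carrier I by blast
    then have "\<one> \<otimes> x \<in> J" using S(3) \<open>x \<in> I\<close> by (auto simp: J_def intro: bexI[of _ \<one>])
    then have "Q n0 \<one> \<and> \<one> \<otimes> x \<in> J" using Q0 by blast
    then show "x \<in> P" unfolding P_def using x by blast
  qed
  moreover have "is_ideal P"
  proof (rule is_idealI)
    show "P \<subseteq> carrier R" by (auto simp: P_def)
    show "\<zero> \<in> P" using IP ideal_zero I by blast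
    fix x assume "x \<in> P"
    then obtain m z where x: "x \<in> carrier R" "Q m z" "z \<otimes> x \<in> J" by (auto simp: P_def)
    show "x \<otimes> r \<in> P" if "r \<in> carrier R" for r
    proof -
      have "z \<otimes> (x \<otimes> r) = z \<otimes> x \<otimes> r" using x that Q_J by (simp add: m_assoc)
      with J_mult[OF x(3) that] have "z \<otimes> (x \<otimes> r) \<in> J" by simp
      then show ?thesis unfolding P_def using x(2) m_closed[OF x(1) that] by blast
    qed
    show "x \<oplus> y \<in> P" if "y \<in> P" for y
    proof -
      from that obtain m' z' where y: "y \<in> carrier R" "Q m' z'" "z' \<otimes> y \<in> J" by (auto simp: P_def)
      obtain w where w: "Q (m \<boxplus> m') w" using Q_ex by blast
      have "w \<otimes> x \<in> J" "w \<otimes> y \<in> J"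
        using J_later[OF x(2,3,1) w] J_later[OF y(2,3,1) w] le_add by auto
      then have "w \<otimes> x \<oplus> w \<otimes> y \<in> J" by (rule J_add)
      then have "w \<otimes> (x \<oplus> y) \<in> J" using x(1) y(1) Q_J[OF w] by (simp add: r_distr)
      then show ?thesis unfolding P_def using w a_closed[OF x(1) y(1)] by blast
    qed
  qed
  moreover have "P \<inter> S = {}"
    using J_S Q_J by (auto simp: P_def)
  moreover have "is_prime P"
    unfolding is_prime_def
  proof (intro ballI impI, rule ccontr)
    fix x y assume x: "x \<in> carrier R" and y: "y \<in> carrier R" and "x \<otimes> y \<in> P" and n: "\<not> (x \<in> P \<or> y \<in> P)"
    then obtain m z where z: "Q m z" "z \<otimes> (x \<otimes> y) \<in> J" by (auto simp: P_def)
    \<comment> \<open>An element outside \<open>P\<close> really becomes a factor of the multiplier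
      at any later stage devoted to it. This is applied to \<open>x\<close> and then to
      \<open>y\<close>: after \<open>x\<close> has been absorbed, \<open>x y\<close> in
      \<open>P\<close> puts the product of \<open>y\<close> with every later multiplier into
      \<open>J\<close>, yet absorbing \<open>y\<close> yields such a product as a multiplier outside
      \<open>J\<close>.\<close>
    have step: "\<exists>m' w. le m m' \<and> Q m' w \<and> Q (m' \<boxplus> n1) (w \<otimes> r)" if "r \<in> carrier R" "r \<notin> P" for m r
    proof -
      obtain w where w: "Q (pr r m) w" using Q_ex by blast
      then have "w \<otimes> r \<notin> J" using that by (auto simp: P_def)
      then have "T (pr r m) w (w \<otimes> r)" using that unfolding T_def by blast
      with w QS le_pr show ?thesis by blast
    qed
    obtain m1 w1 where 1: "le m m1" "Q m1 w1" "Q (m1 \<boxplus> n1) (w1 \<otimes> x)" using step[OF x] n by blast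
    obtain m2 w2 where 2: "le (m1 \<boxplus> n1) m2" "Q m2 w2" "Q (m2 \<boxplus> n1) (w2 \<otimes> y)" using step[OF y] n by blast
    have w1: "w1 \<in> carrier R" using Q_J[OF 1(2)] by blast
    have "w1 \<otimes> (x \<otimes> y) \<in> J" using J_later[OF z _ 1(2,1)] x y by simp
    then have "w1 \<otimes> x \<otimes> y \<in> J" using w1 x y by (simp add: m_assoc)
    then have "w2 \<otimes> y \<in> J" using J_later[OF 1(3) _ y 2(2,1)] by simp
    with Q_J[OF 2(3)] show False by blast
  qed
  ultimately show thesis using that by blast
qed

section \<open>Prime elements and the length of a factorization\<close>

definition prime_element :: "'a \<Rightarrow> bool" where
  "prime_element p \<longleftrightarrow> p \<in> carrier R \<and> p \<noteq> \<zero> \<and> \<not> p divides \<one> \<and>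
     (\<forall>x\<in>carrier R. \<forall>y\<in>carrier R. p divides x \<otimes> y \<longrightarrow> p divides x \<or> p divides y)"

lemma ar_prime_element: "fn f \<Longrightarrow> ar (\<lambda>e. prime_element (f e))"
  by (rule ar_sub1[where P = prime_element]) (unfold prime_element_def, intro ring_rules ar_divides)

text \<open>\<open>len n s\<close> says that \<open>s\<close> is a unit times a product of \<open>n\<close> primes.\<close>

definition len :: "'a \<Rightarrow> 'a \<Rightarrow> bool" where
  "len = reach (\<lambda>s. s \<in> carrier R \<and> s divides \<one>) (\<lambda>_ s t. \<exists>p. prime_element p \<and> t = p \<otimes> s)"

lemma ar_len: "fn f \<Longrightarrow> fn g \<Longrightarrow> ar (\<lambda>e. len (f e) (g e))"
  unfolding len_def by (rule ar_reach) (intro ring_rules ar_divides ar_prime_element; assumption)+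

lemma len_zero: "len n0 s \<longleftrightarrow> s \<in> carrier R \<and> s divides \<one>"
  unfolding len_def by (rule reach_zero)

lemma len_Suc: "len (n \<boxplus> n1) t \<longleftrightarrow> (\<exists>s. len n s \<and> (\<exists>p. prime_element p \<and> t = p \<otimes> s))"
  unfolding len_def by (rule reach_Suc) (intro ring_rules ar_prime_element)

lemma prime_element_carrier: "prime_element p \<Longrightarrow> p \<in> carrier R"
  by (simp add: prime_element_def)

lemma len_carrier: "len n s \<Longrightarrow> s \<in> carrier R"
proof -
  have "\<forall>s. len n s \<longrightarrow> s \<in> carrier R"
  proof (rule ar_induct[of "\<lambda>n. \<forall>s. len n s \<longrightarrow> s \<in> carrier R"])
    show "ar (\<lambda>e. \<forall>s. len (e 0) s \<longrightarrow> s \<in> carrier R)" by (intro ring_rules ar_len)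
  qed (auto simp: len_zero len_Suc prime_element_carrier)
  then show "len n s \<Longrightarrow> s \<in> carrier R" by blast
qed

lemma len_mult_unit:
  assumes u: "u \<in> carrier R" "u divides \<one>"
  shows "len n s \<Longrightarrow> len n (u \<otimes> s)"
proof -
  have "\<forall>s. len n s \<longrightarrow> len n (u \<otimes> s)"
  proof (rule ar_induct[of "\<lambda>n. \<forall>s. len n s \<longrightarrow> len n (u \<otimes> s)"])
    show "ar (\<lambda>e. \<forall>s. len (e 0) s \<longrightarrow> len (e 0) (u \<otimes> s))" by (intro ring_rules ar_len)
    show "\<forall>s. len n0 s \<longrightarrow> len n0 (u \<otimes> s)"
    proof (intro allI impI)
      fix s assume "len n0 s"
      then obtain v w where s: "s \<in> carrier R" "v \<in> carrier R" "\<one> = s \<otimes> v" "w \<in> carrier R" "\<one> = u \<otimes> w"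
        using u by (auto simp: len_zero factor_def)
      have "(u \<otimes> s) \<otimes> (v \<otimes> w) = (s \<otimes> v) \<otimes> (u \<otimes> w)" using s u by (simp add: m_ac)
      then have "\<one> = (u \<otimes> s) \<otimes> (v \<otimes> w)" by (simp flip: s(3,5))
      then have "u \<otimes> s divides \<one>" by (rule dividesI[rotated]) (use s in simp)
      with s u show "len n0 (u \<otimes> s)" by (simp add: len_zero)
    qed
    fix n assume IH: "\<forall>s. len n s \<longrightarrow> len n (u \<otimes> s)"
    show "\<forall>s. len (n \<boxplus> n1) s \<longrightarrow> len (n \<boxplus> n1) (u \<otimes> s)"
    proof (intro allI impI)
      fix s assume "len (n \<boxplus> n1) s"
      then obtain p y where y: "len n y" "prime_element p" "s = p \<otimes> y" by (auto simp: len_Suc)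
      then have "u \<otimes> s = p \<otimes> (u \<otimes> y)"
        using u len_carrier prime_element_carrier by (simp add: m_lcomm)
      with y IH show "len (n \<boxplus> n1) (u \<otimes> s)" by (auto simp: len_Suc)
    qed
  qed
  then show "len n s \<Longrightarrow> len n (u \<otimes> s)" by blast
qed

text \<open>Makes the elements that have a length a multiplicative set, by moving the primes of
  \<open>s\<close> onto \<open>t\<close> one at a time.\<close>

lemma len_mult:
  assumes t: "len k t"
  shows "len n s \<Longrightarrow> \<exists>j. len j (s \<otimes> t)"
proof -
  have tc: "t \<in> carrier R" using t by (rule len_carrier)
  have "\<forall>s. len n s \<longrightarrow> (\<exists>j. len j (s \<otimes> t))"
  proof (rule ar_induct[of "\<lambda>n. \<forall>s. len n s \<longrightarrow> (\<exists>j. len j (s \<otimes> t))"])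
    show "ar (\<lambda>e. \<forall>s. len (e 0) s \<longrightarrow> (\<exists>j. len j (s \<otimes> t)))" by (intro ring_rules ar_len)
    show "\<forall>s. len n0 s \<longrightarrow> (\<exists>j. len j (s \<otimes> t))" using len_mult_unit[OF _ _ t] by (auto simp: len_zero)
    fix n assume IH: "\<forall>s. len n s \<longrightarrow> (\<exists>j. len j (s \<otimes> t))"
    show "\<forall>s. len (n \<boxplus> n1) s \<longrightarrow> (\<exists>j. len j (s \<otimes> t))"
    proof (intro allI impI)
      fix s assume "len (n \<boxplus> n1) s"
      then obtain p y where y: "len n y" "prime_element p" "s = p \<otimes> y" by (auto simp: len_Suc)
      then have "s \<otimes> t = p \<otimes> (y \<otimes> t)"
        using tc len_carrier prime_element_carrier by (simp add: m_assoc)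
      with y IH show "\<exists>j. len j (s \<otimes> t)" by (metis len_Suc)
    qed
  qed
  then show "len n s \<Longrightarrow> \<exists>j. len j (s \<otimes> t)" by blast
qed

lemma prime_divides_cases:
  assumes p: "prime_element p" and ab: "a \<in> carrier R" "b \<in> carrier R" "c \<in> carrier R" "a \<otimes> b = p \<otimes> c"
  obtains d where "d \<in> carrier R" "a = p \<otimes> d" "d \<otimes> b = c" | d where "d \<in> carrier R" "b = p \<otimes> d" "a \<otimes> d = c"
proof -
  have pc: "p \<in> carrier R" "p \<noteq> \<zero>" using p by (auto simp: prime_element_def)
  have "p divides a \<otimes> b" using ab by (auto simp: factor_def)
  then have "p divides a \<or> p divides b" using p ab by (auto simp: prime_element_def)
  then show thesis
  proof
    assume "p divides a"
    then obtain d where d: "d \<in> carrier R" "a = p \<otimes> d" by (auto simp: factor_def)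
    then have "p \<otimes> (d \<otimes> b) = p \<otimes> c" using ab pc by (simp add: m_assoc)
    then have "d \<otimes> b = c" using ab pc d by (simp add: m_lcancel)
    with d that(1) show ?thesis by blast
  next
    assume "p divides b"
    then obtain d where d: "d \<in> carrier R" "b = p \<otimes> d" by (auto simp: factor_def)
    then have "p \<otimes> (a \<otimes> d) = p \<otimes> c" using ab pc by (simp add: m_lcomm)
    then have "a \<otimes> d = c" using ab pc d by (simp add: m_lcancel)
    with d that(2) show ?thesis by blast
  qed
qed

text \<open>The multiplicative set of elements with a length is closed under divisors: each prime of
  the product divides one of the two factors and can be cancelled there. Hence if \<open>a\<close>
  has no length, neither has any multiple of it.\<close>

lemma len_factor: "len n (a \<otimes> b) \<Longrightarrow> a \<in> carrier R \<Longrightarrow> b \<in> carrier R \<Longrightarrow> \<exists>j. len j a"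
proof -
  have "\<forall>a\<in>carrier R. \<forall>b\<in>carrier R. len n (a \<otimes> b) \<longrightarrow> (\<exists>j. len j a)"
  proof (rule ar_induct[of "\<lambda>n. \<forall>a\<in>carrier R. \<forall>b\<in>carrier R. len n (a \<otimes> b) \<longrightarrow> (\<exists>j. len j a)"])
    show "ar (\<lambda>e. \<forall>a\<in>carrier R. \<forall>b\<in>carrier R. len (e 0) (a \<otimes> b) \<longrightarrow> (\<exists>j. len j a))"
      by (intro ring_rules ar_len)
    show "\<forall>a\<in>carrier R. \<forall>b\<in>carrier R. len n0 (a \<otimes> b) \<longrightarrow> (\<exists>j. len j a)"
    proof (intro ballI impI)
      fix a b assume ab: "a \<in> carrier R" "b \<in> carrier R" "len n0 (a \<otimes> b)"
      then obtain c where "c \<in> carrier R" "\<one> = a \<otimes> b \<otimes> c" by (auto simp: len_zero factor_def)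
      then have "a divides \<one>" using ab by (intro dividesI[of "b \<otimes> c"]) (simp_all add: m_assoc)
      then show "\<exists>j. len j a" using ab len_zero by blast
    qed
    fix n assume IH: "\<forall>a\<in>carrier R. \<forall>b\<in>carrier R. len n (a \<otimes> b) \<longrightarrow> (\<exists>j. len j a)"
    show "\<forall>a\<in>carrier R. \<forall>b\<in>carrier R. len (n \<boxplus> n1) (a \<otimes> b) \<longrightarrow> (\<exists>j. len j a)"
    proof (intro ballI impI)
      fix a b assume ab: "a \<in> carrier R" "b \<in> carrier R" and "len (n \<boxplus> n1) (a \<otimes> b)"
      then obtain p y where y: "len n y" "prime_element p" "a \<otimes> b = p \<otimes> y" by (auto simp: len_Suc)
      show "\<exists>j. len j a"
      proof (cases rule: prime_divides_cases[OF y(2) ab len_carrier[OF y(1)] y(3)])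
        case (1 d)
        with IH ab y(1) have "\<exists>j. len j d" by blast
        with 1 y(2) show ?thesis by (metis len_Suc)
      next
        case (2 d)
        with IH ab y(1) show ?thesis by blast
      qed
    qed
  qed
  then show "len n (a \<otimes> b) \<Longrightarrow> a \<in> carrier R \<Longrightarrow> b \<in> carrier R \<Longrightarrow> \<exists>j. len j a" by blast
qed

text \<open>Compare \<open>p\<close> with the outermost prime \<open>q\<close> of the factorization.
  If \<open>q\<close> divides \<open>s\<close>, cancel it and use induction. Otherwise
  \<open>q\<close> divides \<open>p\<close>; then the two are associated, and \<open>s\<close> is
  the rest of the factorization up to a unit. The length drops by exactly one, which drives the
  later descent.\<close>

lemma len_cancel_prime:
  "len n (p \<otimes> s) \<Longrightarrow> prime_element p \<Longrightarrow> s \<in> carrier R \<Longrightarrow> \<exists>m. n = m \<boxplus> n1 \<and> len m s"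
proof -
  have "\<forall>p. prime_element p \<longrightarrow> (\<forall>s\<in>carrier R. len n (p \<otimes> s) \<longrightarrow> (\<exists>m. n = m \<boxplus> n1 \<and> len m s))"
  proof (rule ar_induct[of "\<lambda>n. \<forall>p. prime_element p \<longrightarrow>
        (\<forall>s\<in>carrier R. len n (p \<otimes> s) \<longrightarrow> (\<exists>m. n = m \<boxplus> n1 \<and> len m s))"])
    show "ar (\<lambda>e. \<forall>p. prime_element p \<longrightarrow>
        (\<forall>s\<in>carrier R. len (e 0) (p \<otimes> s) \<longrightarrow> (\<exists>m. e 0 = m \<boxplus> n1 \<and> len m s)))"
      by (intro ring_rules ar_len ar_prime_element)
    show "\<forall>p. prime_element p \<longrightarrow>
        (\<forall>s\<in>carrier R. len n0 (p \<otimes> s) \<longrightarrow> (\<exists>m. n0 = m \<boxplus> n1 \<and> len m s))"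
    proof (intro ballI allI impI)
      fix p s assume p: "prime_element p" "s \<in> carrier R" "len n0 (p \<otimes> s)"
      then obtain c where "c \<in> carrier R" "\<one> = p \<otimes> s \<otimes> c" by (auto simp: len_zero factor_def)
      then have "p divides \<one>" using p
        by (intro dividesI[of "s \<otimes> c"]) (simp_all add: m_assoc prime_element_carrier)
      with p show "\<exists>m. n0 = m \<boxplus> n1 \<and> len m s" by (simp add: prime_element_def)
    qed
    fix n assume IH: "\<forall>p. prime_element p \<longrightarrow>
        (\<forall>s\<in>carrier R. len n (p \<otimes> s) \<longrightarrow> (\<exists>m. n = m \<boxplus> n1 \<and> len m s))"
    have "len n s" if p: "prime_element p" and s: "s \<in> carrier R" and l: "len (n \<boxplus> n1) (p \<otimes> s)" for p s
    proof -
      from l obtain q y where y: "len n y" "prime_element q" "p \<otimes> s = q \<otimes> y" by (auto simp: len_Suc)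
      have pc: "p \<in> carrier R" "p \<noteq> \<zero>" "\<not> p divides \<one>" and qc: "q \<in> carrier R" "q \<noteq> \<zero>" "\<not> q divides \<one>"
        using p y(2) by (auto simp: prime_element_def)
      show ?thesis
      proof (cases rule: prime_divides_cases[OF y(2) pc(1) s len_carrier[OF y(1)] y(3)])
        case (1 t)
        then have "q \<otimes> t = p \<otimes> \<one>" using pc by simp
        show ?thesis
        proof (cases rule: prime_divides_cases[OF p qc(1) 1(1) one_closed \<open>q \<otimes> t = p \<otimes> \<one>\<close>])
          case (1 v)
          then have "t divides \<one>" using \<open>t \<in> carrier R\<close> by (metis dividesI m_comm)
          moreover have "v divides \<one>" using 1(1,3) \<open>t \<in> carrier R\<close> by (metis dividesI)
          ultimately have "len n (v \<otimes> y)" using len_mult_unit[OF 1(1) _ y(1)] by blast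
          moreover have "v \<otimes> y = s"
          proof -
            have "v \<otimes> y = v \<otimes> (t \<otimes> s)" using \<open>t \<otimes> s = y\<close> by simp
            also have "\<dots> = s" using 1(1,3) s \<open>t \<in> carrier R\<close> by (simp add: m_assoc[symmetric])
            finally show ?thesis .
          qed
          ultimately show ?thesis by simp
        next
          case (2 w)
          then have "q divides \<one>" by (metis dividesI)
          with qc show ?thesis by blast
        qed
      next
        case (2 t)
        with IH p y(1) obtain m where "n = m \<boxplus> n1" "len m t" by blast
        with 2 y(2) show ?thesis by (auto simp: len_Suc)
      qed
    qed
    then show "\<forall>p. prime_element p \<longrightarrow>
        (\<forall>s\<in>carrier R. len (n \<boxplus> n1) (p \<otimes> s) \<longrightarrow> (\<exists>m. n \<boxplus> n1 = m \<boxplus> n1 \<and> len m s))" by blast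
  qed
  then show "len n (p \<otimes> s) \<Longrightarrow> prime_element p \<Longrightarrow> s \<in> carrier R \<Longrightarrow> \<exists>m. n = m \<boxplus> n1 \<and> len m s" by blast
qed

text \<open>A nonzero member of \<open>P\<close> excludes the generator 0, and the absence of 1
  excludes a unit; primality of the ideal alone gives neither.\<close>

lemma prime_generator:
  assumes "is_prime P" "generates p P" "a \<in> P" "a \<in> carrier R" "a \<noteq> \<zero>" "\<one> \<notin> P"
  shows "prime_element p"
proof -
  have p: "p \<in> carrier R" "\<And>x. x \<in> carrier R \<Longrightarrow> x \<in> P \<longleftrightarrow> p divides x"
    using assms(2) by (auto simp: generates_def)
  have "p \<noteq> \<zero>" using p assms by (auto simp: factor_def)
  with p assms show ?thesis by (simp add: prime_element_def is_prime_def)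
qed

theorem all_ideals_principal:
  assumes primes: "\<And>P. P \<in> sets \<Longrightarrow> is_ideal P \<Longrightarrow> is_prime P \<Longrightarrow> \<exists>c. generates c P"
    and I: "I \<in> sets" "is_ideal I"
  shows "\<exists>c. generates c I"
proof (rule ccontr)
  assume np: "\<nexists>c. generates c I"
  have len_exists: "\<exists>n. len n a" if a: "a \<in> carrier R" "a \<noteq> \<zero>" for a
  proof (rule ccontr)
    assume n: "\<nexists>n. len n a"
    let ?I = "{x. x \<in> carrier R \<and> a divides x}" and ?S = "{s. \<exists>n. len n s}"
    have sets: "?I \<in> sets" "?S \<in> sets" by (intro ar_set ring_rules ar_divides ar_len)+
    have ideal: "is_ideal ?I"
    proof (rule is_idealI)
      show "\<zero> \<in> ?I" using a by (auto simp: factor_def intro: bexI[of _ \<zero>])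
      show "x \<oplus> y \<in> ?I" if "x \<in> ?I" "y \<in> ?I" for x y
      proof -
        obtain r s where "r \<in> carrier R" "x = a \<otimes> r" "s \<in> carrier R" "y = a \<otimes> s"
          using \<open>x \<in> ?I\<close> \<open>y \<in> ?I\<close> by (auto simp: factor_def)
        then show ?thesis using a by (auto simp: factor_def r_distr intro!: bexI[of _ "r \<oplus> s"])
      qed
      show "x \<otimes> r \<in> ?I" if "x \<in> ?I" "r \<in> carrier R" for x r
        using that a by (auto simp: factor_def m_assoc intro!: bexI[of _ "_ \<otimes> r"])
    qed auto
    have S: "?S \<subseteq> carrier R" using len_carrier by auto
    have one: "\<one> \<in> ?S" using len_zero[of \<one>] by (auto simp: factor_def intro: bexI[of _ \<one>])
    have mult: "s \<otimes> t \<in> ?S" if "s \<in> ?S" "t \<in> ?S" for s t using that len_mult by blast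
    have disjoint: "?I \<inter> ?S = {}"
    proof (rule ccontr)
      assume "?I \<inter> ?S \<noteq> {}"
      then obtain r n where "r \<in> carrier R" "len n (a \<otimes> r)" by (auto simp: factor_def)
      with len_factor a n show False by blast
    qed
    obtain P where P: "P \<in> sets" "is_ideal P" "is_prime P" "?I \<subseteq> P" "P \<inter> ?S = {}"
      by (rule prime_avoidance[OF sets(1) ideal sets(2) S one mult disjoint])
    obtain p where p: "generates p P" using primes P by blast
    have "a divides a" using a by (auto simp: factor_def intro: bexI[of _ \<one>])
    then have "a \<in> P" using P(4) a by auto
    then have prime: "prime_element p" using prime_generator P(3,5) p a one by blast
    then have pc: "p \<in> carrier R" by (rule prime_element_carrier)
    have "p \<otimes> \<one> = p" using pc by simp
    then have "len (n0 \<boxplus> n1) p" using prime len_zero[of \<one>] one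
      by (metis divides_refl len_Suc one_closed)
    moreover have "p \<in> P" using p pc divides_refl by (auto simp: generates_def)
    ultimately show False using P(5) by blast
  qed
  have "\<exists>a\<in>I. a \<noteq> \<zero>"
  proof (rule ccontr)
    assume "\<not> (\<exists>a\<in>I. a \<noteq> \<zero>)"
    then have "I = {\<zero>}" using ideal_zero I by blast
    then have "generates \<zero> I" by (auto simp: generates_def factor_def)
    with np show False by blast
  qed
  then obtain a where a: "a \<in> I" "a \<noteq> \<zero>" "a \<in> carrier R" using ideal_carrier I by blast
  \<comment> \<open>\<open>n\<close> is a possible length of the cofactor of \<open>a\<close>. The
    ideal \<open>I\<close> enters only as a parameter and the quantifiers range over elements, so
    \<open>B\<close> is arithmetical.\<close>
  define B where "B = (\<lambda>n. \<exists>d\<in>carrier R. \<exists>b\<in>carrier R. (\<forall>x\<in>I. d divides x) \<and> a = d \<otimes> b \<and> len n b)"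
  have "\<not> B n" for n
  proof (rule ar_induct[of "\<lambda>n. \<not> B n"])
    show "ar (\<lambda>e. \<not> B (e 0))" unfolding B_def by (intro ring_rules ar_divides ar_len I)
    \<comment> \<open>Choosing a least length is replaced by descent: since every \<open>B n\<close>
      yields \<open>B\<close> at the predecessor, \<open>B n0\<close> fails and failure passes to
      successors.\<close>
    have descent: "\<exists>m. n = m \<boxplus> n1 \<and> B m" if Bn: "B n" for n
    proof -
      from Bn obtain d b where d: "d \<in> carrier R" "b \<in> carrier R" "\<And>x. x \<in> I \<Longrightarrow> d divides x"
        "a = d \<otimes> b" "len n b" by (auto simp: B_def)
      let ?J = "{x. x \<in> carrier R \<and> d \<otimes> x \<in> I}"
      have J: "?J \<in> sets" by (intro ar_set ring_rules I)
      have ideal: "is_ideal ?J"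
      proof (rule is_idealI)
        show "\<zero> \<in> ?J" using d ideal_zero I by simp
        show "x \<oplus> y \<in> ?J" if "x \<in> ?J" "y \<in> ?J" for x y using that d ideal_add I by (simp add: r_distr)
        show "x \<otimes> r \<in> ?J" if "x \<in> ?J" "r \<in> carrier R" for x r
          using that d ideal_mult[OF I(2), of "d \<otimes> x" r] by (simp add: m_assoc)
      qed auto
      \<comment> \<open>Avoiding the multiplicative set consisting of 1 means being proper, so prime
        avoidance also provides a proper prime ideal above a proper ideal.\<close>
      have one: "{\<one>} \<in> sets" using ar_set[of "\<lambda>x. x = \<one>"] by (simp add: ar_eq fn_var fn_const)
      have disjoint: "?J \<inter> {\<one>} = {}"
      proof (rule ccontr)
        assume "?J \<inter> {\<one>} \<noteq> {}"
        then have "d \<in> I" using d by simp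
        have "generates d I"
          using d ideal_mult[OF I(2) \<open>d \<in> I\<close>] by (auto simp: generates_def factor_def)
        with np show False by blast
      qed
      obtain P where P: "P \<in> sets" "is_ideal P" "is_prime P" "?J \<subseteq> P" "P \<inter> {\<one>} = {}"
        by (rule prime_avoidance[OF J ideal one _ _ _ disjoint]) auto
      obtain p where p: "generates p P" using primes P by blast
      \<comment> \<open>From \<open>a = d b\<close> in \<open>I\<close> it follows that
        \<open>b\<close> is a nonzero member of \<open>(I : d)\<close>. It rules out the generator 0
        and shows that \<open>p\<close> divides the cofactor of \<open>a\<close>, whose length can
        then be lowered.\<close>
      have b: "b \<in> P" "b \<noteq> \<zero>" using P(4) d a by auto
      then have prime: "prime_element p" using prime_generator[OF P(3) p _ d(2)] P(5) by blast
      then have pc: "p \<in> carrier R" by (rule prime_element_carrier)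
      have "p divides b" using p b d by (simp add: generates_def)
      then obtain b' where b': "b' \<in> carrier R" "b = p \<otimes> b'" by (auto simp: factor_def)
      then obtain m where m: "n = m \<boxplus> n1" "len m b'" using len_cancel_prime[OF _ prime] d(5) by blast
      have "d \<otimes> p divides x" if x: "x \<in> I" for x
      proof -
        obtain y where y: "y \<in> carrier R" "x = d \<otimes> y" using d(3)[OF x] by (auto simp: factor_def)
        then have "y \<in> P" using P(4) x by auto
        then obtain z where "z \<in> carrier R" "y = p \<otimes> z" using p y by (auto simp: generates_def factor_def)
        with y d pc show ?thesis by (auto simp: factor_def m_assoc)
      qed
      moreover have "a = d \<otimes> p \<otimes> b'" using d b' pc by (simp add: m_assoc)
      ultimately have "B m" using d(1) pc b'(1) m(2) unfolding B_def by (metis m_closed)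
      with m show ?thesis by blast
    qed
    show "\<not> B n0" using descent Suc_not_zero by metis
    show "\<not> B (n \<boxplus> n1)" if "\<not> B n" for n using descent that Suc_inject by blast
  qed
  moreover obtain n where "len n a" using len_exists a by blast
  then have "B n" using a unfolding B_def
    by (intro bexI[of _ \<one>] bexI[of _ a]) (use ideal_carrier[OF I(2)] in \<open>auto simp: factor_def\<close>)
  ultimately show False by blast
qed

end

section \<open>Coded rings\<close>

text \<open>The axioms are kept on graphs of operations, as in the object language. Negation
  survives only as existence of additive inverses, the form in which \<open>abelian_groupI\<close>
  asks for it.\<close>

locale coded_domain = soa_model n0 n1 plus times less sets pn ps
  for n0 n1 :: 'a and plus (infixl \<open>\<boxplus>\<close> 65) and times (infixl \<open>\<boxtimes>\<close> 70)
    and less sets pn ps +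
  fixes C ADD MUL :: "'a set" and z e :: 'a
  assumes coded: "C \<in> sets" "ADD \<in> sets" "MUL \<in> sets"
    and z: "z \<in> C" and e: "e \<in> C"
    and ADD_dom: "n \<in> ADD \<Longrightarrow> \<exists>x\<in>C. \<exists>y\<in>C. \<exists>w\<in>C. n = pr (pr x y) w"
    and ADD_total: "x \<in> C \<Longrightarrow> y \<in> C \<Longrightarrow> \<exists>w\<in>C. pr (pr x y) w \<in> ADD"
    and ADD_fun: "x \<in> C \<Longrightarrow> y \<in> C \<Longrightarrow> w \<in> C \<Longrightarrow> w' \<in> C \<Longrightarrow>
      pr (pr x y) w \<in> ADD \<Longrightarrow> pr (pr x y) w' \<in> ADD \<Longrightarrow> w = w'"
    and MUL_dom: "n \<in> MUL \<Longrightarrow> \<exists>x\<in>C. \<exists>y\<in>C. \<exists>w\<in>C. n = pr (pr x y) w"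
    and MUL_total: "x \<in> C \<Longrightarrow> y \<in> C \<Longrightarrow> \<exists>w\<in>C. pr (pr x y) w \<in> MUL"
    and MUL_fun: "x \<in> C \<Longrightarrow> y \<in> C \<Longrightarrow> w \<in> C \<Longrightarrow> w' \<in> C \<Longrightarrow>
      pr (pr x y) w \<in> MUL \<Longrightarrow> pr (pr x y) w' \<in> MUL \<Longrightarrow> w = w'"
    and ADD_assoc: "x \<in> C \<Longrightarrow> y \<in> C \<Longrightarrow> t \<in> C \<Longrightarrow> u \<in> C \<Longrightarrow> v \<in> C \<Longrightarrow> w \<in> C \<Longrightarrow>
      pr (pr x y) u \<in> ADD \<Longrightarrow> pr (pr y t) v \<in> ADD \<Longrightarrow> pr (pr u t) w \<in> ADD \<Longrightarrow> pr (pr x v) w \<in> ADD"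
    and ADD_commute: "x \<in> C \<Longrightarrow> y \<in> C \<Longrightarrow> w \<in> C \<Longrightarrow> pr (pr x y) w \<in> ADD \<Longrightarrow> pr (pr y x) w \<in> ADD"
    and ADD_zero: "x \<in> C \<Longrightarrow> pr (pr x z) x \<in> ADD"
    and ADD_neg: "x \<in> C \<Longrightarrow> \<exists>y\<in>C. pr (pr x y) z \<in> ADD"
    and MUL_assoc: "x \<in> C \<Longrightarrow> y \<in> C \<Longrightarrow> t \<in> C \<Longrightarrow> u \<in> C \<Longrightarrow> v \<in> C \<Longrightarrow> w \<in> C \<Longrightarrow>
      pr (pr x y) u \<in> MUL \<Longrightarrow> pr (pr y t) v \<in> MUL \<Longrightarrow> pr (pr u t) w \<in> MUL \<Longrightarrow> pr (pr x v) w \<in> MUL"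
    and MUL_commute: "x \<in> C \<Longrightarrow> y \<in> C \<Longrightarrow> w \<in> C \<Longrightarrow> pr (pr x y) w \<in> MUL \<Longrightarrow> pr (pr y x) w \<in> MUL"
    and MUL_one: "x \<in> C \<Longrightarrow> pr (pr x e) x \<in> MUL"
    and distrib: "x \<in> C \<Longrightarrow> y \<in> C \<Longrightarrow> t \<in> C \<Longrightarrow> s \<in> C \<Longrightarrow> u \<in> C \<Longrightarrow> v \<in> C \<Longrightarrow> w \<in> C \<Longrightarrow>
      pr (pr y t) s \<in> ADD \<Longrightarrow> pr (pr x s) w \<in> MUL \<Longrightarrow> pr (pr x y) u \<in> MUL \<Longrightarrow> pr (pr x t) v \<in> MUL \<Longrightarrow>
      pr (pr u v) w \<in> ADD"
    and no_zero_divisors: "x \<in> C \<Longrightarrow> y \<in> C \<Longrightarrow> pr (pr x y) z \<in> MUL \<Longrightarrow> x = z \<or> y = z"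
begin

text \<open>The operations are extended by \<open>z\<close> outside the carrier, which keeps their graphs definable.\<close>

definition op :: "'a set \<Rightarrow> 'a \<Rightarrow> 'a \<Rightarrow> 'a" where
  "op F x y = (if x \<in> C \<and> y \<in> C then THE w. pr (pr x y) w \<in> F else z)"

definition R :: "'a ring" where
  "R = \<lparr>carrier = C, monoid.mult = op MUL, one = e, zero = z, add = op ADD\<rparr>"

lemma R_simps: "carrier R = C" "one R = e" "zero R = z"
  "x \<otimes>\<^bsub>R\<^esub> y = op MUL x y" "x \<oplus>\<^bsub>R\<^esub> y = op ADD x y"
  by (simp_all add: R_def)

lemma op_iff:
  assumes "F \<in> {ADD, MUL}" "x \<in> C" "y \<in> C"
  shows "pr (pr x y) w \<in> F \<longleftrightarrow> w = op F x y"
proof -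
  have "\<exists>!w. pr (pr x y) w \<in> F"
    using assms ADD_total ADD_fun ADD_dom MUL_total MUL_fun MUL_dom by auto (metis pr_inject)+
  then show ?thesis using assms(2,3) unfolding op_def by (auto intro: theI' the1_equality[symmetric])
qed

lemma op_closed:
  assumes "F \<in> {ADD, MUL}" "x \<in> C" "y \<in> C"
  shows "op F x y \<in> C"
proof -
  obtain w where "w \<in> C" "pr (pr x y) w \<in> F" using assms ADD_total MUL_total by blast
  with op_iff[OF assms] show ?thesis by simp
qed

lemmas ADD_iff = op_iff[of ADD, simplified]
lemmas MUL_iff = op_iff[of MUL, simplified]
lemmas ADD_closed = op_closed[of ADD, simplified]
lemmas MUL_closed = op_closed[of MUL, simplified]

lemma cring_R: "cring R"
proof (rule cringI)
  have comm: "op ADD x y = op ADD y x" if "x \<in> C" "y \<in> C" for x y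
    using ADD_commute[OF that(2,1)] that by (simp add: ADD_iff ADD_closed)
  show "abelian_group R"
  proof (rule abelian_groupI; simp only: R_simps)
    show "op ADD x y \<in> C" if "x \<in> C" "y \<in> C" for x y using that by (rule ADD_closed)
    show "z \<in> C" by (rule z)
    show "op ADD (op ADD x y) t = op ADD x (op ADD y t)" if "x \<in> C" "y \<in> C" "t \<in> C" for x y t
      using ADD_assoc[OF that] that by (simp add: ADD_iff ADD_closed)
    show "op ADD x y = op ADD y x" if "x \<in> C" "y \<in> C" for x y using that by (rule comm)
    show "op ADD z x = x" if "x \<in> C" for x
      using ADD_zero[OF that] comm[OF z that] that z by (simp add: ADD_iff)
    show "\<exists>y\<in>C. op ADD y x = z" if x: "x \<in> C" for x
    proof -
      obtain y where "y \<in> C" "pr (pr x y) z \<in> ADD" using ADD_neg[OF x] by blast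
      with x comm[of y x] show ?thesis by (intro bexI[of _ y]) (simp_all add: ADD_iff)
    qed
  qed
  show "Group.comm_monoid R"
  proof (rule comm_monoidI; simp only: R_simps)
    have comm: "op MUL x y = op MUL y x" if "x \<in> C" "y \<in> C" for x y
      using MUL_commute[OF that(2,1)] that by (simp add: MUL_iff MUL_closed)
    show "op MUL x y \<in> C" if "x \<in> C" "y \<in> C" for x y using that by (rule MUL_closed)
    show "e \<in> C" by (rule e)
    show "op MUL (op MUL x y) t = op MUL x (op MUL y t)" if "x \<in> C" "y \<in> C" "t \<in> C" for x y t
      using MUL_assoc[OF that] that by (simp add: MUL_iff MUL_closed)
    show "op MUL x y = op MUL y x" if "x \<in> C" "y \<in> C" for x y using that by (rule comm)
    show "op MUL e x = x" if "x \<in> C" for x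
      using MUL_one[OF that] comm[OF e that] that e by (simp add: MUL_iff)
  qed
  then interpret M: Group.comm_monoid R .
  show "(x \<oplus>\<^bsub>R\<^esub> y) \<otimes>\<^bsub>R\<^esub> t = x \<otimes>\<^bsub>R\<^esub> t \<oplus>\<^bsub>R\<^esub> y \<otimes>\<^bsub>R\<^esub> t"
    if "x \<in> carrier R" "y \<in> carrier R" "t \<in> carrier R" for x y t
  proof -
    have c: "x \<in> C" "y \<in> C" "t \<in> C" using that by (simp_all add: R_simps)
    have "op MUL t (op ADD x y) = op ADD (op MUL t x) (op MUL t y)"
      using distrib[OF c(3,1,2)] c by (simp add: ADD_iff MUL_iff ADD_closed MUL_closed)
    then show ?thesis
      using M.m_comm[of t "x \<oplus>\<^bsub>R\<^esub> y"] M.m_comm[of t x] M.m_comm[of t y] c ADD_closed by (simp add: R_simps)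
  qed
qed

lemma ar_op:
  assumes "F \<in> {ADD, MUL}"
  shows "ar (\<lambda>d. d 0 = op F (d 1) (d 2))"
proof -
  have "d 0 = op F (d 1) (d 2) \<longleftrightarrow>
    (d 1 \<in> C \<and> d 2 \<in> C \<and> pr (pr (d 1) (d 2)) (d 0) \<in> F) \<or> (\<not> (d 1 \<in> C \<and> d 2 \<in> C) \<and> d 0 = z)" for d :: "nat \<Rightarrow> 'a"
  proof (cases "d 1 \<in> C \<and> d 2 \<in> C")
    case True
    with op_iff[OF assms, of "d 1" "d 2" "d 0"] show ?thesis by simp
  next
    case False
    then have "op F (d 1) (d 2) = z" unfolding op_def by (rule if_not_P)
    with False show ?thesis by auto
  qed
  moreover have "F \<in> sets" using assms coded by auto
  ultimately show ?thesis using coded by (simp only:) (intro ar_rules')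
qed

lemma soa_domain_R:
  assumes "e \<noteq> z"
  shows "soa_domain n0 n1 plus times less sets pn ps R"
proof -
  interpret cring R by (rule cring_R)
  have "domain R"
  proof (intro domain.intro domain_axioms.intro)
    show "cring R" by (rule cring_R)
    show "\<one>\<^bsub>R\<^esub> \<noteq> \<zero>\<^bsub>R\<^esub>" using assms by (simp add: R_simps)
    show "a = \<zero>\<^bsub>R\<^esub> \<or> b = \<zero>\<^bsub>R\<^esub>" if "a \<otimes>\<^bsub>R\<^esub> b = \<zero>\<^bsub>R\<^esub>" "a \<in> carrier R" "b \<in> carrier R" for a b
      using that no_zero_divisors[of a b] by (simp add: R_simps MUL_iff)
  qed
  moreover have "soa_model n0 n1 plus times less sets pn ps" by unfold_locales
  ultimately show ?thesis
    using coded ar_op[of ADD] ar_op[of MUL]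
    by (simp add: soa_domain_def soa_domain_axioms_def R_simps)
qed

text \<open>The members of a Sigma ideal. Arithmetical comprehension makes them a set, after which
  ideals can be treated as sets.\<close>

definition seq_range :: "'a set \<Rightarrow> 'a set" where
  "seq_range A = {x. \<exists>m. pr m x \<in> A}"

lemma seq_range_set: "A \<in> sets \<Longrightarrow> seq_range A \<in> sets"
  unfolding seq_range_def by (intro ar_set ar_rules')

text \<open>Turns an ideal given as a set back into a sequence: each member stands at its own index,
  and the other indices receive the zero element, which every ideal contains.\<close>

definition enum :: "'a set \<Rightarrow> 'a set" where
  "enum P = {n. \<exists>i x. n = pr i x \<and> (i \<in> P \<and> x = i \<or> i \<notin> P \<and> x = z)}"

lemma enum_set: "P \<in> sets \<Longrightarrow> enum P \<in> sets"
  unfolding enum_def by (intro ar_set ar_rules')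

lemma pr_in_enum: "pr i x \<in> enum P \<longleftrightarrow> x = (if i \<in> P then i else z)"
  by (auto simp: enum_def)

lemma seq_range_enum: "z \<in> P \<Longrightarrow> seq_range (enum P) = P"
  by (auto simp: seq_range_def pr_in_enum split: if_splits)

end

section \<open>The ring-theoretic formulas in a model\<close>

context soa_structure
begin

lemma sat_AllR_Cons:
  "sat \<nu> \<Sigma> (\<^bold>\<forall>\<^sub>R(x # xs). \<phi>) \<longleftrightarrow> (\<forall>a\<in>\<Sigma> ''R''. sat (\<nu>(x := a)) \<Sigma> (\<^bold>\<forall>\<^sub>Rxs. \<phi>))"
  by (auto simp: AllR_def)

lemma sat_ExR_Cons:
  "sat \<nu> \<Sigma> (\<^bold>\<exists>\<^sub>R(x # xs). \<phi>) \<longleftrightarrow> (\<exists>a\<in>\<Sigma> ''R''. sat (\<nu>(x := a)) \<Sigma> (\<^bold>\<exists>\<^sub>Rxs. \<phi>))"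
  by (auto simp: ExR_def)

lemma AllR_Nil: "(\<^bold>\<forall>\<^sub>R[]. \<phi>) = \<phi>" by (simp add: AllR_def)

lemma ExR_Nil: "(\<^bold>\<exists>\<^sub>R[]. \<phi>) = \<phi>" by (simp add: ExR_def)

lemmas sat_bounded = sat_AllR_Cons sat_ExR_Cons AllR_Nil ExR_Nil

end

context soa_model
begin

lemma ev_pair: "ev \<nu> \<llangle>s, t\<rrangle> = pr (ev \<nu> s) (ev \<nu> t)"
  by (simp add: pair_def pr_def)

lemma sat_maps: "sat \<nu> \<Sigma> (maps1 F x y) \<longleftrightarrow> pr (\<nu> x) (\<nu> y) \<in> \<Sigma> F"
  "sat \<nu> \<Sigma> (maps2 F x y w) \<longleftrightarrow> pr (pr (\<nu> x) (\<nu> y)) (\<nu> w) \<in> \<Sigma> F"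
  by (simp_all add: maps1_def maps2_def ev_pair)

lemma sat_sigma_ideal:
  "sat \<nu> (\<Sigma>(''A'' := A)) (sigma_ideal ''A'') \<longleftrightarrow>
    (\<forall>n\<in>A. \<exists>i. \<exists>x\<in>\<Sigma> ''R''. n = pr i x) \<and>
    (\<forall>i. \<exists>x\<in>\<Sigma> ''R''. pr i x \<in> A) \<and>
    (\<forall>i. \<forall>x\<in>\<Sigma> ''R''. \<forall>y\<in>\<Sigma> ''R''. pr i x \<in> A \<longrightarrow> pr i y \<in> A \<longrightarrow> x = y) \<and>
    (\<forall>i j. \<forall>r\<in>\<Sigma> ''R''. \<forall>s\<in>\<Sigma> ''R''. \<exists>k. \<exists>x\<in>\<Sigma> ''R''. \<exists>y\<in>\<Sigma> ''R''. \<exists>w\<in>\<Sigma> ''R''. \<exists>u\<in>\<Sigma> ''R''. \<exists>v\<in>\<Sigma> ''R''.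
       pr i x \<in> A \<and> pr j y \<in> A \<and> pr k w \<in> A \<and>
       pr (pr x r) u \<in> \<Sigma> ''mul'' \<and> pr (pr y s) v \<in> \<Sigma> ''mul'' \<and> pr (pr u v) w \<in> \<Sigma> ''add'')"
  unfolding sigma_ideal_def sequence_in_R_def
  by (simp add: sat_bounded sat_maps ev_pair Ball_def)

lemma sat_prime_ideal:
  "sat \<nu> (\<Sigma>(''A'' := A)) (prime_ideal ''A'') \<longleftrightarrow>
    (\<forall>x\<in>\<Sigma> ''R''. \<forall>y\<in>\<Sigma> ''R''. \<forall>w\<in>\<Sigma> ''R''. pr (pr x y) w \<in> \<Sigma> ''mul'' \<longrightarrow> (\<exists>m. pr m w \<in> A) \<longrightarrow>
       (\<exists>m. pr m x \<in> A) \<or> (\<exists>m. pr m y \<in> A))"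
  unfolding prime_ideal_def in_ideal_def by (simp add: sat_bounded sat_maps)

lemma sat_principal_ideal:
  "sat \<nu> (\<Sigma>(''A'' := A)) (principal_ideal ''A'') \<longleftrightarrow>
    (\<exists>c\<in>\<Sigma> ''R''. \<forall>x\<in>\<Sigma> ''R''. (\<exists>m. pr m x \<in> A) \<longleftrightarrow> (\<exists>r\<in>\<Sigma> ''R''. pr (pr c r) x \<in> \<Sigma> ''mul''))"
  unfolding principal_ideal_def in_ideal_def by (simp add: sat_bounded sat_maps)

lemma sat_binary_op:
  assumes "sat \<nu> \<Sigma> (binary_op F)"
  shows "n \<in> \<Sigma> F \<Longrightarrow> \<exists>x\<in>\<Sigma> ''R''. \<exists>y\<in>\<Sigma> ''R''. \<exists>w\<in>\<Sigma> ''R''. n = pr (pr x y) w"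
    and "x \<in> \<Sigma> ''R'' \<Longrightarrow> y \<in> \<Sigma> ''R'' \<Longrightarrow> \<exists>w\<in>\<Sigma> ''R''. pr (pr x y) w \<in> \<Sigma> F"
    and "x \<in> \<Sigma> ''R'' \<Longrightarrow> y \<in> \<Sigma> ''R'' \<Longrightarrow> w \<in> \<Sigma> ''R'' \<Longrightarrow> w' \<in> \<Sigma> ''R'' \<Longrightarrow>
      pr (pr x y) w \<in> \<Sigma> F \<Longrightarrow> pr (pr x y) w' \<in> \<Sigma> F \<Longrightarrow> w = w'"
  using assms unfolding binary_op_def by (simp_all add: sat_bounded sat_maps ev_pair)

lemma coded_domain_if_sat:
  assumes "sat \<nu> \<Sigma> integral_domain" and "\<Sigma> ''R'' \<in> sets" "\<Sigma> ''add'' \<in> sets" "\<Sigma> ''mul'' \<in> sets"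
  shows "coded_domain n0 n1 plus times less sets pn ps (\<Sigma> ''R'') (\<Sigma> ''add'') (\<Sigma> ''mul'') (\<nu> ''zero'') (\<nu> ''one'')"
proof -
  note sat = assms(1)[unfolded integral_domain_def commutative_ring_def sat_derived]
  note t0 = sat[THEN conjunct1]
  note t1 = t0[THEN conjunct2]
  note t2 = t1[THEN conjunct2]
  note t3 = t2[THEN conjunct2]
  note t4 = t3[THEN conjunct2]
  note t5 = t4[THEN conjunct2]
  note t6 = t5[THEN conjunct2]
  note t7 = t6[THEN conjunct2]
  note t8 = t7[THEN conjunct2]
  note t9 = t8[THEN conjunct2]
  note t10 = t9[THEN conjunct2]
  note t11 = t10[THEN conjunct2]
  note t12 = t11[THEN conjunct2]
  note add = t2[THEN conjunct1] and neg = t3[THEN conjunct1] and mul = t4[THEN conjunct1]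
  have neg: "\<exists>y\<in>\<Sigma> ''R''. pr x y \<in> \<Sigma> ''neg''" if "x \<in> \<Sigma> ''R''" for x
    using neg that unfolding unary_op_def by (simp add: sat_bounded sat_maps)
  \<comment> \<open>The axioms are simplified on their own: as premises of a goal, commutativity would loop.\<close>
  show ?thesis
    apply unfold_locales
    subgoal by (rule assms)
    subgoal by (rule assms)
    subgoal by (rule assms)
    subgoal using t0[THEN conjunct1] by simp
    subgoal using t1[THEN conjunct1] by simp
    subgoal by (rule sat_binary_op(1)[OF add])
    subgoal by (rule sat_binary_op(2)[OF add])
    subgoal by (rule sat_binary_op(3)[OF add])
    subgoal by (rule sat_binary_op(1)[OF mul])
    subgoal by (rule sat_binary_op(2)[OF mul])
    subgoal by (rule sat_binary_op(3)[OF mul])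
    subgoal using t5[THEN conjunct1, simplified sat_bounded sat.simps sat_derived sat_maps, simplified] by blast
    subgoal using t6[THEN conjunct1, simplified sat_bounded sat.simps sat_derived sat_maps, simplified] by blast
    subgoal using t7[THEN conjunct1, simplified sat_bounded sat.simps sat_derived sat_maps, simplified] by blast
    subgoal for x using t8[THEN conjunct1, simplified sat_bounded sat.simps sat_derived sat_maps, simplified] neg[of x] by blast
    subgoal using t9[THEN conjunct1, simplified sat_bounded sat.simps sat_derived sat_maps, simplified] by blast
    subgoal using t10[THEN conjunct1, simplified sat_bounded sat.simps sat_derived sat_maps, simplified] by blast
    subgoal using t11[THEN conjunct1, simplified sat_bounded sat.simps sat_derived sat_maps, simplified] by blast
    subgoal using t12[simplified sat_bounded sat.simps sat_derived sat_maps, simplified] by blast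
    subgoal using sat[THEN conjunct2, simplified sat_bounded sat.simps sat_derived sat_maps, simplified] by blast
    done
qed

theorem sat_sigma_PID:
  assumes dom: "sat \<nu> \<Sigma> integral_domain" and \<Sigma>: "\<Sigma> ''R'' \<in> sets" "\<Sigma> ''add'' \<in> sets" "\<Sigma> ''mul'' \<in> sets"
    and primes: "sat \<nu> \<Sigma> (\<^bold>\<forall>\<^sub>S''A''. sigma_ideal ''A'' \<^bold>\<and> prime_ideal ''A'' \<^bold>\<longrightarrow> principal_ideal ''A'')"
  shows "sat \<nu> \<Sigma> sigma_PID"
proof -
  interpret coded_domain n0 n1 plus times less sets pn ps
    "\<Sigma> ''R''" "\<Sigma> ''add''" "\<Sigma> ''mul''" "\<nu> ''zero''" "\<nu> ''one''"
    by (rule coded_domain_if_sat[OF dom \<Sigma>])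
  interpret cring R by (rule cring_R)
  have "sat \<nu> (\<Sigma>(''A'' := A)) (principal_ideal ''A'')"
    if A: "A \<in> sets" and ideal: "sat \<nu> (\<Sigma>(''A'' := A)) (sigma_ideal ''A'')" for A
  proof -
    have A_dom: "\<exists>i. \<exists>x\<in>\<Sigma> ''R''. n = pr i x" if "n \<in> A" for n
      using ideal that by (simp add: sat_sigma_ideal)
    have A_total: "\<exists>x\<in>\<Sigma> ''R''. pr i x \<in> A" for i
      using ideal by (simp add: sat_sigma_ideal)
    have A_fun: "x = y" if "pr i x \<in> A" "pr i y \<in> A" for i x y
      using ideal that A_dom[OF that(1)] A_dom[OF that(2)] by (auto simp: sat_sigma_ideal)
    have A_lin: "\<exists>k. \<exists>x\<in>\<Sigma> ''R''. \<exists>y\<in>\<Sigma> ''R''. \<exists>w\<in>\<Sigma> ''R''. \<exists>u\<in>\<Sigma> ''R''. \<exists>v\<in>\<Sigma> ''R''.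
       pr i x \<in> A \<and> pr j y \<in> A \<and> pr k w \<in> A \<and>
       pr (pr x r) u \<in> \<Sigma> ''mul'' \<and> pr (pr y s) v \<in> \<Sigma> ''mul'' \<and> pr (pr u v) w \<in> \<Sigma> ''add''"
      if "r \<in> \<Sigma> ''R''" "s \<in> \<Sigma> ''R''" for i j r s
      using ideal that by (simp add: sat_sigma_ideal)
    show ?thesis
    \<comment> \<open>The formula for integral domains admits the zero ring, the locale
      \<open>domain\<close> does not. In the zero ring every ideal is generated by 0.\<close>
    proof (cases "\<nu> ''one'' = \<nu> ''zero''")
      case True
      then have "\<one>\<^bsub>R\<^esub> = \<zero>\<^bsub>R\<^esub>" unfolding R_simps .
      from one_zeroD[OF this] have "\<Sigma> ''R'' = {\<nu> ''zero''}" unfolding R_simps .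
      moreover have "\<nu> ''zero'' \<in> \<Sigma> ''R''" by (rule z)
      moreover have "pr (pr (\<nu> ''zero'') (\<nu> ''zero'')) (\<nu> ''zero'') \<in> \<Sigma> ''mul''"
        using MUL_one[OF z] True by simp
      ultimately show ?thesis using A_total by (auto simp: sat_principal_ideal)
    next
      case False
      interpret soa_domain n0 n1 plus times less sets pn ps R by (rule soa_domain_R[OF False])
      have generates: "generates c I \<longleftrightarrow> c \<in> \<Sigma> ''R'' \<and>
          (\<forall>x\<in>\<Sigma> ''R''. x \<in> I \<longleftrightarrow> (\<exists>r\<in>\<Sigma> ''R''. pr (pr c r) x \<in> \<Sigma> ''mul''))" for c I
        by (auto simp: generates_def factor_def R_simps MUL_iff)
      have "\<exists>c. generates c (seq_range A)"
      proof (rule all_ideals_principal)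
        show "seq_range A \<in> sets" using A by (rule seq_range_set)
        show "is_ideal (seq_range A)"
          unfolding is_ideal_def R_simps
        proof (intro conjI ballI)
          show "seq_range A \<subseteq> \<Sigma> ''R''" using A_dom by (fastforce simp: seq_range_def)
          show "seq_range A \<noteq> {}" using A_total by (auto simp: seq_range_def)
          fix x y r s assume "x \<in> seq_range A" "y \<in> seq_range A" and rs: "r \<in> \<Sigma> ''R''" "s \<in> \<Sigma> ''R''"
          then obtain i j where ij: "pr i x \<in> A" "pr j y \<in> A" by (auto simp: seq_range_def)
          obtain k x' y' w u v where *: "x' \<in> \<Sigma> ''R''" "y' \<in> \<Sigma> ''R''" "u \<in> \<Sigma> ''R''" "v \<in> \<Sigma> ''R''"
            "pr i x' \<in> A" "pr j y' \<in> A" "pr k w \<in> A"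
            "pr (pr x' r) u \<in> \<Sigma> ''mul''" "pr (pr y' s) v \<in> \<Sigma> ''mul''" "pr (pr u v) w \<in> \<Sigma> ''add''"
            using A_lin[OF rs, of i j] by blast
          have xy: "x' = x" "y' = y" using A_fun ij *(5,6) by blast+
          have "u = op (\<Sigma> ''mul'') x r" "v = op (\<Sigma> ''mul'') y s" "w = op (\<Sigma> ''add'') u v"
            using * rs unfolding xy by (simp_all add: MUL_iff ADD_iff)
          with *(7) show "op (\<Sigma> ''add'') (op (\<Sigma> ''mul'') x r) (op (\<Sigma> ''mul'') y s) \<in> seq_range A"
            by (auto simp: seq_range_def)
        qed
        fix P assume P: "P \<in> sets" "is_ideal P" "is_prime P"
        \<comment> \<open>The hypothesis about prime ideals speaks of sequences, so it is applied to
          the enumeration of \<open>P\<close>.\<close>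
        let ?\<Sigma> = "\<Sigma>(''A'' := enum P)"
        have zP: "\<nu> ''zero'' \<in> P" using ideal_zero[OF P(2)] by (simp add: R_simps)
        have PR: "P \<subseteq> \<Sigma> ''R''" using P(2) by (simp add: is_ideal_def R_simps)
        have range: "(\<exists>m. pr m x \<in> enum P) \<longleftrightarrow> x \<in> P" for x
          using seq_range_enum[OF zP] by (auto simp: seq_range_def)
        have "sat \<nu> ?\<Sigma> (sigma_ideal ''A'')"
          unfolding sat_sigma_ideal
        proof (intro conjI ballI allI impI)
          show "\<exists>i. \<exists>x\<in>\<Sigma> ''R''. n = pr i x" if "n \<in> enum P" for n
            using that z PR by (auto simp: enum_def)
          show "\<exists>x\<in>\<Sigma> ''R''. pr i x \<in> enum P" for i
            using z PR by (auto simp: pr_in_enum)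
          show "x = y" if "pr i x \<in> enum P" "pr i y \<in> enum P" for i x y
            using that by (simp add: pr_in_enum)
          fix i j r s assume rs: "r \<in> \<Sigma> ''R''" "s \<in> \<Sigma> ''R''"
          define x where "x = (if i \<in> P then i else \<nu> ''zero'')"
          define y where "y = (if j \<in> P then j else \<nu> ''zero'')"
          have xy: "x \<in> P" "y \<in> P" using zP by (auto simp: x_def y_def)
          then have "x \<in> \<Sigma> ''R''" "y \<in> \<Sigma> ''R''" using PR by auto
          note C = this
          let ?u = "op (\<Sigma> ''mul'') x r" and ?v = "op (\<Sigma> ''mul'') y s"
          let ?w = "op (\<Sigma> ''add'') ?u ?v"
          have w: "?w \<in> P" using P(2) xy rs unfolding is_ideal_def R_simps by blast
          then obtain k where k: "pr k ?w \<in> enum P" using range by blast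
          have uv: "?u \<in> \<Sigma> ''R''" "?v \<in> \<Sigma> ''R''" using C rs by (simp_all add: MUL_closed)
          have "pr i x \<in> enum P" "pr j y \<in> enum P" by (simp_all add: pr_in_enum x_def y_def)
          moreover have "pr (pr x r) ?u \<in> \<Sigma> ''mul''" "pr (pr y s) ?v \<in> \<Sigma> ''mul''"
            using C rs by (simp_all add: MUL_iff)
          moreover have "pr (pr ?u ?v) ?w \<in> \<Sigma> ''add''" using uv by (simp add: ADD_iff)
          moreover have "?w \<in> \<Sigma> ''R''" using w PR by blast
          ultimately show "\<exists>k. \<exists>x\<in>\<Sigma> ''R''. \<exists>y\<in>\<Sigma> ''R''. \<exists>w\<in>\<Sigma> ''R''. \<exists>u\<in>\<Sigma> ''R''. \<exists>v\<in>\<Sigma> ''R''.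
             pr i x \<in> enum P \<and> pr j y \<in> enum P \<and> pr k w \<in> enum P \<and>
             pr (pr x r) u \<in> \<Sigma> ''mul'' \<and> pr (pr y s) v \<in> \<Sigma> ''mul'' \<and> pr (pr u v) w \<in> \<Sigma> ''add''"
            using C uv k by blast
        qed
        moreover have "sat \<nu> ?\<Sigma> (prime_ideal ''A'')"
          using P(3) by (simp add: sat_prime_ideal range is_prime_def R_simps MUL_iff)
        ultimately have "sat \<nu> ?\<Sigma> (principal_ideal ''A'')"
          using primes enum_set[OF P(1)] by simp
        then show "\<exists>c. generates c P" by (auto simp: sat_principal_ideal range generates)
      qed
      then show ?thesis by (auto simp: sat_principal_ideal generates seq_range_def)
    qed
  qed
  then show ?thesis using dom by (simp add: sigma_PID_def)
qed

end

section \<open>From models to provability\<close>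

lemma fvN_foldr_AllN: "fvN (foldr AllN xs \<phi>) = fvN \<phi> - set xs"
  by (induction xs) auto

lemma fvS_foldr_AllN: "fvS (foldr AllN xs \<phi>) = fvS \<phi>"
  by (induction xs) auto

lemma fvN_foldr_AllS: "fvN (foldr AllS Xs \<phi>) = fvN \<phi>"
  by (induction Xs) auto

lemma fvS_foldr_AllS: "fvS (foldr AllS Xs \<phi>) = fvS \<phi> - set Xs"
  by (induction Xs) auto

lemma clean_foldr_AllN: "clean (foldr AllN xs \<phi>) \<longleftrightarrow> set xs \<inter> reserved = {} \<and> clean \<phi>"
  by (induction xs) auto

lemma clean_foldr_AllS: "clean (foldr AllS Xs \<phi>) \<longleftrightarrow> set Xs \<inter> reserved = {} \<and> clean \<phi>"
  by (induction Xs) auto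

lemma fv_derived [simp]:
  "fvN (\<^bold>\<not> \<phi>) = fvN \<phi>" "fvN (\<phi> \<^bold>\<and> \<psi>) = fvN \<phi> \<union> fvN \<psi>" "fvN (\<phi> \<^bold>\<or> \<psi>) = fvN \<phi> \<union> fvN \<psi>"
  "fvN (\<phi> \<^bold>\<longleftrightarrow> \<psi>) = fvN \<phi> \<union> fvN \<psi>" "fvN (\<^bold>\<exists>x. \<phi>) = fvN \<phi> - {x}" "fvN (\<^bold>\<exists>\<^sub>SX. \<phi>) = fvN \<phi>"
  "fvS (\<^bold>\<not> \<phi>) = fvS \<phi>" "fvS (\<phi> \<^bold>\<and> \<psi>) = fvS \<phi> \<union> fvS \<psi>" "fvS (\<phi> \<^bold>\<or> \<psi>) = fvS \<phi> \<union> fvS \<psi>"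
  "fvS (\<phi> \<^bold>\<longleftrightarrow> \<psi>) = fvS \<phi> \<union> fvS \<psi>" "fvS (\<^bold>\<exists>x. \<phi>) = fvS \<phi>" "fvS (\<^bold>\<exists>\<^sub>SX. \<phi>) = fvS \<phi> - {X}"
  by (auto simp: Neg_def Conj_def Disj_def Iff_def ExN_def ExS_def)

lemma ACA_sentence: "\<gamma> \<in> ACA\<^sub>0 \<Longrightarrow> fvN \<gamma> = {} \<and> fvS \<gamma> = {}"
  unfolding ACA\<^sub>0_def
proof (elim UnE)
  show "\<gamma> \<in> basic_axioms \<Longrightarrow> fvN \<gamma> = {} \<and> fvS \<gamma> = {}"
    unfolding basic_axioms_def Let_def by auto
  show "\<gamma> \<in> {induction_axiom} \<Longrightarrow> fvN \<gamma> = {} \<and> fvS \<gamma> = {}"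
    by (auto simp: induction_axiom_def Let_def)
  show "\<gamma> \<in> arithmetical_comprehension \<Longrightarrow> fvN \<gamma> = {} \<and> fvS \<gamma> = {}"
    by (auto simp: arithmetical_comprehension_def universal_closures_def
        fvN_foldr_AllN fvS_foldr_AllN fvN_foldr_AllS fvS_foldr_AllS)
qed

context soa_structure
begin

lemma sat_foldr_AllN:
  "sat \<nu> \<Sigma> (foldr AllN xs \<phi>) \<Longrightarrow> (\<And>x. x \<notin> set xs \<Longrightarrow> \<nu>' x = \<nu> x) \<Longrightarrow> sat \<nu>' \<Sigma> \<phi>"
proof (induction xs arbitrary: \<nu>)
  case Nil
  then have "\<nu>' = \<nu>" by auto
  with Nil show ?case by simp
next
  case (Cons x xs)
  have "sat (\<nu>(x := \<nu>' x)) \<Sigma> (foldr AllN xs \<phi>)"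
    using Cons.prems(1) by (simp del: fun_upd_apply)
  then show ?case by (rule Cons.IH) (use Cons.prems(2) in auto)
qed

lemma sat_foldr_AllS:
  "sat \<nu> \<Sigma> (foldr AllS Xs \<phi>) \<Longrightarrow> (\<And>X. X \<notin> set Xs \<Longrightarrow> \<Sigma>' X = \<Sigma> X) \<Longrightarrow> \<Sigma>' ` set Xs \<subseteq> sets \<Longrightarrow> sat \<nu> \<Sigma>' \<phi>"
proof (induction Xs arbitrary: \<Sigma>)
  case Nil
  then have "\<Sigma>' = \<Sigma>" by auto
  with Nil show ?case by simp
next
  case (Cons X Xs)
  have "sat \<nu> (\<Sigma>(X := \<Sigma>' X)) (foldr AllS Xs \<phi>)"
    using Cons.prems(1,3) by (simp del: fun_upd_apply)
  then show ?case by (rule Cons.IH) (use Cons.prems(2,3) in auto)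
qed

lemma sat_universal_closure:
  assumes "sat \<nu> \<Sigma> (foldr AllN xs (foldr AllS Xs \<phi>))" "fvN \<phi> \<subseteq> set xs" "fvS \<phi> \<subseteq> set Xs"
    "range \<Sigma>' \<subseteq> sets"
  shows "sat \<nu>' \<Sigma>' \<phi>"
proof -
  let ?\<nu> = "\<lambda>x. if x \<in> set xs then \<nu>' x else \<nu> x" and ?\<Sigma> = "\<lambda>X. if X \<in> set Xs then \<Sigma>' X else \<Sigma> X"
  have "sat ?\<nu> \<Sigma> (foldr AllS Xs \<phi>)" by (rule sat_foldr_AllN[OF assms(1)]) simp
  then have "sat ?\<nu> ?\<Sigma> \<phi>" by (rule sat_foldr_AllS) (use assms(4) in auto)
  moreover have "sat ?\<nu> ?\<Sigma> \<phi> = sat \<nu>' \<Sigma>' \<phi>" by (rule sat_cong) (use assms(2,3) in auto)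
  ultimately show ?thesis by simp
qed

end

lemma unreserved_literals: "x \<noteq> [] \<Longrightarrow> hd x \<noteq> CHR ''~'' \<Longrightarrow> x \<notin> reserved"
  by (auto simp: reserved_def)

lemma proper_induction_axiom: "proper induction_axiom"
  by (simp add: induction_axiom_def Let_def proper_def unreserved_literals)

lemma proper_basic_axioms: "\<gamma> \<in> basic_axioms \<Longrightarrow> proper \<gamma>"
  unfolding basic_axioms_def Let_def by (auto simp: proper_def unreserved_literals)

text \<open>The prefix of the closure binds exactly the free variables, none of which is reserved; a
  longer prefix could bind reserved names and make the axiom improper.\<close>

lemma comprehension_instance:
  assumes "arithmetical \<phi>" "plain \<phi>" "x \<notin> reserved"
  obtains X xs Xs where "foldr AllN xs (foldr AllS Xs (\<^bold>\<exists>\<^sub>SX. \<^bold>\<forall>x. V x \<^bold>\<in> X \<^bold>\<longleftrightarrow> \<phi>)) \<in> {\<gamma> \<in> ACA\<^sub>0. proper \<gamma>}"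
    "X \<notin> fvS \<phi>" "fvN \<phi> - {x} \<subseteq> set xs" "fvS \<phi> \<subseteq> set Xs"
proof -
  obtain X where X: "X \<in> evars" "X \<notin> fvS \<phi>" using fresh_evar[of "fvS \<phi>"] by auto
  have "X \<notin> reserved" using X evars_disjoint by blast
  let ?\<psi> = "\<^bold>\<exists>\<^sub>SX. \<^bold>\<forall>x. V x \<^bold>\<in> X \<^bold>\<longleftrightarrow> \<phi>"
  obtain xs where xs: "set xs = fvN \<phi> - {x}" using finite_list[of "fvN \<phi> - {x}"] by auto
  obtain Xs where Xs: "set Xs = fvS \<phi>" using finite_list[of "fvS \<phi>"] by auto
  have "foldr AllN xs (foldr AllS Xs ?\<psi>) \<in> universal_closures ?\<psi>"
    unfolding universal_closures_def using xs Xs by auto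
  then have "foldr AllN xs (foldr AllS Xs ?\<psi>) \<in> ACA\<^sub>0"
    unfolding ACA\<^sub>0_def arithmetical_comprehension_def using assms(1) X(2) by blast
  moreover from this have "proper (foldr AllN xs (foldr AllS Xs ?\<psi>))"
    using ACA_sentence assms(2,3) xs Xs \<open>X \<notin> reserved\<close>
    by (auto simp: proper_def clean_foldr_AllN clean_foldr_AllS plain_def)
  ultimately show thesis using that[of xs Xs X] X(2) xs Xs by blast
qed

text \<open>Any surjection from strings to numbers can supply the number parameters, and
  \<open>length\<close> is one. The sets of the model are the values of reserved names, so deleting
  the initial letter of those names enumerates them.\<close>

lemma soa_model_if_sat:
  fixes n0 n1 :: nat and plus times less
  assumes sat: "\<And>\<gamma>. \<gamma> \<in> ACA\<^sub>0 \<Longrightarrow> proper \<gamma> \<Longrightarrow>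
      soa_structure.sat n0 n1 plus times less (\<sigma> ` reserved) \<nu> \<sigma> \<gamma>"
  shows "soa_model n0 n1 plus times less (\<sigma> ` reserved) length (\<lambda>s. \<sigma> (CHR ''~'' # s))"
proof -
  interpret soa_structure n0 n1 plus times less "\<sigma> ` reserved" .
  have basic: "sat \<nu> \<sigma> \<gamma>" if "\<gamma> \<in> basic_axioms" for \<gamma>
    using sat[of \<gamma>] proper_basic_axioms[OF that] that by (auto simp: ACA\<^sub>0_def)
  have "sat \<nu> \<sigma> induction_axiom"
    using sat[OF _ proper_induction_axiom] by (auto simp: ACA\<^sub>0_def)
  note ind = this[unfolded induction_axiom_def Let_def, simplified]
  have "\<forall>\<gamma>\<in>basic_axioms. sat \<nu> \<sigma> \<gamma>" using basic by blast
  note basic = this[unfolded basic_axioms_def Let_def, simplified]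
  have compr: "{a. sat (\<nu>'(x := a)) \<Sigma> \<phi>} \<in> \<sigma> ` reserved"
    if \<phi>: "arithmetical \<phi>" "plain \<phi>" "x \<notin> reserved" "range \<Sigma> \<subseteq> \<sigma> ` reserved" for \<phi> x \<Sigma> \<nu>'
  proof -
    obtain X xs Xs where inst: "foldr AllN xs (foldr AllS Xs (\<^bold>\<exists>\<^sub>SX. \<^bold>\<forall>x. V x \<^bold>\<in> X \<^bold>\<longleftrightarrow> \<phi>)) \<in> {\<gamma> \<in> ACA\<^sub>0. proper \<gamma>}"
      and X: "X \<notin> fvS \<phi>" and fv: "fvN \<phi> - {x} \<subseteq> set xs" "fvS \<phi> \<subseteq> set Xs"
      using comprehension_instance[OF \<phi>(1-3)] .
    have "sat \<nu>' \<Sigma> (\<^bold>\<exists>\<^sub>SX. \<^bold>\<forall>x. V x \<^bold>\<in> X \<^bold>\<longleftrightarrow> \<phi>)"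
      by (rule sat_universal_closure[OF sat]) (use inst fv \<phi>(4) in auto)
    then obtain A where A: "A \<in> \<sigma> ` reserved" "\<And>a. a \<in> A \<longleftrightarrow> sat (\<nu>'(x := a)) (\<Sigma>(X := A)) \<phi>"
      by auto
    have "sat (\<nu>'(x := a)) (\<Sigma>(X := A)) \<phi> = sat (\<nu>'(x := a)) \<Sigma> \<phi>" for a
      by (rule sat_cong) (use X in auto)
    with A have "{a. sat (\<nu>'(x := a)) \<Sigma> \<phi>} = A" by auto
    with A(1) show ?thesis by simp
  qed
  show ?thesis
  proof
    show "surj (length :: string \<Rightarrow> nat)"
      by (rule surjI[of _ "\<lambda>n. replicate n undefined"]) simp
    show "range (\<lambda>s. \<sigma> (CHR ''~'' # s)) = \<sigma> ` reserved" by (auto simp: reserved_def)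
    show "n \<in> A" if "A \<in> \<sigma> ` reserved" "n0 \<in> A" "\<And>n. n \<in> A \<Longrightarrow> plus n n1 \<in> A" for A n
      using ind that by auto
  qed (use basic compr in auto)
qed

text \<open>Completeness in the restricted form needed here: models on \<open>nat\<close> are enough
  because that is where the Henkin model is built.\<close>

lemma provable_if_valid:
  assumes \<theta>: "proper \<theta>"
    and valid: "\<And>(n0 :: nat) n1 plus times less sets pn ps \<nu> \<Sigma>. soa_model n0 n1 plus times less sets pn ps \<Longrightarrow>
      soa_structure.sat n0 n1 plus times less sets \<nu> \<Sigma> \<theta>"
  shows "ACA\<^sub>0 \<turnstile> \<theta>"
proof (rule ccontr)
  assume unprovable: "\<not> (ACA\<^sub>0 \<turnstile> \<theta>)"
  \<comment> \<open>Axioms that bind a reserved name are left out, which is harmless as weakening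
    restores them. The remaining ones are sentences, so the free variables are those of
    \<open>\<theta>\<close>.\<close>
  let ?\<Gamma> = "insert (\<^bold>\<not> \<theta>) {\<gamma> \<in> ACA\<^sub>0. proper \<gamma>}"
  have "fvN \<gamma> \<subseteq> fvN \<theta> \<and> fvS \<gamma> \<subseteq> fvS \<theta>" if "\<gamma> \<in> ?\<Gamma>" for \<gamma>
    using that ACA_sentence by auto
  then have fv: "\<Union>(fvN ` ?\<Gamma>) \<subseteq> fvN \<theta>" "\<Union>(fvS ` ?\<Gamma>) \<subseteq> fvS \<theta>" by blast+
  have "finite (\<Union>(fvN ` ?\<Gamma>))" "finite (\<Union>(fvS ` ?\<Gamma>))"
    by (rule finite_subset[OF fv(1) finite_fvN], rule finite_subset[OF fv(2) finite_fvS])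
  moreover have "\<not> (?\<Gamma> \<turnstile> \<^bold>\<bottom>)"
  proof
    assume "?\<Gamma> \<turnstile> \<^bold>\<bottom>"
    then have "{\<gamma> \<in> ACA\<^sub>0. proper \<gamma>} \<turnstile> \<theta>" by (rule RAA)
    then have "ACA\<^sub>0 \<turnstile> \<theta>" by (rule Weak) blast
    with unprovable show False ..
  qed
  moreover have "\<forall>\<gamma>\<in>?\<Gamma>. proper \<gamma>" using \<theta> by simp
  ultimately have "henkin_stage ?\<Gamma>" unfolding henkin_stage_def by (intro conjI)
  from henkin_extension[OF this] obtain S where S: "?\<Gamma> \<subseteq> S" "\<not> (S \<turnstile> \<^bold>\<bottom>)" "\<forall>\<gamma>\<in>S. proper \<gamma>" "\<forall>\<phi>. proper \<phi> \<longrightarrow> settles S \<phi>"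
    by (elim exE conjE)
  have "basic_axioms \<subseteq> S" using S(1) proper_basic_axioms by (auto simp: ACA\<^sub>0_def)
  then have "henkin S" using S by unfold_locales (auto simp: basic_axioms_def Let_def)
  then obtain n0 n1 plus times less \<sigma> \<nu> where
    sat: "\<forall>\<phi>\<in>S. soa_structure.sat (n0 :: nat) n1 plus times less (\<sigma> ` reserved) \<nu> \<sigma> \<phi>"
    using henkin.has_model[OF \<open>henkin S\<close>] by (elim exE)
  interpret soa_model n0 n1 plus times less "\<sigma> ` reserved" length "\<lambda>s. \<sigma> (CHR ''~'' # s)"
    by (rule soa_model_if_sat[where \<nu> = \<nu> and \<sigma> = \<sigma>]) (use sat S(1) in auto)
  have "sat \<nu> \<sigma> \<theta>" by (rule valid) unfold_locales
  moreover have "sat \<nu> \<sigma> (\<^bold>\<not> \<theta>)" using sat S(1) by blast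
  ultimately show False by simp
qed

section \<open>The theorem as a proper sentence\<close>

lemma clean_AllR [simp]: "clean (\<^bold>\<forall>\<^sub>Rxs. \<phi>) \<longleftrightarrow> set xs \<inter> reserved = {} \<and> clean \<phi>"
  by (induction xs) (auto simp: AllR_def)

lemma clean_ExR [simp]: "clean (\<^bold>\<exists>\<^sub>Rxs. \<phi>) \<longleftrightarrow> set xs \<inter> reserved = {} \<and> clean \<phi>"
  by (induction xs) (auto simp: ExR_def)

lemma fvN_AllR [simp]: "fvN (\<^bold>\<forall>\<^sub>Rxs. \<phi>) = fvN \<phi> - set xs"
  by (induction xs) (auto simp: AllR_def)

lemma fvN_ExR [simp]: "fvN (\<^bold>\<exists>\<^sub>Rxs. \<phi>) = fvN \<phi> - set xs"
  by (induction xs) (auto simp: ExR_def)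

lemma proper_statement:
  "proper (for_all_R_structures
     (integral_domain \<^bold>\<and>
      (\<^bold>\<forall>\<^sub>S''A''. sigma_ideal ''A'' \<^bold>\<and> prime_ideal ''A'' \<^bold>\<longrightarrow> principal_ideal ''A'')
      \<^bold>\<longrightarrow> sigma_PID))"
  unfolding proper_def
  apply (intro conjI)
  subgoal
    by (simp add: for_all_R_structures_def integral_domain_def commutative_ring_def unary_op_def
      binary_op_def maps1_def maps2_def sigma_ideal_def sequence_in_R_def prime_ideal_def principal_ideal_def
      in_ideal_def sigma_PID_def unreserved_literals)
  subgoal
    by (simp add: for_all_R_structures_def integral_domain_def commutative_ring_def unary_op_def
      binary_op_def maps1_def maps2_def sigma_ideal_def sequence_in_R_def prime_ideal_def principal_ideal_def
      in_ideal_def sigma_PID_def pair_def Un_Diff insert_Diff_if)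
  subgoal
    by (simp add: for_all_R_structures_def integral_domain_def commutative_ring_def unary_op_def
      binary_op_def maps1_def maps2_def sigma_ideal_def sequence_in_R_def prime_ideal_def principal_ideal_def
      in_ideal_def sigma_PID_def AllR_def ExR_def Un_Diff insert_Diff_if)
  done

theorem theorem6p26:
  "ACA\<^sub>0 \<turnstile> for_all_R_structures
     (integral_domain \<^bold>\<and>
      (\<^bold>\<forall>\<^sub>S''A''. sigma_ideal ''A'' \<^bold>\<and> prime_ideal ''A'' \<^bold>\<longrightarrow> principal_ideal ''A'')
      \<^bold>\<longrightarrow> sigma_PID)"
proof (rule provable_if_valid[OF proper_statement])
  fix n0 n1 :: nat and plus times less sets pn ps \<nu> \<Sigma>
  assume "soa_model n0 n1 plus times less sets pn ps"
  then interpret soa_model n0 n1 plus times less sets pn ps .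
  show "sat \<nu> \<Sigma> (for_all_R_structures
     (integral_domain \<^bold>\<and>
      (\<^bold>\<forall>\<^sub>S''A''. sigma_ideal ''A'' \<^bold>\<and> prime_ideal ''A'' \<^bold>\<longrightarrow> principal_ideal ''A'')
      \<^bold>\<longrightarrow> sigma_PID))"
    unfolding for_all_R_structures_def sat.simps(5-7) sat_derived(2)
    apply (intro ballI allI impI, elim conjE)
    apply (rule sat_sigma_PID)
        apply assumption
       apply simp
      apply simp
     apply simp
    apply (simp only: sat.simps(5-7) sat_derived(2))
    done
qed

end
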